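(* Let $\phi:[0,\infty)^2\to\mathbb R$ be a homogeneous, $\mathbb R$-valued continuous function, and for positive bounded operators let $\phi(\cdot,\cdot)$ denote the Pusz--Woronowicz functional calculus associated with $\phi$. Let $A,B,A_n,B_n\in B(\mathcal H)_+$ ($n\in\mathbb N$) be such that $A_n\searrow A$ and $B_n\searrow B$. Then $\phi(A_n,B_n)$ ($n\in\mathbb N$) and $\phi(A,B)$ are all bounded operators and $$\phi(A_n,B_n)\longrightarrow\phi(A,B)\quad\text{in the strong operator topology}.$$
   Context: $B(\mathcal H)_+$ is the set of positive bounded operators on a (complex) Hilbert space $\mathcal H$. $A_n\searrow A$ means $A_1\ge A_2\ge\cdots$ and $A_n\to A$ in the strong operator topology. Homogeneous: $\phi(\lambda x,\lambda y)=\lambda\phi(x,y)$ for all $\lambda,x,y\ge0$. Pusz--Woronowicz functional calculus (for $\mathbb R$-valued continuous homogeneous $\phi$): for $A,B\in B(\mathcal H)_+$ put $\mathcal H_{A,B}:=\overline{\mathrm{ran}}(A+B)$ and $T_{A,B}:\mathcal H\to\mathcal H_{A,B}$, $T_{A,B}\xi:=(A+B)^{1/2}\xi$. There are unique positive contractions $R_{A,B},S_{A,B}$ on $\mathcal H_{A,B}$ with $R_{A,B}+S_{A,B}=I_{\mathcal H_{A,B}}$, $A=T_{A,B}^*R_{A,B}T_{A,B}$ and $B=T_{A,B}^*S_{A,B}T_{A,B}$. Then $\phi(A,B):=T_{A,B}^*\,\phi(R_{A,B},S_{A,B})\,T_{A,B}$, where $\phi(R_{A,B},S_{A,B})=\int_{[0,1]}\phi(r,1-r)\,dE_{R_{A,B}}(r)$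 with $E_{R_{A,B}}$ the spectral measure of $R_{A,B}$. *)

theory Defs
  imports "HOL-Analysis.Analysis"
begin

text \<open>Complex Hilbert spaces. The inner product is linear in its first argument. The axioms on
  \<open>scaleR\<close> and \<open>norm\<close> say that the real Banach space structure is the one induced by the complex
  structure and the inner product; in particular they give \<open>1 *\<^sub>C x = x\<close> and positive
  definiteness.\<close>

class complex_hilbert = banach +
  fixes scaleC :: "complex \<Rightarrow> 'a \<Rightarrow> 'a"  (infixr \<open>*\<^sub>C\<close> 75)
    and cinner :: "'a \<Rightarrow> 'a \<Rightarrow> complex"
  assumes scaleC_add_right: "c *\<^sub>C (x + y) = c *\<^sub>C x + c *\<^sub>C y"
    and scaleC_add_left: "(c + d) *\<^sub>C x = c *\<^sub>C x + d *\<^sub>C x"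
    and scaleC_scaleC: "c *\<^sub>C d *\<^sub>C x = (c * d) *\<^sub>C x"
    and scaleR_eq_scaleC: "r *\<^sub>R x = complex_of_real r *\<^sub>C x"
    and cinner_commute: "cinner x y = cnj (cinner y x)"
    and cinner_add_left: "cinner (x + y) z = cinner x z + cinner y z"
    and cinner_scaleC_left: "cinner (c *\<^sub>C x) y = c * cinner x y"
    and cinner_self: "cinner x x = complex_of_real ((norm x)\<^sup>2)"

text \<open>An operator on a closed subspace \<open>K\<close> is a function on the whole type of which only the values
  on \<open>K\<close> matter; \<open>K = UNIV\<close> is the case of operators on the whole space.\<close>

definition bounded_op :: "'h::complex_hilbert set \<Rightarrow> ('h \<Rightarrow> 'h) \<Rightarrow> bool" where
  "bounded_op K T \<longleftrightarrow>
     (\<forall>x\<in>K. T x \<in> K) \<and>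
     (\<forall>x\<in>K. \<forall>y\<in>K. T (x + y) = T x + T y) \<and>
     (\<forall>c. \<forall>x\<in>K. T (c *\<^sub>C x) = c *\<^sub>C T x) \<and>
     (\<exists>M. \<forall>x\<in>K. norm (T x) \<le> M * norm x)"

definition positive_op :: "'h::complex_hilbert set \<Rightarrow> ('h \<Rightarrow> 'h) \<Rightarrow> bool" where
  "positive_op K T \<longleftrightarrow> bounded_op K T \<and> (\<forall>x\<in>K. cinner (T x) x \<in> \<real>\<^sub>\<ge>\<^sub>0)"

definition contraction :: "'h::complex_hilbert set \<Rightarrow> ('h \<Rightarrow> 'h) \<Rightarrow> bool" where
  "contraction K T \<longleftrightarrow> bounded_op K T \<and> (\<forall>x\<in>K. norm (T x) \<le> norm x)"

definition orthogonal_projection :: "'h::complex_hilbert set \<Rightarrow> ('h \<Rightarrow> 'h) \<Rightarrow> bool" where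
  "orthogonal_projection K P \<longleftrightarrow> bounded_op K P \<and>
     (\<forall>x\<in>K. P (P x) = P x) \<and> (\<forall>x\<in>K. \<forall>y\<in>K. cinner (P x) y = cinner x (P y))"

definition op_le :: "('h::complex_hilbert \<Rightarrow> 'h) \<Rightarrow> ('h \<Rightarrow> 'h) \<Rightarrow> bool" where
  "op_le A B \<longleftrightarrow> positive_op UNIV (\<lambda>x. B x - A x)"

definition sot_tendsto :: "(nat \<Rightarrow> 'h::complex_hilbert \<Rightarrow> 'h) \<Rightarrow> ('h \<Rightarrow> 'h) \<Rightarrow> bool" where
  "sot_tendsto X Y \<longleftrightarrow> (\<forall>x. (\<lambda>n. X n x) \<longlonglongrightarrow> Y x)"

definition sot_decreasing_to :: "(nat \<Rightarrow> 'h::complex_hilbert \<Rightarrow> 'h) \<Rightarrow> ('h \<Rightarrow> 'h) \<Rightarrow> bool" where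
  "sot_decreasing_to X Y \<longleftrightarrow> (\<forall>n. op_le (X (Suc n)) (X n)) \<and> sot_tendsto X Y"

definition cadjoint :: "('h::complex_hilbert \<Rightarrow> 'h) \<Rightarrow> 'h \<Rightarrow> 'h" where
  "cadjoint T y = (THE z. \<forall>x. cinner z x = cinner y (T x))"

definition op_sqrt :: "('h::complex_hilbert \<Rightarrow> 'h) \<Rightarrow> 'h \<Rightarrow> 'h" where
  "op_sqrt T = (THE Q. positive_op UNIV Q \<and> (\<forall>x. Q (Q x) = T x))"

text \<open>Projection-valued measures on the Borel sets of the real line, acting on the Hilbert space
  \<open>K\<close>; countable additivity is in the strong operator topology.\<close>

definition proj_valued_measure :: "'h::complex_hilbert set \<Rightarrow> (real set \<Rightarrow> 'h \<Rightarrow> 'h) \<Rightarrow> bool" where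
  "proj_valued_measure K E \<longleftrightarrow>
     (\<forall>S\<in>sets borel. orthogonal_projection K (E S)) \<and>
     (\<forall>x\<in>K. E UNIV x = x) \<and>
     (\<forall>S\<in>sets borel. \<forall>S'\<in>sets borel. \<forall>x\<in>K. E (S \<inter> S') x = E S (E S' x)) \<and>
     (\<forall>F :: nat \<Rightarrow> real set. range F \<subseteq> sets borel \<longrightarrow> disjoint_family F \<longrightarrow>
        (\<forall>x\<in>K. (\<lambda>n. E (F n) x) sums E (\<Union>n. F n) x))"

definition pvm_measure :: "(real set \<Rightarrow> 'h::complex_hilbert \<Rightarrow> 'h) \<Rightarrow> 'h \<Rightarrow> real measure" where
  "pvm_measure E x = measure_of UNIV (sets borel) (\<lambda>S. ennreal (Re (cinner (E S x) x)))"

text \<open>\<open>X\<close> is the operator integral \<open>\<integral>\<^sub>S f dE\<close>. By polarization its quadratic form determines it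
  on \<open>K\<close>.\<close>

definition is_pvm_integral ::
    "'h::complex_hilbert set \<Rightarrow> (real set \<Rightarrow> 'h \<Rightarrow> 'h) \<Rightarrow> real set \<Rightarrow> (real \<Rightarrow> real) \<Rightarrow> ('h \<Rightarrow> 'h) \<Rightarrow> bool"
  where
  "is_pvm_integral K E S f X \<longleftrightarrow> bounded_op K X \<and>
     (\<forall>x\<in>K. set_integrable (pvm_measure E x) S f \<and>
        cinner (X x) x = complex_of_real (LINT r:S|pvm_measure E x. f r))"

definition is_spectral_measure ::
    "'h::complex_hilbert set \<Rightarrow> ('h \<Rightarrow> 'h) \<Rightarrow> (real set \<Rightarrow> 'h \<Rightarrow> 'h) \<Rightarrow> bool" where
  "is_spectral_measure K T E \<longleftrightarrow> proj_valued_measure K E \<and>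
     (\<exists>c. \<forall>x\<in>K. E {-c..c} x = x) \<and> is_pvm_integral K E UNIV (\<lambda>r. r) T"

text \<open>The objects below are unique up to their values off \<open>K\<close> and, for the spectral measure, on
  non-Borel sets; \<open>SOME\<close> only fixes these irrelevant values.\<close>

definition pvm_integral ::
    "'h::complex_hilbert set \<Rightarrow> (real set \<Rightarrow> 'h \<Rightarrow> 'h) \<Rightarrow> real set \<Rightarrow> (real \<Rightarrow> real) \<Rightarrow> 'h \<Rightarrow> 'h" where
  "pvm_integral K E S f = (SOME X. is_pvm_integral K E S f X)"

definition spectral_measure ::
    "'h::complex_hilbert set \<Rightarrow> ('h \<Rightarrow> 'h) \<Rightarrow> real set \<Rightarrow> 'h \<Rightarrow> 'h" where
  "spectral_measure K T = (SOME E. is_spectral_measure K T E)"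

definition pw_space :: "('h::complex_hilbert \<Rightarrow> 'h) \<Rightarrow> ('h \<Rightarrow> 'h) \<Rightarrow> 'h set" where
  "pw_space A B = closure (range (\<lambda>x. A x + B x))"

definition pw_T :: "('h::complex_hilbert \<Rightarrow> 'h) \<Rightarrow> ('h \<Rightarrow> 'h) \<Rightarrow> 'h \<Rightarrow> 'h" where
  "pw_T A B = op_sqrt (\<lambda>x. A x + B x)"

text \<open>The map \<open>pw_T A B\<close> takes values in \<open>pw_space A B\<close>, whose inner product is inherited. Hence
  the adjoint of \<open>pw_T A B\<close> as a map into \<open>pw_space A B\<close> is \<open>cadjoint (pw_T A B)\<close> restricted to
  that subspace.\<close>

definition is_pw_pair ::
    "('h::complex_hilbert \<Rightarrow> 'h) \<Rightarrow> ('h \<Rightarrow> 'h) \<Rightarrow> ('h \<Rightarrow> 'h) \<times> ('h \<Rightarrow> 'h) \<Rightarrow> bool" where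
  "is_pw_pair A B = (\<lambda>(R, S).
     positive_op (pw_space A B) R \<and> contraction (pw_space A B) R \<and>
     positive_op (pw_space A B) S \<and> contraction (pw_space A B) S \<and>
     (\<forall>x\<in>pw_space A B. R x + S x = x) \<and>
     (\<forall>x. A x = cadjoint (pw_T A B) (R (pw_T A B x))) \<and>
     (\<forall>x. B x = cadjoint (pw_T A B) (S (pw_T A B x))))"

definition pw_R :: "('h::complex_hilbert \<Rightarrow> 'h) \<Rightarrow> ('h \<Rightarrow> 'h) \<Rightarrow> 'h \<Rightarrow> 'h" where
  "pw_R A B = fst (SOME p. is_pw_pair A B p)"

text \<open>Pusz--Woronowicz functional calculus: \<open>T\<^sup>* (\<integral>\<^bsub>[0,1]\<^esub> \<phi>(r, 1 - r) dE\<^sub>R(r)) T\<close>, where \<open>S = I - R\<close>.\<close>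

definition pw_calculus ::
    "(real \<times> real \<Rightarrow> real) \<Rightarrow> ('h::complex_hilbert \<Rightarrow> 'h) \<Rightarrow> ('h \<Rightarrow> 'h) \<Rightarrow> 'h \<Rightarrow> 'h" where
  "pw_calculus \<phi> A B x =
     cadjoint (pw_T A B)
       (pvm_integral (pw_space A B) (spectral_measure (pw_space A B) (pw_R A B)) {0..1}
          (\<lambda>r. \<phi> (r, 1 - r)) (pw_T A B x))"

text \<open>Only the values of \<open>\<phi>\<close> on the closed first quadrant matter.\<close>

definition homogeneous :: "(real \<times> real \<Rightarrow> real) \<Rightarrow> bool" where
  "homogeneous \<phi> \<longleftrightarrow> (\<forall>l\<ge>0. \<forall>x\<ge>0. \<forall>y\<ge>0. \<phi> (l * x, l * y) = l * \<phi> (x, y))"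

end

theory Submission imports Defs
begin

text \<open>Write \<open>T = (A + B)\<^sup>1\<^sup>/\<^sup>2\<close>, \<open>R\<close> for the Pusz--Woronowicz contraction of \<open>(A, B)\<close>, and \<open>T\<^sub>n, R\<^sub>n\<close>
  for those of \<open>(A\<^sub>n, B\<^sub>n)\<close>. Then \<open>T\<^sub>n \<rightarrow> T\<close> strongly, because the square root is a limit of
  polynomials uniformly on bounded sets. Weierstrass approximation of \<open>r \<mapsto> \<phi>(r, 1 - r)\<close> on \<open>[0, 1]\<close>
  reduces the claim to \<open>R\<^sub>n\<^sup>k T\<^sub>n x \<rightarrow> R\<^sup>k T x\<close>. From \<open>T\<^sub>n R\<^sub>n T\<^sub>n = A\<^sub>n \<rightarrow> A\<close> one gets weak convergence
  \<open>R\<^sub>n T\<^sub>n x \<rightarrow> R T x\<close>, tested against the range of \<open>T\<close>. The operator \<open>T\<^sub>n R\<^sub>n (1 - R\<^sub>n) T\<^sub>n\<close> is the parallel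
  sum of \<open>A\<^sub>n\<close> and \<open>B\<^sub>n\<close>, whose quadratic form is \<open>inf\<^sub>y \<langle>A\<^sub>n y, y\<rangle> + \<langle>B\<^sub>n (x - y), x - y\<rangle>\<close>; for
  decreasing sequences it converges to that of \<open>A\<close> and \<open>B\<close>, whence \<open>\<parallel>R\<^sub>n T\<^sub>n x\<parallel> \<rightarrow> \<parallel>R T x\<parallel>\<close> and the
  convergence is strong. Density of the range of \<open>T\<close> then gives \<open>R\<^sub>n u\<^sub>n \<rightarrow> R u\<close> whenever \<open>u\<^sub>n \<rightarrow> u\<close>
  within the respective subspaces, and so the statement for all \<open>k\<close>.\<close>

section \<open>The real inner product and the Riesz representation\<close>

text \<open>The contractions \<open>R_n\<close> act on closed subspaces that vary with n, so strong
  convergence of \<open>R_n\<close> itself has no meaning. Every convergence statement concerns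
  vectors lying in the matching subspaces, in the first place \<open>R_n T_n x\<close>. Weak
  convergence would not pass to powers, because products are not weakly continuous; it is upgraded
  by convergence of norms, which are accessible because ||R_n T_n x||^2 is <A_n x, x> minus the form
  of the parallel sum. A second obstacle is that the pair, the spectral measure and the operator
  integral are all fixed by choice operators. Their existence has to be proved, which takes a
  spectral theorem for positive contractions on a closed subspace. Afterwards only the defining
  properties of the chosen objects are available: the spectral measure is tied to \<open>R\<close>
  through quadratic forms alone, so invariance of its ranges under \<open>R\<close>, its support in
  [0, 1] and the integral formula for powers must all be derived from these forms.\<close>

text \<open>Operators are treated as real-linear maps for the real inner product \<open>rin\<close>; complex linearity is
  recovered as commutation with scalar multiplications.\<close>

definition rin :: "'h::complex_hilbert \<Rightarrow> 'h \<Rightarrow> real" where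
  "rin x y = Re (cinner x y)"

lemma rin_commute: "rin x y = rin y x"
  by (metis cinner_commute cnj.simps(1) rin_def)

lemma rin_self: "rin x x = (norm x)\<^sup>2"
  by (simp add: rin_def cinner_self)

lemma rin_add_left: "rin (x + y) z = rin x z + rin y z"
  by (simp add: rin_def cinner_add_left)

lemma rin_add_right: "rin z (x + y) = rin z x + rin z y"
  by (metis rin_add_left rin_commute)

lemma rin_scaleR_left: "rin (r *\<^sub>R x) y = r * rin x y"
  by (simp add: rin_def scaleR_eq_scaleC cinner_scaleC_left)

lemma rin_scaleR_right: "rin x (r *\<^sub>R y) = r * rin x y"
  by (metis rin_scaleR_left rin_commute)

lemma rin_minus_left: "rin (- x) y = - rin x y"
  using rin_scaleR_left[of "-1" x y] by simp

lemma rin_minus_right: "rin x (- y) = - rin x y"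
  by (metis rin_minus_left rin_commute)

lemma rin_diff_left: "rin (x - y) z = rin x z - rin y z"
  using rin_add_left[of x "- y" z] by (simp add: rin_minus_left)

lemma rin_diff_right: "rin z (x - y) = rin z x - rin z y"
  by (metis rin_diff_left rin_commute)

lemmas rin_simps = rin_add_left rin_add_right rin_diff_left rin_diff_right
  rin_scaleR_left rin_scaleR_right rin_minus_left rin_minus_right

lemma rin_zero [simp]: "rin 0 x = 0" "rin x 0 = 0"
  using rin_diff_left[of 0 0 x] rin_diff_right[of x 0 0] by auto

lemma norm_add_sq: "(norm (x + y))\<^sup>2 = (norm x)\<^sup>2 + 2 * rin x y + (norm y)\<^sup>2"
  unfolding rin_self[symmetric] rin_simps by (simp add: rin_commute)

lemma norm_diff_sq: "(norm (x - y))\<^sup>2 = (norm x)\<^sup>2 - 2 * rin x y + (norm y)\<^sup>2"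
  unfolding rin_self[symmetric] rin_simps by (simp add: rin_commute)

lemma rin_cauchy_schwarz: "\<bar>rin x y\<bar> \<le> norm x * norm y"
proof (cases "x = 0 \<or> y = 0")
  case False
  have *: "rin u v \<le> norm u * norm v" if "u \<noteq> 0" "v \<noteq> 0" for u v :: 'a
  proof -
    have "0 \<le> (norm (norm v *\<^sub>R u - norm u *\<^sub>R v))\<^sup>2" by simp
    also have "\<dots> = 2 * (norm u * norm v) * (norm u * norm v - rin u v)"
      unfolding norm_diff_sq rin_simps by (simp add: power2_eq_square algebra_simps)
    finally show ?thesis using that by (smt (verit) mult_pos_pos mult_pos_neg zero_less_norm_iff)
  qed
  from *[of x y] *[of "-x" y] False show ?thesis by (simp add: rin_minus_left)
qed auto

lemma bounded_bilinear_rin: "bounded_bilinear rin"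
  by (standard, simp_all add: rin_simps) (metis mult.right_neutral rin_cauchy_schwarz)

lemmas tendsto_rin = bounded_bilinear.tendsto[OF bounded_bilinear_rin]
lemmas sums_rin_left = bounded_linear.sums[OF bounded_bilinear.bounded_linear_left[OF bounded_bilinear_rin]]
lemmas sums_rin_right = bounded_linear.sums[OF bounded_bilinear.bounded_linear_right[OF bounded_bilinear_rin]]
lemmas rin_sum_left = bounded_bilinear.sum_left[OF bounded_bilinear_rin]
lemmas rin_sum_right = bounded_bilinear.sum_right[OF bounded_bilinear_rin]

lemma rin_eqI:
  assumes "\<And>y. rin x y = rin z y" shows "x = z"
proof -
  have "(norm (x - z))\<^sup>2 = 0"
    using assms[of "x - z"] by (simp only: rin_self[symmetric] rin_diff_left)
  then show ?thesis by simp
qed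

lemma cinner_scaleC_right: "cinner x (c *\<^sub>C y) = cnj c * cinner x y"
  by (metis cinner_commute cinner_scaleC_left complex_cnj_mult)

lemma rin_scaleC_left: "rin (c *\<^sub>C x) y = rin x (cnj c *\<^sub>C y)"
  by (simp add: rin_def cinner_scaleC_left cinner_scaleC_right)

lemma cinner_eq_rin: "cinner x y = Complex (rin x y) (rin x (\<i> *\<^sub>C y))"
  by (simp add: rin_def cinner_scaleC_right complex_eq_iff)

lemma norm_scaleC: "norm (c *\<^sub>C x) = cmod c * norm x"
proof -
  have "complex_of_real ((norm (c *\<^sub>C x))\<^sup>2) = c * (cnj c * cinner x x)"
    unfolding cinner_self[symmetric] cinner_scaleC_left cinner_scaleC_right by (simp only: mult.left_commute mult.commute)
  also have "\<dots> = complex_of_real ((cmod c * norm x)\<^sup>2)"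
    by (simp add: cinner_self power_mult_distrib complex_norm_square[of c, simplified of_real_power, symmetric] mult.assoc[symmetric])
  finally show ?thesis
    by (metis of_real_eq_iff norm_ge_zero mult_nonneg_nonneg power2_eq_iff_nonneg)
qed

lemma scaleC_scaleR_commute: "c *\<^sub>C (r *\<^sub>R x) = r *\<^sub>R (c *\<^sub>C x)"
  by (simp add: scaleR_eq_scaleC scaleC_scaleC mult.commute)

lemma bounded_linear_scaleC: "bounded_linear (\<lambda>x. c *\<^sub>C x)"
  by (rule bounded_linear_intro[where K = "cmod c"])
    (simp_all add: scaleC_add_right scaleC_scaleR_commute norm_scaleC mult.commute)

lemma norm_le_of_sq_le: "(norm x)\<^sup>2 \<le> M * norm x \<Longrightarrow> 0 \<le> M \<Longrightarrow> norm x \<le> M"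
  by (metis mult_le_cancel_right norm_ge_zero order.order_iff_strict power2_eq_square norm_zero not_le)

text \<open>First-order condition at a minimum at s = 0. The exact minimizer -a/(2b) is replaced by
  -a/(b + 1), which makes sense for b = 0 as well.\<close>

lemma real_linear_coeff_zero:
  fixes a b :: real
  assumes "\<And>s. 0 \<le> s * a + s\<^sup>2 * b" "0 \<le> b"
  shows "a = 0"
proof (rule ccontr)
  assume a: "a \<noteq> 0"
  have b: "b + 1 \<noteq> 0" using assms(2) by simp
  have "0 \<le> (- a / (b + 1)) * a + (- a / (b + 1))\<^sup>2 * b" by (rule assms)
  also have "\<dots> = - (a\<^sup>2 / (b + 1)\<^sup>2)"
    using b by (simp add: divide_simps) (simp add: power2_eq_square algebra_simps)
  finally have "a\<^sup>2 / (b + 1)\<^sup>2 \<le> 0" by simp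
  moreover have "a\<^sup>2 / (b + 1)\<^sup>2 > 0" using a assms(2) by simp
  ultimately show False by simp
qed

section \<open>Closed ranges: representation of functionals and orthogonal projections\<close>

lemma closure_limI: "(\<And>n. s n \<in> S) \<Longrightarrow> s \<longlonglongrightarrow> v \<Longrightarrow> v \<in> closure S"
  for v :: "'a::first_countable_topology"
  unfolding closure_sequential by (intro exI[of _ s]) simp

lemma closure_limE:
  fixes v :: "'a::first_countable_topology"
  assumes "v \<in> closure S"
  obtains s where "\<forall>n. s n \<in> S" "s \<longlonglongrightarrow> v"
  using assms unfolding closure_sequential by (elim exE conjE)

text \<open>The vector \<open>v\<close> is the limit of \<open>T y\<^sub>n\<close> for a minimizing sequence of \<open>\<parallel>T y\<parallel>\<^sup>2 - 2 f y\<close>.\<close>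

lemma riesz_range:
  fixes T :: "'h::complex_hilbert \<Rightarrow> 'h"
  assumes T: "bounded_linear T" and f: "linear f" and M: "0 \<le> M"
    and bd: "\<And>y. \<bar>f y\<bar> \<le> M * norm (T y)"
  shows "\<exists>v\<in>closure (range T). (\<forall>y. rin v (T y) = f y) \<and> norm v \<le> M"
proof -
  interpret T: bounded_linear T by (rule T)
  define J where "J y = (norm (T y))\<^sup>2 - 2 * f y" for y
  have fa: "f (x + y) = f x + f y" and fs: "f (r *\<^sub>R x) = r * f x" for x y r
    using f by (auto simp: linear_add linear_cmul)
  have fd: "f (x - y) = f x - f y" for x y
    using f by (rule linear_diff)
  have Jbd: "- M\<^sup>2 \<le> J y" for y
  proof -
    have "0 \<le> (norm (T y) - M)\<^sup>2" by simp
    then show ?thesis using bd[of y] by (simp add: J_def power2_diff algebra_simps)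
  qed
  have bb: "bdd_below (range J)" using Jbd by (auto simp: bdd_below_def)
  define I where "I = Inf (range J)"
  have I: "I \<le> J y" for y unfolding I_def by (rule cInf_lower) (use bb in auto)
  have "\<exists>y. J y < I + 1 / Suc n" for n
    using cInf_lessD[of "range J" "I + 1 / Suc n"] by (auto simp: I_def)
  then obtain y where y: "\<And>n. J (y n) < I + 1 / Suc n" by metis
  \<comment> \<open>Parallelogram law for \<open>J\<close>: the linear part cancels, and the
    midpoint has \<open>J\<close>-value at least \<open>I\<close>. Only the images
    \<open>T (y n)\<close> are controlled; the \<open>y n\<close> themselves need not
    converge.\<close>
  have par: "(norm (T (y n) - T (y m)))\<^sup>2 \<le> 2 / Suc n + 2 / Suc m" for n m
  proof -
    have "(norm (T (y n) - T (y m)))\<^sup>2 = 2 * J (y n) + 2 * J (y m) - 4 * J ((1/2) *\<^sub>R (y n + y m))"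
      unfolding J_def T.scaleR T.add fs fa norm_scaleR power_mult_distrib norm_add_sq norm_diff_sq
      by (simp add: power2_eq_square field_simps)
    with y[of n] y[of m] I[of "(1/2) *\<^sub>R (y n + y m)"] show ?thesis by simp
  qed
  have "Cauchy (\<lambda>n. T (y n))"
  proof (rule metric_CauchyI)
    fix e :: real assume e: "0 < e"
    obtain N :: nat where N: "4 / e\<^sup>2 < real N" using reals_Archimedean2 by blast
    show "\<exists>N. \<forall>m\<ge>N. \<forall>n\<ge>N. dist (T (y m)) (T (y n)) < e"
    proof (intro exI allI impI)
      fix m n assume mn: "N \<le> m" "N \<le> n"
      have N0: "0 < real N" using N e by (smt (verit) divide_pos_pos zero_less_power)
      have "2 / Suc m + 2 / Suc n \<le> 2 / N + 2 / N"
        using mn N0 by (intro add_mono divide_left_mono) auto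
      also have "\<dots> < e\<^sup>2" using N N0 e by (simp add: field_simps)
      finally have "(norm (T (y m) - T (y n)))\<^sup>2 < e\<^sup>2" using par[of m n] by simp
      then show "dist (T (y m)) (T (y n)) < e"
        using e by (simp add: dist_norm power2_less_imp_less)
    qed
  qed
  then obtain v where v: "(\<lambda>n. T (y n)) \<longlonglongrightarrow> v"
    by (auto simp: Cauchy_convergent_iff convergent_def)
  have vc: "v \<in> closure (range T)"
    by (rule closure_limI[OF _ v]) simp
  have vf: "rin v (T z) = f z" for z
  proof -
    have "0 \<le> s * (2 * (rin v (T z) - f z)) + s\<^sup>2 * (norm (T z))\<^sup>2" for s
    proof (rule LIMSEQ_le_const)
      show "(\<lambda>n. 1 / Suc n + s * (2 * (rin (T (y n)) (T z) - f z)) + s\<^sup>2 * (norm (T z))\<^sup>2)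
        \<longlonglongrightarrow> s * (2 * (rin v (T z) - f z)) + s\<^sup>2 * (norm (T z))\<^sup>2"
      proof -
        have "(\<lambda>n. 1 / real (Suc n)) \<longlonglongrightarrow> 0"
          using LIMSEQ_inverse_real_of_nat by (simp add: inverse_eq_divide)
        then have "(\<lambda>n. 1 / Suc n + s * (2 * (rin (T (y n)) (T z) - f z)) + s\<^sup>2 * (norm (T z))\<^sup>2)
          \<longlonglongrightarrow> 0 + s * (2 * (rin v (T z) - f z)) + s\<^sup>2 * (norm (T z))\<^sup>2"
          by (intro tendsto_intros tendsto_rin v)
        then show ?thesis by simp
      qed
      have "J (y n + s *\<^sub>R z) = J (y n) + s * (2 * (rin (T (y n)) (T z) - f z)) + s\<^sup>2 * (norm (T z))\<^sup>2" for n
        by (simp add: J_def T.add T.scaleR norm_add_sq fa fs rin_simps power_mult_distrib algebra_simps)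
      then have "0 \<le> 1 / Suc n + s * (2 * (rin (T (y n)) (T z) - f z)) + s\<^sup>2 * (norm (T z))\<^sup>2" for n
        using I[of "y n + s *\<^sub>R z"] y[of n] by (smt (verit))
      then show "\<exists>N. \<forall>n\<ge>N. 0 \<le> 1 / Suc n + s * (2 * (rin (T (y n)) (T z) - f z)) + s\<^sup>2 * (norm (T z))\<^sup>2"
        by blast
    qed
    then have "2 * (rin v (T z) - f z) = 0" by (rule real_linear_coeff_zero) simp
    then show ?thesis by simp
  qed
  \<comment> \<open>The norm bound comes from testing \<open>v\<close> against the vectors
    \<open>T (y n)\<close> that converge to it.\<close>
  have "(norm v)\<^sup>2 \<le> M * norm v"
  proof (rule LIMSEQ_le)
    show "(\<lambda>n. rin v (T (y n))) \<longlonglongrightarrow> (norm v)\<^sup>2"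
      using tendsto_rin[OF tendsto_const v, of v] by (simp add: rin_self)
    show "(\<lambda>n. M * norm (T (y n))) \<longlonglongrightarrow> M * norm v"
      by (intro tendsto_intros v)
    show "\<exists>N. \<forall>n\<ge>N. rin v (T (y n)) \<le> M * norm (T (y n))"
      using bd vf by (metis abs_le_D1)
  qed
  then have "norm v \<le> M" using M by (rule norm_le_of_sq_le)
  with vc vf show ?thesis by blast
qed

lemma rin_closure_eq:
  assumes "\<And>y. y \<in> S \<Longrightarrow> rin v y = rin w y" "y \<in> closure S"
  shows "rin v y = rin w y"
proof -
  obtain s where s: "\<forall>n. s n \<in> S" "s \<longlonglongrightarrow> y"
    by (rule closure_limE[OF assms(2)])
  have "(\<lambda>n. rin v (s n)) \<longlonglongrightarrow> rin v y" by (intro tendsto_rin tendsto_const s)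
  moreover have "(\<lambda>n. rin v (s n)) \<longlonglongrightarrow> rin w y"
    unfolding assms(1)[OF s(1)[rule_format]] by (intro tendsto_rin tendsto_const s)
  ultimately show ?thesis by (rule LIMSEQ_unique)
qed

text \<open>The difference v - w lies in the closed range and is orthogonal to it. Equations between
  vectors of the closed range are therefore always checked against vectors \<open>T y\<close>
  only.\<close>

lemma closure_range_eqI:
  assumes "v \<in> closure (range T)" "w \<in> closure (range T)" "\<And>y. rin v (T y) = rin w (T y)"
  shows "v = w"
proof -
  have "rin v y = rin w y" if "y \<in> closure (range T)" for y
    by (rule rin_closure_eq[OF _ that]) (use assms(3) in auto)
  then have "rin (v - w) v = 0" "rin (v - w) w = 0"
    using assms by (simp_all add: rin_diff_left)
  then have "(norm (v - w))\<^sup>2 = 0" by (simp add: rin_self[symmetric] rin_diff_right)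
  then show ?thesis by simp
qed

lemma closure_range_add:
  fixes T :: "'h::complex_hilbert \<Rightarrow> 'h"
  assumes "bounded_linear T" "x \<in> closure (range T)" "y \<in> closure (range T)"
  shows "x + y \<in> closure (range T)"
proof -
  interpret bounded_linear T by (rule assms)
  obtain s where s: "\<forall>n. s n \<in> range T" "s \<longlonglongrightarrow> x" by (rule closure_limE[OF assms(2)])
  obtain t where t: "\<forall>n. t n \<in> range T" "t \<longlonglongrightarrow> y" by (rule closure_limE[OF assms(3)])
  have "s n + t n \<in> range T" for n
  proof -
    obtain a b where "s n = T a" "t n = T b"
      using spec[OF s(1), of n] spec[OF t(1), of n] by (elim rangeE)
    then show ?thesis by (simp flip: add)
  qed
  then show ?thesis by (rule closure_limI[where s = "\<lambda>n. s n + t n"]) (intro tendsto_add s t)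
qed

lemma closure_range_invariant:
  fixes W T :: "'h::complex_hilbert \<Rightarrow> 'h"
  assumes "bounded_linear W" "\<And>x. W (T x) \<in> range T" "x \<in> closure (range T)"
  shows "W x \<in> closure (range T)"
proof -
  obtain s where s: "\<forall>n. s n \<in> range T" "s \<longlonglongrightarrow> x" by (rule closure_limE[OF assms(3)])
  have "W (s n) \<in> range T" for n
  proof -
    obtain a where "s n = T a" using spec[OF s(1), of n] by (elim rangeE)
    then show ?thesis using assms(2)[of a] by simp
  qed
  then show ?thesis by (rule closure_limI[where s = "\<lambda>n. W (s n)"]) (rule bounded_linear.tendsto[OF assms(1) s(2)])
qed

lemma closure_range_scaleR:
  fixes T :: "'h::complex_hilbert \<Rightarrow> 'h"
  assumes "bounded_linear T" "x \<in> closure (range T)"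
  shows "r *\<^sub>R x \<in> closure (range T)"
  by (rule closure_range_invariant[OF bounded_linear_scaleR_right _ assms(2)])
    (simp flip: linear_cmul[OF bounded_linear.linear[OF assms(1)]])

definition sym_op :: "('h::complex_hilbert \<Rightarrow> 'h) \<Rightarrow> bool" where
  "sym_op T \<longleftrightarrow> bounded_linear T \<and> (\<forall>x y. rin (T x) y = rin x (T y))"

definition oproj :: "('h::complex_hilbert \<Rightarrow> 'h) \<Rightarrow> bool" where
  "oproj P \<longleftrightarrow> sym_op P \<and> (\<forall>x. P (P x) = P x)"

lemma oproj_rin: assumes "oproj P" shows "rin (P x) x = (norm (P x))\<^sup>2"
  using assms unfolding oproj_def sym_op_def rin_self[symmetric] by metis

lemma oproj_norm_le: assumes "oproj P" shows "norm (P x) \<le> norm x"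
proof -
  have "(norm (P x))\<^sup>2 \<le> norm x * norm (P x)"
    using rin_cauchy_schwarz[of "P x" x] oproj_rin[OF assms, of x] by (simp add: mult.commute)
  then show ?thesis by (rule norm_le_of_sq_le) simp
qed

text \<open>Commuting with \<open>P\<close> requires that \<open>W\<close> leave both the closed
  range and its orthogonal complement invariant. The latter is invariance of the closed range under
  the adjoint, which is why the last clause speaks of a pair \<open>W\<close>,
  \<open>W'\<close>.\<close>

lemma range_projection:
  fixes T :: "'h::complex_hilbert \<Rightarrow> 'h"
  assumes T: "bounded_linear T"
  shows "\<exists>P. oproj P \<and> (\<forall>x. P x \<in> closure (range T)) \<and>
    (\<forall>x\<in>closure (range T). P x = x) \<and> (\<forall>x y. rin (P x) (T y) = rin x (T y)) \<and>
    (\<forall>W W'. bounded_linear W \<longrightarrow> (\<forall>x y. rin (W x) y = rin x (W' y)) \<longrightarrow>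
      (\<forall>x. W (T x) = T (W x)) \<longrightarrow> (\<forall>x. W' (T x) = T (W' x)) \<longrightarrow> (\<forall>x. W (P x) = P (W x)))"
proof -
  interpret T: bounded_linear T by (rule T)
  have "\<exists>v\<in>closure (range T). (\<forall>y. rin v (T y) = rin x (T y)) \<and> norm v \<le> norm x" for x
    by (rule riesz_range[OF T])
      (auto simp: rin_cauchy_schwarz T.add T.scaleR rin_simps intro!: linearI)
  then obtain P where Pc: "\<And>x. P x \<in> closure (range T)"
    and Pr: "\<And>x y. rin (P x) (T y) = rin x (T y)" and Pn: "\<And>x. norm (P x) \<le> norm x"
    by metis
  have Pid: "P x = x" if "x \<in> closure (range T)" for x
    using Pc that Pr by (rule closure_range_eqI)
  have Prc: "rin (P x) y = rin x y" if "y \<in> closure (range T)" for x y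
    using _ that by (rule rin_closure_eq) (use Pr in auto)
  have lin: "bounded_linear P"
  proof (rule bounded_linear_intro[where K = 1])
    show "P (x + y) = P x + P y" for x y
      by (rule closure_range_eqI[OF Pc]) (auto simp: Pr rin_simps intro: closure_range_add T Pc)
    show "P (r *\<^sub>R x) = r *\<^sub>R P x" for r x
      by (rule closure_range_eqI[OF Pc]) (auto simp: Pr rin_simps intro: closure_range_scaleR T Pc)
    show "norm (P x) \<le> norm x * 1" for x using Pn by simp
  qed
  have "rin (P x) y = rin x (P y)" for x y
    using Prc[OF Pc, of y x] Prc[OF Pc, of x y] rin_commute by metis
  then have op: "oproj P" using lin Pid Pc by (auto simp: oproj_def sym_op_def)
  have com: "W (P x) = P (W x)" if W: "bounded_linear W" "\<And>x y. rin (W x) y = rin x (W' y)"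
    "\<And>x. W (T x) = T (W x)" "\<And>x. W' (T x) = T (W' x)" for W W' x
  proof (rule closure_range_eqI)
    show "P (W x) \<in> closure (range T)" by (rule Pc)
    show "W (P x) \<in> closure (range T)"
      by (rule closure_range_invariant[OF W(1) _ Pc]) (simp add: W(3))
    show "rin (W (P x)) (T y) = rin (P (W x)) (T y)" for y
      by (simp add: Pr W)
  qed
  with op Pc Pid Pr show ?thesis by (intro exI[of _ P] conjI allI impI ballI) auto
qed

section \<open>Square roots of positive operators\<close>

definition pos_sym :: "('h::complex_hilbert \<Rightarrow> 'h) \<Rightarrow> bool" where
  "pos_sym T \<longleftrightarrow> sym_op T \<and> (\<forall>x. 0 \<le> rin (T x) x)"

text \<open>This is \<open>T^2 \<le> M T\<close>, obtained without functional calculus: expand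
  \<open>T (1 - T/M)^2 \<ge> 0\<close> and bound the cubic term by \<open>T^3 \<le> M T^2\<close>,
  which is the hypothesis applied to \<open>T x\<close>.\<close>

lemma pos_sym_norm_sq:
  assumes T: "pos_sym T" and M: "0 < M" "\<And>x. rin (T x) x \<le> M * (norm x)\<^sup>2"
  shows "(norm (T x))\<^sup>2 \<le> M * rin (T x) x"
proof -
  from T interpret bounded_linear T by (simp add: pos_sym_def sym_op_def)
  have sym: "rin (T x) y = rin x (T y)" for x y using T by (simp add: pos_sym_def sym_op_def)
  have "0 \<le> rin (T (x - (1/M) *\<^sub>R T x)) (x - (1/M) *\<^sub>R T x)"
    using T by (simp add: pos_sym_def)
  also have "\<dots> = rin (T x) x - 2 * (1/M) * (norm (T x))\<^sup>2 + (1/M)\<^sup>2 * rin (T (T x)) (T x)"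
    unfolding diff scaleR rin_simps sym[of "T x" x] rin_self
    by (simp add: power2_eq_square diff_divide_distrib)
  also have "\<dots> \<le> rin (T x) x - 2 * (1/M) * (norm (T x))\<^sup>2 + (1/M)\<^sup>2 * (M * (norm (T x))\<^sup>2)"
    by (intro add_left_mono mult_left_mono M) simp
  also have "\<dots> = (M * rin (T x) x - (norm (T x))\<^sup>2) / M"
    using M(1) by (simp add: field_simps power2_eq_square)
  finally show ?thesis using M(1) by (simp add: zero_le_divide_iff)
qed

lemma bounded_linear_rin_bound:
  assumes "bounded_linear T"
  shows "\<exists>M>0. (\<forall>x. \<bar>rin (T x) x\<bar> \<le> M * (norm x)\<^sup>2) \<and> (\<forall>x. norm (T x) \<le> M * norm x)"
proof -
  obtain K where K: "0 < K" "\<And>x. norm (T x) \<le> norm x * K"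
    using bounded_linear.pos_bounded[OF assms] by blast
  have "\<bar>rin (T x) x\<bar> \<le> K * (norm x)\<^sup>2" for x
  proof -
    have "\<bar>rin (T x) x\<bar> \<le> norm (T x) * norm x" by (rule rin_cauchy_schwarz)
    also have "\<dots> \<le> (norm x * K) * norm x" by (intro mult_right_mono K) simp
    finally show ?thesis by (simp add: power2_eq_square ac_simps)
  qed
  with K show ?thesis by (intro exI[of _ K]) (auto simp: mult.commute)
qed

lemma pos_sym_zero:
  assumes T: "pos_sym T" and "rin (T x) x = 0"
  shows "T x = 0"
proof -
  obtain M where M: "0 < M" "\<And>x. \<bar>rin (T x) x\<bar> \<le> M * (norm x)\<^sup>2"
    using bounded_linear_rin_bound[of T] T unfolding pos_sym_def sym_op_def by blast
  have "(norm (T x))\<^sup>2 \<le> M * rin (T x) x"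
    by (rule pos_sym_norm_sq[OF T M(1)]) (use M(2) in \<open>auto intro: order_trans[OF abs_ge_self]\<close>)
  with assms(2) show ?thesis by simp
qed

text \<open>The iterates converge to \<open>1 - (1 - Z)\<^sup>1\<^sup>/\<^sup>2\<close> at the rate of the scalar iteration at \<open>Z = 1\<close>, whatever
  the contraction \<open>Z\<close>. This uniformity makes the square root strongly continuous on bounded sets.\<close>

fun sqrt_iter :: "('h::complex_hilbert \<Rightarrow> 'h) \<Rightarrow> nat \<Rightarrow> 'h \<Rightarrow> 'h" where
  "sqrt_iter Z 0 = (\<lambda>x. 0)"
| "sqrt_iter Z (Suc k) = (\<lambda>x. (1/2) *\<^sub>R (Z x + sqrt_iter Z k (sqrt_iter Z k x)))"

fun sqrt_rate :: "nat \<Rightarrow> real" where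
  "sqrt_rate 0 = 0"
| "sqrt_rate (Suc k) = (1 + (sqrt_rate k)\<^sup>2) / 2"

lemma sqrt_rate_bounds: "0 \<le> sqrt_rate k \<and> sqrt_rate k \<le> 1"
  by (induction k) (auto simp: power_le_one)

lemma sqrt_rate_Suc_ge: "sqrt_rate k \<le> sqrt_rate (Suc k)"
proof -
  have "0 \<le> (sqrt_rate k - 1)\<^sup>2" by simp
  then show ?thesis by (simp add: power2_diff)
qed

lemma sqrt_rate_mono: "k \<le> m \<Longrightarrow> sqrt_rate k \<le> sqrt_rate m"
  using sqrt_rate_Suc_ge by (rule lift_Suc_mono_le)

lemma sqrt_rate_tendsto: "sqrt_rate \<longlonglongrightarrow> 1"
proof -
  have "convergent sqrt_rate"
    by (rule Bseq_mono_convergent)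
      (use sqrt_rate_bounds sqrt_rate_mono in \<open>auto intro!: BseqI'[where K = 1]\<close>)
  then obtain l where l: "sqrt_rate \<longlonglongrightarrow> l" by (auto simp: convergent_def)
  have "(\<lambda>k. sqrt_rate (Suc k)) \<longlonglongrightarrow> (1 + l\<^sup>2) / 2"
    unfolding sqrt_rate.simps by (intro tendsto_intros l) simp
  with l have "l = (1 + l\<^sup>2) / 2" using LIMSEQ_Suc LIMSEQ_unique by blast
  then have "(l - 1)\<^sup>2 = 0" by (simp add: power2_diff)
  with l show ?thesis by simp
qed

context
  fixes Z :: "'h::complex_hilbert \<Rightarrow> 'h"
  assumes Z: "sym_op Z" "\<And>x. norm (Z x) \<le> norm x"
begin

lemma sqrt_iter_bounded_linear: "bounded_linear (sqrt_iter Z k)"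
proof (induction k)
  case (Suc k)
  show ?case unfolding sqrt_iter.simps
    by (intro bounded_linear_const_scaleR bounded_linear_add bounded_linear_compose[OF Suc Suc])
      (use Z in \<open>simp add: sym_op_def\<close>)
qed simp

lemmas sqrt_iter_linear = bounded_linear.linear[OF sqrt_iter_bounded_linear]

lemma sqrt_iter_commute:
  assumes "linear W" "\<And>x. W (Z x) = Z (W x)"
  shows "W (sqrt_iter Z k x) = sqrt_iter Z k (W x)"
proof (induction k arbitrary: x)
  case 0
  then show ?case using linear_0[OF assms(1)] by simp
next
  case (Suc k)
  then show ?case by (simp add: linear_add[OF assms(1)] linear_cmul[OF assms(1)] assms(2))
qed

lemma sqrt_iter_commute_iter: "sqrt_iter Z j (sqrt_iter Z k x) = sqrt_iter Z k (sqrt_iter Z j x)"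
  by (intro sqrt_iter_commute sqrt_iter_linear
      sqrt_iter_commute[symmetric] bounded_linear.linear) (use Z in \<open>auto simp: sym_op_def\<close>)

lemma sqrt_iter_sym: "rin (sqrt_iter Z k x) y = rin x (sqrt_iter Z k y)"
proof (induction k arbitrary: x y)
  case (Suc k)
  have "rin (Z x) y = rin x (Z y)" using Z by (simp add: sym_op_def)
  with Suc show ?case by (simp add: rin_simps)
qed simp

lemma sqrt_iter_norm: "norm (sqrt_iter Z k x) \<le> sqrt_rate k * norm x"
proof (induction k arbitrary: x)
  case (Suc k)
  have "norm (sqrt_iter Z k (sqrt_iter Z k x)) \<le> sqrt_rate k * (sqrt_rate k * norm x)"
    by (rule order_trans[OF Suc]) (intro mult_left_mono Suc, use sqrt_rate_bounds in auto)
  then show ?case using norm_triangle_ineq[of "Z x" "sqrt_iter Z k (sqrt_iter Z k x)"] Z(2)[of x]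
    unfolding sqrt_iter.simps norm_scaleR by (simp add: power2_eq_square algebra_simps)
qed simp

text \<open>The iterates commute, so the difference of their squares factors as (Y_(k+1) +
  Y_k)(Y_(k+1) - Y_k). Bounding the first factor by \<open>sqrt_rate\<close> reproduces exactly the
  recursion of the scalar increments.\<close>

lemma sqrt_iter_step:
  "norm (sqrt_iter Z (Suc k) x - sqrt_iter Z k x) \<le> (sqrt_rate (Suc k) - sqrt_rate k) * norm x"
proof (induction k arbitrary: x)
  case 0
  show ?case using Z(2)[of x] by simp
next
  case (Suc k)
  let ?Y = "sqrt_iter Z" and ?y = sqrt_rate
  interpret A: bounded_linear "?Y k" by (rule sqrt_iter_bounded_linear)
  interpret B: bounded_linear "?Y (Suc k)" by (rule sqrt_iter_bounded_linear)
  let ?d = "?Y (Suc k) x - ?Y k x"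
  have "?Y (Suc k) (?Y (Suc k) x) - ?Y k (?Y k x) = ?Y (Suc k) ?d + ?Y k ?d"
    by (simp add: A.diff B.diff sqrt_iter_commute_iter[of k "Suc k"] del: sqrt_iter.simps)
  then have "?Y (Suc (Suc k)) x - ?Y (Suc k) x = (1/2) *\<^sub>R (?Y (Suc k) ?d + ?Y k ?d)"
    unfolding sqrt_iter.simps(2)[of Z "Suc k"] sqrt_iter.simps(2)[of Z k, THEN fun_cong, of x]
    by (metis (no_types, lifting) add_diff_cancel_left scaleR_right_diff_distrib sqrt_iter.simps(2))
  then have "norm (?Y (Suc (Suc k)) x - ?Y (Suc k) x) = (1/2) * norm (?Y (Suc k) ?d + ?Y k ?d)"
    by simp
  also have "\<dots> \<le> (1/2) * (?y (Suc k) * norm ?d + ?y k * norm ?d)"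
    using norm_triangle_ineq[of "?Y (Suc k) ?d" "?Y k ?d"] sqrt_iter_norm[of "Suc k" ?d] sqrt_iter_norm[of k ?d]
    by (intro mult_left_mono) linarith+
  also have "\<dots> = (1/2) * (?y (Suc k) + ?y k) * norm ?d" by (simp add: algebra_simps)
  also have "\<dots> \<le> (1/2) * (?y (Suc k) + ?y k) * ((?y (Suc k) - ?y k) * norm x)"
    using sqrt_rate_bounds[of k] sqrt_rate_bounds[of "Suc k"]
    by (intro mult_left_mono Suc) (simp del: sqrt_rate.simps)
  also have "\<dots> = (?y (Suc (Suc k)) - ?y (Suc k)) * norm x"
  proof -
    have "?y (Suc (Suc k)) - ?y (Suc k) = (1/2) * ((?y (Suc k))\<^sup>2 - (?y k)\<^sup>2)"
      using sqrt_rate.simps(2)[of k] sqrt_rate.simps(2)[of "Suc k"] by argo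
    also have "\<dots> = (1/2) * (?y (Suc k) + ?y k) * (?y (Suc k) - ?y k)"
      by (simp add: power2_eq_square field_simps del: sqrt_rate.simps)
    finally show ?thesis by (simp only: mult.assoc)
  qed
  finally show ?case .
qed

lemma sqrt_iter_diff:
  assumes "k \<le> m"
  shows "norm (sqrt_iter Z m x - sqrt_iter Z k x) \<le> (sqrt_rate m - sqrt_rate k) * norm x"
  using assms
proof (induction m rule: dec_induct)
  case (step m)
  have "norm (sqrt_iter Z (Suc m) x - sqrt_iter Z k x)
    \<le> norm (sqrt_iter Z (Suc m) x - sqrt_iter Z m x) + norm (sqrt_iter Z m x - sqrt_iter Z k x)"
    using norm_triangle_ineq[of "sqrt_iter Z (Suc m) x - sqrt_iter Z m x" "sqrt_iter Z m x - sqrt_iter Z k x"]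
    by (simp del: sqrt_iter.simps)
  with step.IH sqrt_iter_step[of m x] show ?case
    by (simp add: left_diff_distrib del: sqrt_iter.simps sqrt_rate.simps)
qed simp

text \<open>The fourth clause arises by letting m tend to infinity in \<open>sqrt_iter_diff\<close>,
  where \<open>sqrt_rate m\<close> is at most 1; its right-hand side does not depend on
  \<open>Z\<close>. The last clause holds for each iterate and passes to the limit.\<close>

lemma sqrt_iter_limit:
  "\<exists>Y. sym_op Y \<and> (\<forall>x. norm (Y x) \<le> norm x) \<and> (\<forall>x. 2 *\<^sub>R Y x = Z x + Y (Y x)) \<and>
    (\<forall>k x. norm (Y x - sqrt_iter Z k x) \<le> (1 - sqrt_rate k) * norm x) \<and>
    (\<forall>W. bounded_linear W \<longrightarrow> (\<forall>x. W (Z x) = Z (W x)) \<longrightarrow> (\<forall>x. W (Y x) = Y (W x)))"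
proof -
  have le: "norm (sqrt_iter Z m x - sqrt_iter Z k x) \<le> (1 - sqrt_rate k) * norm x" if "k \<le> m" for k m x
  proof -
    have "(sqrt_rate m - sqrt_rate k) * norm x \<le> (1 - sqrt_rate k) * norm x"
      using sqrt_rate_bounds[of m] by (intro mult_right_mono) auto
    with sqrt_iter_diff[OF that, of x] show ?thesis by linarith
  qed
  have "Cauchy (\<lambda>k. sqrt_iter Z k x)" for x
  proof (rule CauchyI')
    fix e :: real assume "0 < e"
    moreover have "(\<lambda>k. (1 - sqrt_rate k) * norm x) \<longlonglongrightarrow> (1 - 1) * norm x"
      by (intro tendsto_intros sqrt_rate_tendsto)
    ultimately have "\<forall>\<^sub>F k in sequentially. (1 - sqrt_rate k) * norm x < e"
      by (simp add: order_tendstoD)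
    then obtain N where N: "\<And>k. N \<le> k \<Longrightarrow> (1 - sqrt_rate k) * norm x < e"
      by (auto simp: eventually_sequentially)
    show "\<exists>M. \<forall>m\<ge>M. \<forall>n>m. dist (sqrt_iter Z m x) (sqrt_iter Z n x) < e"
    proof (intro exI allI impI)
      fix m n assume "N \<le> m" "m < n"
      then show "dist (sqrt_iter Z m x) (sqrt_iter Z n x) < e"
        using le[of m n x] N[of m] by (simp add: dist_norm norm_minus_commute)
    qed
  qed
  then have "\<exists>l. (\<lambda>k. sqrt_iter Z k x) \<longlonglongrightarrow> l" for x
    by (simp add: Cauchy_convergent_iff convergent_def)
  then obtain Y where Y: "\<And>x. (\<lambda>k. sqrt_iter Z k x) \<longlonglongrightarrow> Y x" by metis
  have Yn: "norm (Y x) \<le> norm x" for x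
  proof (rule LIMSEQ_le_const2[OF tendsto_norm[OF Y]], intro exI allI impI)
    fix k
    have "sqrt_rate k * norm x \<le> 1 * norm x"
      using sqrt_rate_bounds[of k] by (intro mult_right_mono) auto
    then show "norm (sqrt_iter Z k x) \<le> norm x" using sqrt_iter_norm[of k x] by simp
  qed
  have blin: "bounded_linear Y"
  proof (rule bounded_linear_intro[where K = 1])
    fix x y r
    have "(\<lambda>k. sqrt_iter Z k (x + y)) \<longlonglongrightarrow> Y x + Y y"
      unfolding linear_add[OF sqrt_iter_linear] by (intro tendsto_intros Y)
    then show "Y (x + y) = Y x + Y y" using Y LIMSEQ_unique by blast
    have "(\<lambda>k. sqrt_iter Z k (r *\<^sub>R x)) \<longlonglongrightarrow> r *\<^sub>R Y x"
      unfolding linear_cmul[OF sqrt_iter_linear] by (intro tendsto_intros Y)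
    then show "Y (r *\<^sub>R x) = r *\<^sub>R Y x" using Y LIMSEQ_unique by blast
    show "norm (Y x) \<le> norm x * 1" using Yn by simp
  qed
  have app: "norm (Y x - sqrt_iter Z k x) \<le> (1 - sqrt_rate k) * norm x" for k x
    by (rule LIMSEQ_le_const2[OF tendsto_norm[OF tendsto_diff[OF Y tendsto_const]]]) (use le in blast)
  have YY: "(\<lambda>k. sqrt_iter Z k (sqrt_iter Z k x)) \<longlonglongrightarrow> Y (Y x)" for x
  proof -
    have "(\<lambda>k. sqrt_iter Z k (sqrt_iter Z k x - Y x)) \<longlonglongrightarrow> 0"
    proof (rule Lim_null_comparison)
      show "\<forall>\<^sub>F k in sequentially. norm (sqrt_iter Z k (sqrt_iter Z k x - Y x)) \<le> norm (sqrt_iter Z k x - Y x)"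
      proof (intro always_eventually allI)
        fix k
        have "sqrt_rate k * norm (sqrt_iter Z k x - Y x) \<le> 1 * norm (sqrt_iter Z k x - Y x)"
          using sqrt_rate_bounds[of k] by (intro mult_right_mono) auto
        then show "norm (sqrt_iter Z k (sqrt_iter Z k x - Y x)) \<le> norm (sqrt_iter Z k x - Y x)"
          using sqrt_iter_norm[of k "sqrt_iter Z k x - Y x"] by simp
      qed
      show "(\<lambda>k. norm (sqrt_iter Z k x - Y x)) \<longlonglongrightarrow> 0"
        using tendsto_norm[OF tendsto_diff[OF Y tendsto_const], of x "Y x"] by simp
    qed
    from tendsto_add[OF this Y[of "Y x"]] show ?thesis
      by (simp add: linear_diff[OF sqrt_iter_linear])
  qed
  have eq: "2 *\<^sub>R Y x = Z x + Y (Y x)" for x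
  proof -
    have "(\<lambda>k. 2 *\<^sub>R sqrt_iter Z (Suc k) x) \<longlonglongrightarrow> Z x + Y (Y x)"
      by (simp add: tendsto_add[OF tendsto_const YY])
    moreover have "(\<lambda>k. 2 *\<^sub>R sqrt_iter Z (Suc k) x) \<longlonglongrightarrow> 2 *\<^sub>R Y x"
      by (intro tendsto_intros LIMSEQ_Suc[OF Y])
    ultimately show ?thesis using LIMSEQ_unique by blast
  qed
  have sym: "rin (Y x) y = rin x (Y y)" for x y
  proof (rule LIMSEQ_unique)
    show "(\<lambda>k. rin (sqrt_iter Z k x) y) \<longlonglongrightarrow> rin (Y x) y" by (intro tendsto_rin Y tendsto_const)
    show "(\<lambda>k. rin (sqrt_iter Z k x) y) \<longlonglongrightarrow> rin x (Y y)"
      unfolding sqrt_iter_sym by (intro tendsto_rin Y tendsto_const)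
  qed
  have com: "W (Y x) = Y (W x)" if W: "bounded_linear W" "\<And>x. W (Z x) = Z (W x)" for W x
  proof (rule LIMSEQ_unique)
    show "(\<lambda>k. W (sqrt_iter Z k x)) \<longlonglongrightarrow> W (Y x)" by (rule bounded_linear.tendsto[OF W(1) Y])
    show "(\<lambda>k. W (sqrt_iter Z k x)) \<longlonglongrightarrow> Y (W x)"
      unfolding sqrt_iter_commute[OF bounded_linear.linear[OF W(1)] W(2)] by (rule Y)
  qed
  have "sym_op Y" using blin sym by (simp add: sym_op_def)
  with Yn eq app com show ?thesis by (intro exI[of _ Y] conjI allI impI) auto
qed

end

text \<open>With \<open>Z = 1 - T/M\<close> one has \<open>T = M (1 - Z)\<close>, so the root of
  \<open>T\<close> is \<open>sqrt M\<close> times that of \<open>1 - Z\<close>, and the latter is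
  approximated by 1 minus the k-th iterate. The result is a polynomial in \<open>T\<close>.\<close>

definition sqrt_approx :: "real \<Rightarrow> ('h::complex_hilbert \<Rightarrow> 'h) \<Rightarrow> nat \<Rightarrow> 'h \<Rightarrow> 'h" where
  "sqrt_approx M T k x = sqrt M *\<^sub>R (x - sqrt_iter (\<lambda>x. x - (1/M) *\<^sub>R T x) k x)"

text \<open>Expanding the square and inserting \<open>T^2 \<le> M T\<close> leaves ||x||^2 - <T x,
  x>/M.\<close>

lemma pos_sym_contraction_complement:
  assumes T: "pos_sym T" and M: "0 < M" "\<And>x. rin (T x) x \<le> M * (norm x)\<^sup>2"
  shows "sym_op (\<lambda>x. x - (1/M) *\<^sub>R T x)" "norm (x - (1/M) *\<^sub>R T x) \<le> norm x"
proof -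
  from T have bl: "bounded_linear T" and sy: "rin (T x) y = rin x (T y)" for x y
    by (auto simp: pos_sym_def sym_op_def)
  show "sym_op (\<lambda>x. x - (1/M) *\<^sub>R T x)"
    unfolding sym_op_def
    by (intro conjI allI bounded_linear_sub bounded_linear_ident bounded_linear_const_scaleR bl)
      (simp add: rin_simps sy)
  have "(norm (x - (1/M) *\<^sub>R T x))\<^sup>2 = (norm x)\<^sup>2 - 2 * (1/M) * rin (T x) x + (1/M)\<^sup>2 * (norm (T x))\<^sup>2"
    unfolding norm_diff_sq by (simp add: rin_simps power_mult_distrib power_divide rin_commute[of x "T x"])
  also have "\<dots> \<le> (norm x)\<^sup>2 - 2 * (1/M) * rin (T x) x + (1/M)\<^sup>2 * (M * rin (T x) x)"
    by (intro add_left_mono mult_left_mono pos_sym_norm_sq[OF T M]) simp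
  also have "\<dots> = (norm x)\<^sup>2 - rin (T x) x / M"
    using M(1) by (simp add: field_simps power2_eq_square)
  also have "\<dots> \<le> (norm x)\<^sup>2" using T M(1) by (simp add: pos_sym_def)
  finally show "norm (x - (1/M) *\<^sub>R T x) \<le> norm x" by simp
qed

text \<open>The commutation clause serves several ends: with \<open>W\<close> a complex scalar it
  makes the root complex-linear, with \<open>W\<close> another root it supplies the hypothesis of
  \<open>pos_sym_sqrt_unique\<close>, and it lets an absolute value commute with its
  operator.\<close>

lemma pos_sym_sqrt_exists:
  assumes T: "pos_sym T" and M: "0 < M" "\<And>x. rin (T x) x \<le> M * (norm x)\<^sup>2"
  shows "\<exists>Q. pos_sym Q \<and> (\<forall>x. Q (Q x) = T x) \<and>
    (\<forall>W. bounded_linear W \<longrightarrow> (\<forall>x. W (T x) = T (W x)) \<longrightarrow> (\<forall>x. W (Q x) = Q (W x))) \<and>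
    (\<forall>k x. norm (Q x - sqrt_approx M T k x) \<le> sqrt M * (1 - sqrt_rate k) * norm x)"
proof -
  let ?Z = "\<lambda>x. x - (1/M) *\<^sub>R T x"
  note Z = pos_sym_contraction_complement[OF T M]
  from T have bl: "bounded_linear T" by (auto simp: pos_sym_def sym_op_def)
  obtain Y where Y: "sym_op Y" "\<forall>x. norm (Y x) \<le> norm x" "\<forall>x. 2 *\<^sub>R Y x = ?Z x + Y (Y x)"
    "\<forall>k x. norm (Y x - sqrt_iter ?Z k x) \<le> (1 - sqrt_rate k) * norm x"
    "\<forall>W. bounded_linear W \<longrightarrow> (\<forall>x. W (?Z x) = ?Z (W x)) \<longrightarrow> (\<forall>x. W (Y x) = Y (W x))"
    using sqrt_iter_limit[OF Z] by (elim exE conjE)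
  note Y = Y(1) Y(2-5)[rule_format]
  interpret Y: bounded_linear Y using Y(1) by (simp add: sym_op_def)
  define Q where "Q x = sqrt M *\<^sub>R (x - Y x)" for x
  have Ysym: "rin (Y x) y = rin x (Y y)" for x y using Y(1) by (simp add: sym_op_def)
  have "bounded_linear Q" unfolding Q_def
    by (intro bounded_linear_const_scaleR bounded_linear_sub bounded_linear_ident Y.bounded_linear_axioms)
  moreover have "rin (Q x) y = rin x (Q y)" for x y by (simp add: Q_def rin_simps Ysym)
  moreover have "0 \<le> rin (Q x) x" for x
  proof -
    have "rin (Y x) x \<le> norm x * norm x"
      using rin_cauchy_schwarz[of "Y x" x] mult_right_mono[OF Y(2)[of x], of "norm x"] by simp
    then show ?thesis using M(1) by (simp add: Q_def rin_simps rin_self power2_eq_square)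
  qed
  ultimately have 1: "pos_sym Q" by (simp add: pos_sym_def sym_op_def)
  have 2: "Q (Q x) = T x" for x
  proof -
    have "Q (Q x) = M *\<^sub>R (x - 2 *\<^sub>R Y x + Y (Y x))"
      using M(1) by (simp add: Q_def Y.diff Y.scaleR scaleR_2 algebra_simps)
    also have "\<dots> = T x" unfolding Y(3) using M(1) by simp
    finally show ?thesis .
  qed
  have 3: "W (Q x) = Q (W x)" if W: "bounded_linear W" "\<And>x. W (T x) = T (W x)" for W x
  proof -
    interpret W: bounded_linear W by (rule W)
    have "W (Y x) = Y (W x)" for x by (rule Y(5)[OF W(1)]) (simp add: W.diff W.scaleR W(2))
    then show ?thesis by (simp add: Q_def W.diff W.scaleR)
  qed
  have 4: "norm (Q x - sqrt_approx M T k x) \<le> sqrt M * (1 - sqrt_rate k) * norm x" for k x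
  proof -
    have "Q x - sqrt_approx M T k x = - (sqrt M *\<^sub>R (Y x - sqrt_iter ?Z k x))"
      by (simp add: Q_def sqrt_approx_def algebra_simps)
    then have "norm (Q x - sqrt_approx M T k x) = sqrt M * norm (Y x - sqrt_iter ?Z k x)"
      using M(1) by simp
    also have "\<dots> \<le> sqrt M * ((1 - sqrt_rate k) * norm x)"
      using M(1) by (intro mult_left_mono Y) simp
    finally show ?thesis by (simp add: mult.assoc)
  qed
  from 1 2 3 4 show ?thesis by (intro exI[of _ Q] conjI allI impI) auto
qed

text \<open>Since (P + Q)(P - Q) = 0, the vector y = (P - Q) x satisfies <P y, y> + <Q y, y> = 0.
  Both terms are nonnegative, hence P y = Q y = 0, and ||y||^2 = <x, (P - Q) y> vanishes.\<close>

lemma pos_sym_sqrt_unique: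
  assumes P: "pos_sym P" and Q: "pos_sym Q"
    and eq: "\<And>x. P (P x) = Q (Q x)" and com: "\<And>x. P (Q x) = Q (P x)"
  shows "P = Q"
proof
  fix x
  interpret P: bounded_linear P using P by (simp add: pos_sym_def sym_op_def)
  interpret Q: bounded_linear Q using Q by (simp add: pos_sym_def sym_op_def)
  let ?y = "P x - Q x"
  have "rin (P ?y) ?y + rin (Q ?y) ?y = rin (P ?y + Q ?y) ?y" by (simp add: rin_simps)
  also have "P ?y + Q ?y = 0" by (simp add: P.diff Q.diff eq com)
  finally have "rin (P ?y) ?y + rin (Q ?y) ?y = 0" by simp
  moreover have "0 \<le> rin (P ?y) ?y" "0 \<le> rin (Q ?y) ?y" using P Q by (auto simp: pos_sym_def)
  ultimately have "P ?y = 0" "Q ?y = 0"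
    using pos_sym_zero[OF P, of ?y] pos_sym_zero[OF Q, of ?y] by auto
  moreover have "(norm ?y)\<^sup>2 = rin x (P ?y) - rin x (Q ?y)"
  proof -
    have "(norm ?y)\<^sup>2 = rin (P x) ?y - rin (Q x) ?y" by (simp add: rin_self[symmetric] rin_diff_left)
    then show ?thesis using P Q by (simp add: pos_sym_def sym_op_def)
  qed
  ultimately show "P x = Q x" by simp
qed

section \<open>Operators on a closed subspace\<close>

definition csubspace :: "'h::complex_hilbert set \<Rightarrow> bool" where
  "csubspace K \<longleftrightarrow> 0 \<in> K \<and> (\<forall>x\<in>K. \<forall>y\<in>K. x + y \<in> K) \<and> (\<forall>c. \<forall>x\<in>K. c *\<^sub>C x \<in> K)"

lemma csubspace_UNIV [simp]: "csubspace UNIV"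
  by (simp add: csubspace_def)

lemma csubspaceD:
  assumes "csubspace K"
  shows "0 \<in> K" "x \<in> K \<Longrightarrow> y \<in> K \<Longrightarrow> x + y \<in> K" "x \<in> K \<Longrightarrow> c *\<^sub>C x \<in> K"
    "x \<in> K \<Longrightarrow> r *\<^sub>R x \<in> K" "x \<in> K \<Longrightarrow> y \<in> K \<Longrightarrow> x - y \<in> K"
proof -
  show 1: "0 \<in> K" "x \<in> K \<Longrightarrow> y \<in> K \<Longrightarrow> x + y \<in> K" "x \<in> K \<Longrightarrow> c *\<^sub>C x \<in> K" for x y c
    using assms by (auto simp: csubspace_def)
  show 2: "x \<in> K \<Longrightarrow> r *\<^sub>R x \<in> K" for r x by (simp add: scaleR_eq_scaleC 1)
  show "x \<in> K \<Longrightarrow> y \<in> K \<Longrightarrow> x - y \<in> K" using 1(2)[of x "(-1) *\<^sub>R y"] 2[of y "-1"] by simp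
qed

lemma bounded_opD:
  assumes "bounded_op K T"
  shows "x \<in> K \<Longrightarrow> T x \<in> K" "x \<in> K \<Longrightarrow> y \<in> K \<Longrightarrow> T (x + y) = T x + T y"
    "x \<in> K \<Longrightarrow> T (c *\<^sub>C x) = c *\<^sub>C T x" "x \<in> K \<Longrightarrow> T (r *\<^sub>R x) = r *\<^sub>R T x"
  using assms by (auto simp: bounded_op_def scaleR_eq_scaleC)

lemma bounded_op_diff:
  assumes "csubspace K" "bounded_op K T" "x \<in> K" "y \<in> K"
  shows "T (x - y) = T x - T y"
  using bounded_opD(2)[OF assms(2,3), of "(-1) *\<^sub>R y"] bounded_opD(4)[OF assms(2,4), of "-1"]
    csubspaceD(4)[OF assms(1,4), of "-1"] by simp

lemma bounded_op_zero:
  assumes "csubspace K" "bounded_op K T"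
  shows "T 0 = 0"
  using bounded_op_diff[OF assms csubspaceD(1)[OF assms(1)] csubspaceD(1)[OF assms(1)]] by simp

text \<open>The form h(u, v) = <T u, v> - <u, T v> vanishes on the diagonal, so it is antisymmetric.
  Replacing x by \<open>\<i> *\<^sub>C x\<close> multiplies h(x, y) by i and h(y, x) by -i, and
  comparison forces h(x, y) = 0. Complex scalars are essential here; the real notion
  \<open>pos_sym\<close> has to include symmetry.\<close>

lemma bounded_op_cinner_sym:
  assumes K: "csubspace K" and T: "bounded_op K T" and re: "\<And>x. x \<in> K \<Longrightarrow> cinner (T x) x \<in> \<real>"
    and x: "x \<in> K" and y: "y \<in> K"
  shows "cinner (T x) y = cinner x (T y)"
proof -
  have add_right: "cinner z (u + v) = cinner z u + cinner z v" for z u v :: 'a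
    by (metis cinner_add_left cinner_commute complex_cnj_add)
  define h where "h u v = cinner (T u) v - cinner u (T v)" for u v
  have h0: "h u u = 0" if "u \<in> K" for u
    using re[OF that] cinner_commute[of u "T u"] by (simp add: h_def Reals_cnj_iff)
  have hadd: "h (u + v) (u + v) = h u u + h u v + h v u + h v v" if "u \<in> K" "v \<in> K" for u v
    by (simp add: h_def bounded_opD(2)[OF T that] cinner_add_left add_right)
  have h1: "h u v + h v u = 0" if "u \<in> K" "v \<in> K" for u v
    using hadd[OF that] h0[OF that(1)] h0[OF that(2)] h0[OF csubspaceD(2)[OF K that]] by simp
  have "h (\<i> *\<^sub>C x) y = \<i> * h x y" "h y (\<i> *\<^sub>C x) = - \<i> * h y x"
    by (simp_all add: h_def bounded_opD(3)[OF T x] cinner_scaleC_left cinner_scaleC_right algebra_simps)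
  with h1[OF csubspaceD(3)[OF K x] y, of \<i>] h1[OF x y] have "2 * h x y = 0"
    by (simp add: algebra_simps add_eq_0_iff)
  then show ?thesis by (simp add: h_def)
qed

lemma nonneg_Reals_complex_iff: "z \<in> \<real>\<^sub>\<ge>\<^sub>0 \<longleftrightarrow> z \<in> \<real> \<and> 0 \<le> Re z" for z :: complex
  by (auto simp: complex_nonneg_Reals_iff complex_is_Real_iff)

lemma positive_opD:
  assumes "csubspace K" "positive_op K T"
  shows "bounded_op K T" "x \<in> K \<Longrightarrow> y \<in> K \<Longrightarrow> cinner (T x) y = cinner x (T y)"
    "x \<in> K \<Longrightarrow> y \<in> K \<Longrightarrow> rin (T x) y = rin x (T y)" "x \<in> K \<Longrightarrow> 0 \<le> rin (T x) x"
proof -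
  show "x \<in> K \<Longrightarrow> y \<in> K \<Longrightarrow> cinner (T x) y = cinner x (T y)"
    using bounded_op_cinner_sym[OF assms(1), of T x y] assms(2)
    by (simp add: positive_op_def nonneg_Reals_complex_iff)
  then show "x \<in> K \<Longrightarrow> y \<in> K \<Longrightarrow> rin (T x) y = rin x (T y)" by (simp add: rin_def)
qed (use assms(2) in \<open>auto simp: positive_op_def nonneg_Reals_complex_iff rin_def\<close>)

text \<open>The imaginary part of <T x, x> is \<open>rin (T x) (\<i> *\<^sub>C x)\<close>. Moving
  \<open>T\<close> across and then the factor i shows that it equals its own negative.\<close>

lemma cinner_self_eq_rin:
  assumes "\<And>c. T (c *\<^sub>C x) = c *\<^sub>C T x" "rin (T x) (\<i> *\<^sub>C x) = rin x (T (\<i> *\<^sub>C x))"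
  shows "cinner (T x) x = complex_of_real (rin (T x) x)"
proof -
  have "rin (T x) (\<i> *\<^sub>C x) = rin (\<i> *\<^sub>C T x) x"
    unfolding assms(2) assms(1) by (rule rin_commute)
  also have "\<dots> = rin (T x) ((-1 :: real) *\<^sub>R (\<i> *\<^sub>C x))"
    by (simp add: rin_scaleC_left scaleR_eq_scaleC scaleC_scaleC)
  finally have "rin (T x) (\<i> *\<^sub>C x) = 0" by (simp add: rin_minus_right)
  then show ?thesis by (simp add: cinner_eq_rin[of "T x" x] complex_eq_iff)
qed

lemma bounded_op_UNIV_iff:
  "bounded_op UNIV T \<longleftrightarrow> bounded_linear T \<and> (\<forall>c x. T (c *\<^sub>C x) = c *\<^sub>C T x)"
proof
  assume T: "bounded_op UNIV T"
  then obtain M where "\<And>x. norm (T x) \<le> M * norm x" by (auto simp: bounded_op_def)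
  then have "bounded_linear T"
    by (intro bounded_linear_intro[where K = M]) (auto simp: bounded_opD[OF T] mult.commute)
  then show "bounded_linear T \<and> (\<forall>c x. T (c *\<^sub>C x) = c *\<^sub>C T x)" by (simp add: bounded_opD[OF T])
next
  assume T: "bounded_linear T \<and> (\<forall>c x. T (c *\<^sub>C x) = c *\<^sub>C T x)"
  then interpret bounded_linear T by simp
  from bounded show "bounded_op UNIV T"
    using T by (auto simp: bounded_op_def add mult.commute)
qed

lemma positive_op_UNIV_iff:
  "positive_op UNIV T \<longleftrightarrow> pos_sym T \<and> (\<forall>c x. T (c *\<^sub>C x) = c *\<^sub>C T x)"
proof
  assume T: "positive_op UNIV T"
  then show "pos_sym T \<and> (\<forall>c x. T (c *\<^sub>C x) = c *\<^sub>C T x)"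
    using positive_opD[OF csubspace_UNIV T] by (simp add: pos_sym_def sym_op_def bounded_op_UNIV_iff)
next
  assume T: "pos_sym T \<and> (\<forall>c x. T (c *\<^sub>C x) = c *\<^sub>C T x)"
  have "cinner (T x) x = complex_of_real (rin (T x) x)" for x
    by (rule cinner_self_eq_rin) (use T in \<open>auto simp: pos_sym_def sym_op_def\<close>)
  moreover have "bounded_op UNIV T" "\<And>x. 0 \<le> rin (T x) x"
    using T by (auto simp: bounded_op_UNIV_iff pos_sym_def sym_op_def)
  ultimately show "positive_op UNIV T" unfolding positive_op_def by simp
qed

text \<open>The bound M stays free in the third claim, so that a single M can later serve a whole
  sequence of operators and its limit.\<close>

lemma op_sqrt:
  assumes T: "positive_op UNIV T"
  shows "positive_op UNIV (op_sqrt T)" "op_sqrt T (op_sqrt T x) = T x"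
    "0 < M \<Longrightarrow> (\<And>x. rin (T x) x \<le> M * (norm x)\<^sup>2) \<Longrightarrow>
      norm (op_sqrt T x - sqrt_approx M T k x) \<le> sqrt M * (1 - sqrt_rate k) * norm x"
proof -
  have Tp: "pos_sym T" and Tc: "\<And>c x. T (c *\<^sub>C x) = c *\<^sub>C T x"
    using T by (auto simp: positive_op_UNIV_iff)
  have key: "positive_op UNIV (op_sqrt T) \<and> (\<forall>x. op_sqrt T (op_sqrt T x) = T x) \<and>
      (\<forall>k x. norm (op_sqrt T x - sqrt_approx M T k x) \<le> sqrt M * (1 - sqrt_rate k) * norm x)"
    if M: "0 < M" "\<And>x. rin (T x) x \<le> M * (norm x)\<^sup>2" for M
  proof -
    obtain Q where Q: "pos_sym Q" "\<forall>x. Q (Q x) = T x"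
      "\<forall>W. bounded_linear W \<longrightarrow> (\<forall>x. W (T x) = T (W x)) \<longrightarrow> (\<forall>x. W (Q x) = Q (W x))"
      "\<forall>k x. norm (Q x - sqrt_approx M T k x) \<le> sqrt M * (1 - sqrt_rate k) * norm x"
      using pos_sym_sqrt_exists[OF Tp M] by (elim exE conjE)
    have Qc: "c *\<^sub>C Q x = Q (c *\<^sub>C x)" for c x
      using Q(3)[rule_format, of "\<lambda>x. c *\<^sub>C x"] by (simp add: bounded_linear_scaleC Tc)
    have Qpos: "positive_op UNIV Q" using Q(1) Qc by (simp add: positive_op_UNIV_iff)
    have "op_sqrt T = Q" unfolding op_sqrt_def
    proof (rule the_equality)
      fix P assume P: "positive_op UNIV P \<and> (\<forall>x. P (P x) = T x)"
      then have Pp: "pos_sym P" by (simp add: positive_op_UNIV_iff)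
      show "P = Q"
      proof (rule pos_sym_sqrt_unique[OF Pp Q(1)])
        show "P (P x) = Q (Q x)" for x using P Q(2) by simp
        have "P (T x) = T (P x)" for x using P by metis
        then show "P (Q x) = Q (P x)" for x
          using Q(3) Pp by (simp add: pos_sym_def sym_op_def)
      qed
    qed (use Qpos Q(2) in simp)
    with Q Qpos show ?thesis by simp
  qed
  have "bounded_linear T" using Tp by (simp add: pos_sym_def sym_op_def)
  then obtain N where "0 < N" "\<And>x. rin (T x) x \<le> N * (norm x)\<^sup>2"
    using bounded_linear_rin_bound by (metis abs_le_D1)
  with key show "positive_op UNIV (op_sqrt T)" "op_sqrt T (op_sqrt T x) = T x" by blast+
  show "0 < M \<Longrightarrow> (\<And>x. rin (T x) x \<le> M * (norm x)\<^sup>2) \<Longrightarrow>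
      norm (op_sqrt T x - sqrt_approx M T k x) \<le> sqrt M * (1 - sqrt_rate k) * norm x"
    using key by blast
qed

lemma cadjoint_positive_op:
  assumes "positive_op UNIV T"
  shows "cadjoint T = T"
proof
  fix y
  show "cadjoint T y = T y" unfolding cadjoint_def
  proof (rule the_equality)
    show "\<forall>x. cinner (T y) x = cinner y (T x)"
      using positive_opD(2)[OF csubspace_UNIV assms] by simp
    fix z assume "\<forall>x. cinner z x = cinner y (T x)"
    then have "rin z x = rin (T y) x" for x
      using positive_opD(2)[OF csubspace_UNIV assms] by (simp add: rin_def)
    then show "z = T y" by (rule rin_eqI)
  qed
qed

text \<open>Polarization at u and at the vector v of length ||u|| in the direction of X u, combined
  with the parallelogram law. \<open>K\<close> only has to be closed under sums and real multiples,
  so the lemma also applies to the range of a spectral projection inside a subspace.\<close>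

lemma real_quadratic_form_norm_bound:
  assumes add: "\<And>x y. x \<in> K \<Longrightarrow> y \<in> K \<Longrightarrow> x + y \<in> K \<and> X (x + y) = X x + X y"
    and scale: "\<And>r x. x \<in> K \<Longrightarrow> r *\<^sub>R x \<in> K \<and> X (r *\<^sub>R x) = r *\<^sub>R X x"
    and inK: "\<And>x. x \<in> K \<Longrightarrow> X x \<in> K"
    and sym: "\<And>x y. x \<in> K \<Longrightarrow> y \<in> K \<Longrightarrow> rin (X x) y = rin x (X y)"
    and bd: "\<And>x. x \<in> K \<Longrightarrow> \<bar>rin (X x) x\<bar> \<le> e * (norm x)\<^sup>2" and "u \<in> K"
  shows "norm (X u) \<le> e * norm u"
proof (cases "X u = 0")
  case True
  show ?thesis
  proof (cases "u = 0")
    case False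
    then have "0 \<le> e" using bd[OF \<open>u \<in> K\<close>] True by (simp add: zero_le_mult_iff)
    then show ?thesis using True by simp
  qed (use True in simp)
next
  case False
  have X0: "X 0 = 0" using scale[OF \<open>u \<in> K\<close>, of 0] by simp
  then have u0: "u \<noteq> 0" using False by auto
  have diff: "x - y \<in> K \<and> X (x - y) = X x - X y" if "x \<in> K" "y \<in> K" for x y
    using add[OF that(1), of "(-1) *\<^sub>R y"] scale[OF that(2), of "-1"] by simp
  define t where "t = norm u / norm (X u)"
  define v where "v = t *\<^sub>R X u"
  have vK: "v \<in> K" unfolding v_def using scale inK \<open>u \<in> K\<close> by blast
  have nv: "norm v = norm u" using False by (simp add: v_def t_def)
  have "4 * rin (X u) v = rin (X (u + v)) (u + v) - rin (X (u - v)) (u - v)"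
    using add[OF \<open>u \<in> K\<close> vK] diff[OF \<open>u \<in> K\<close> vK] sym[OF \<open>u \<in> K\<close> vK] rin_commute[of u "X v"]
    by (simp add: rin_simps)
  also have "\<dots> \<le> e * (norm (u + v))\<^sup>2 + e * (norm (u - v))\<^sup>2"
    using bd[of "u + v"] bd[of "u - v"] add[OF \<open>u \<in> K\<close> vK] diff[OF \<open>u \<in> K\<close> vK] by auto
  also have "\<dots> = 4 * (e * (norm u)\<^sup>2)" by (simp add: norm_add_sq norm_diff_sq nv algebra_simps)
  finally have "rin (X u) v \<le> e * (norm u)\<^sup>2" by simp
  moreover have "rin (X u) v = norm u * norm (X u)"
    using False by (simp add: v_def t_def rin_simps rin_self power2_eq_square)
  ultimately show ?thesis using u0 by (simp add: power2_eq_square)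
qed

section \<open>The spectral family of a symmetric operator\<close>

text \<open>\<open>X\<close> lies in the bicommutant of \<open>T\<close>, with \<open>W'\<close> the adjoint of \<open>W\<close>.\<close>

definition bicomm :: "('h::complex_hilbert \<Rightarrow> 'h) \<Rightarrow> ('h \<Rightarrow> 'h) \<Rightarrow> bool" where
  "bicomm T X \<longleftrightarrow> (\<forall>W W'. bounded_linear W \<longrightarrow> bounded_linear W' \<longrightarrow>
     (\<forall>x y. rin (W x) y = rin x (W' y)) \<longrightarrow> (\<forall>x. W (T x) = T (W x)) \<longrightarrow> (\<forall>x. W (X x) = X (W x)))"

lemma bicommD:
  assumes "bicomm T X" "bounded_linear W" "bounded_linear W'" "\<And>x y. rin (W x) y = rin x (W' y)"
    "\<And>x. W (T x) = T (W x)"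
  shows "W (X x) = X (W x)"
  using assms unfolding bicomm_def by blast

lemma bicomm_self: "sym_op T \<Longrightarrow> bicomm T X \<Longrightarrow> T (X x) = X (T x)"
  by (rule bicommD[of T X T T]) (auto simp: sym_op_def)

lemma sym_opD:
  assumes "sym_op T"
  shows "bounded_linear T" "rin (T x) y = rin x (T y)"
  using assms by (auto simp: sym_op_def)

lemma pos_symD:
  assumes "pos_sym T"
  shows "sym_op T" "bounded_linear T" "rin (T x) y = rin x (T y)" "0 \<le> rin (T x) x"
  using assms by (auto simp: pos_sym_def sym_op_def)

lemma oprojD:
  assumes "oproj P"
  shows "sym_op P" "bounded_linear P" "rin (P x) y = rin x (P y)" "P (P x) = P x"
  using assms by (auto simp: oproj_def sym_op_def)

lemmas oproj_linear = bounded_linear.linear[OF oprojD(2)]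

lemma adjoint_commute:
  assumes "sym_op T" "\<And>x y. rin (W x) y = rin x (W' y)" "\<And>x. W (T x) = T (W x)"
  shows "W' (T x) = T (W' x)"
proof (rule rin_eqI)
  fix y
  have "rin (W' (T x)) y = rin (T (W y)) x"
    using assms(2)[of y "T x"] sym_opD(2)[OF assms(1), of "W y" x] by (metis rin_commute)
  also have "\<dots> = rin (T (W' x)) y"
    using assms(2)[of "T y" x] sym_opD(2)[OF assms(1), of y "W' x"] by (simp add: assms(3)[symmetric] rin_commute)
  finally show "rin (W' (T x)) y = rin (T (W' x)) y" .
qed

text \<open>With \<open>D = T - t\<close>, the projection onto the kernel of \<open>\<bar>D\<bar> + D\<close>, twice the positive part of \<open>D\<close>.\<close>

lemma spectral_projection_exists:
  fixes T :: "'h::complex_hilbert \<Rightarrow> 'h"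
  assumes T: "sym_op T"
  shows "\<exists>E. oproj E \<and> bicomm T E \<and> (\<forall>x. E x = x \<longrightarrow> rin (T x) x \<le> t * (norm x)\<^sup>2) \<and>
    (\<forall>x. E x = 0 \<longrightarrow> x \<noteq> 0 \<longrightarrow> t * (norm x)\<^sup>2 < rin (T x) x)"
proof -
  interpret T: bounded_linear T by (rule sym_opD[OF T])
  define D where "D x = T x - t *\<^sub>R x" for x
  have Dbl: "bounded_linear D" unfolding D_def
    by (intro bounded_linear_sub T.bounded_linear_axioms bounded_linear_scaleR_right)
  interpret D: bounded_linear D by (rule Dbl)
  have Dsym: "rin (D x) y = rin x (D y)" for x y
    by (simp add: D_def rin_simps sym_opD(2)[OF T])
  have DD: "pos_sym (\<lambda>x. D (D x))"
    using bounded_linear_compose[OF Dbl Dbl] by (simp add: pos_sym_def sym_op_def Dsym rin_self)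
  obtain M where M: "0 < M" "\<And>x. rin (D (D x)) x \<le> M * (norm x)\<^sup>2"
    using bounded_linear_rin_bound[OF bounded_linear_compose[OF Dbl Dbl]] by (metis abs_le_D1)
  obtain Q where Q: "pos_sym Q" "\<forall>x. Q (Q x) = D (D x)"
      "\<forall>W. bounded_linear W \<longrightarrow> (\<forall>x. W (D (D x)) = D (D (W x))) \<longrightarrow> (\<forall>x. W (Q x) = Q (W x))"
    using pos_sym_sqrt_exists[OF DD M] by (elim exE conjE)
  interpret Q: bounded_linear Q by (rule pos_symD[OF Q(1)])
  have DQ: "D (Q x) = Q (D x)" for x using Q(3) Dbl by simp
  define N where "N x = Q x + D x" for x
  define N' where "N' x = Q x - D x" for x
  have Nbl: "bounded_linear N" unfolding N_def
    by (intro bounded_linear_add Dbl Q.bounded_linear_axioms)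
  have Nsym: "rin (N x) y = rin x (N y)" and N'sym: "rin (N' x) y = rin x (N' y)" for x y
    by (simp_all add: N_def N'_def rin_simps Dsym pos_symD(3)[OF Q(1)])
  \<comment> \<open>With \<open>Q\<close> the absolute value of \<open>D\<close>, this is (Q - D)(Q
    + D) = Q^2 - D^2, by commutation.\<close>
  have N'N: "N' (N x) = 0" for x
    by (simp add: N_def N'_def Q.add D.add DQ Q(2))
  obtain P where P: "oproj P" "\<forall>x. P x \<in> closure (range N)" "\<forall>x y. rin (P x) (N y) = rin x (N y)"
    "\<forall>W W'. bounded_linear W \<longrightarrow> (\<forall>x y. rin (W x) y = rin x (W' y)) \<longrightarrow>
      (\<forall>x. W (N x) = N (W x)) \<longrightarrow> (\<forall>x. W' (N x) = N (W' x)) \<longrightarrow> (\<forall>x. W (P x) = P (W x))"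
    using range_projection[OF Nbl] by (elim exE conjE)
  interpret P: bounded_linear P by (rule oprojD[OF P(1)])
  define E where "E x = x - P x" for x
  have "oproj E" unfolding oproj_def sym_op_def E_def
    by (intro conjI allI bounded_linear_sub bounded_linear_ident P.bounded_linear_axioms)
      (auto simp: rin_simps P.diff oprojD[OF P(1)])
  moreover have "bicomm T E" unfolding bicomm_def
  proof (intro allI impI)
    fix W W' :: "'h \<Rightarrow> 'h" and x
    assume W: "bounded_linear W" "bounded_linear W'" "\<forall>x y. rin (W x) y = rin x (W' y)"
      "\<forall>x. W (T x) = T (W x)"
    have NV: "V (N x) = N (V x)" if V: "bounded_linear V" "\<And>x. V (T x) = T (V x)" for V x
    proof -
      interpret V: bounded_linear V by (rule V)
      have VD: "V (D x) = D (V x)" for x by (simp add: D_def V.diff V.scaleR V(2))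
      then have "V (Q x) = Q (V x)" for x using Q(3) V(1) by simp
      with VD show ?thesis by (simp add: N_def V.add)
    qed
    have "W' (T x) = T (W' x)" for x
      using T by (rule adjoint_commute[of T W W']) (use W in auto)
    with NV[of W] NV[of W'] W have "W (P x) = P (W x)"
      by (intro P(4)[rule_format, of W W']) auto
    then show "W (E x) = E (W x)"
      by (simp add: E_def linear_diff[OF bounded_linear.linear[OF W(1)]])
  qed
  \<comment> \<open>A vector fixed by \<open>E\<close> is orthogonal to the range of
    \<open>N\<close>, hence killed by \<open>N\<close>; there \<open>D\<close> is the negative of
    its absolute value.\<close>
  moreover have "rin (T x) x \<le> t * (norm x)\<^sup>2" if "E x = x" for x
  proof -
    from that have "P x = 0" by (simp add: E_def)
    then have "rin x (N y) = 0" for y using P(3) by (metis rin_zero(1))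
    then have "N x = 0" by (intro rin_eqI) (simp add: Nsym)
    then have "D x = - Q x" by (simp add: N_def add_eq_0_iff)
    then have "rin (D x) x \<le> 0" using pos_symD(4)[OF Q(1), of x] by (simp add: rin_minus_left)
    then show ?thesis by (simp add: D_def rin_simps rin_self)
  qed
  moreover have "t * (norm x)\<^sup>2 < rin (T x) x" if "E x = 0" "x \<noteq> 0" for x
  proof -
    from that have "P x = x" by (simp add: E_def)
    then have xc: "x \<in> closure (range N)" using P(2) by metis
    have orth: "rin v x = 0" if "\<And>z. rin v (N z) = 0" for v
    proof -
      have "rin v x = rin 0 x" by (rule rin_closure_eq[OF _ xc]) (use that in auto)
      then show ?thesis by simp
    qed
    have "rin (N' x) y = 0" for y
      using orth[of "N' y"] N'sym N'N by (metis rin_commute rin_zero(2))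
    then have "N' x = 0" by (intro rin_eqI) simp
    then have DQx: "D x = Q x" by (simp add: N'_def)
    \<comment> \<open>Here x lies in the closed range of \<open>N\<close>, where \<open>N'\<close>
      vanishes and \<open>D\<close> agrees with its absolute value. If the form vanished, x would be
      killed by \<open>N\<close> as well, hence orthogonal to the closed range that contains it. The
      strict inequality is what later gives monotonicity and right continuity in t.\<close>
    have "rin (D x) x \<noteq> 0"
    proof
      assume "rin (D x) x = 0"
      then have "Q x = 0" using pos_sym_zero[OF Q(1), of x] DQx by simp
      then have "N x = 0" using DQx by (simp add: N_def)
      then have "rin x x = 0" by (intro orth) (simp add: Nsym[symmetric])
      with that show False by (simp add: rin_self)
    qed
    then have "0 < rin (D x) x" using pos_symD(4)[OF Q(1), of x] DQx by simp
    then show ?thesis by (simp add: D_def rin_simps rin_self)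
  qed
  ultimately show ?thesis by (intro exI[of _ E]) simp
qed

text \<open>By Pythagoras the squared distances are differences of the squared norms, and these form
  a bounded increasing sequence.\<close>

lemma increasing_projections_Cauchy:
  assumes P: "\<And>n. oproj (P n)" and mono: "\<And>m n. m \<le> n \<Longrightarrow> P m (P n x) = P m x"
  shows "Cauchy (\<lambda>n::nat. P n x)"
proof -
  have d: "(norm (P n x - P m x))\<^sup>2 = (norm (P n x))\<^sup>2 - (norm (P m x))\<^sup>2" if "m \<le> n" for m n
  proof -
    have "rin (P n x) (P m x) = rin (P m (P n x)) x" by (simp add: oprojD[OF P])
    then show ?thesis using mono[OF that] oproj_rin[OF P, of m x] by (simp add: norm_diff_sq)
  qed
  have "convergent (\<lambda>n. (norm (P n x))\<^sup>2)"
  proof (rule Bseq_mono_convergent)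
    show "Bseq (\<lambda>n. (norm (P n x))\<^sup>2)"
      by (rule BseqI'[where K = "(norm x)\<^sup>2"]) (simp add: oproj_norm_le[OF P] power_mono)
    show "\<forall>m n. m \<le> n \<longrightarrow> (norm (P m x))\<^sup>2 \<le> (norm (P n x))\<^sup>2"
      using d by (metis diff_ge_0_iff_ge zero_le_power2)
  qed
  then have C: "Cauchy (\<lambda>n. (norm (P n x))\<^sup>2)" by (rule convergent_Cauchy)
  show ?thesis
  proof (rule CauchyI')
    fix e :: real assume e: "0 < e"
    then obtain N where N: "\<And>m n. N \<le> m \<Longrightarrow> N \<le> n \<Longrightarrow> dist ((norm (P m x))\<^sup>2) ((norm (P n x))\<^sup>2) < e\<^sup>2"
      using metric_CauchyD[OF C, of "e\<^sup>2"] by auto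
    show "\<exists>M. \<forall>m\<ge>M. \<forall>n>m. dist (P m x) (P n x) < e"
    proof (intro exI allI impI)
      fix m n assume mn: "N \<le> m" "m < n"
      then have "(norm (P n x - P m x))\<^sup>2 < e\<^sup>2" using N[of m n] d[of m n] by (simp add: dist_real_def)
      then show "dist (P m x) (P n x) < e"
        using e by (simp add: dist_norm norm_minus_commute power2_less_imp_less)
    qed
  qed
qed

lemma oproj_complement:
  assumes "oproj P" shows "oproj (\<lambda>x. x - P x)"
proof -
  interpret bounded_linear P by (rule oprojD[OF assms])
  show ?thesis unfolding oproj_def sym_op_def
    by (intro conjI allI bounded_linear_sub bounded_linear_ident bounded_linear_axioms)
      (auto simp: rin_simps diff oprojD[OF assms])
qed

lemma mono_right_continuous_sequentially:
  fixes F :: "real \<Rightarrow> real"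
  assumes mono: "\<And>s t. s \<le> t \<Longrightarrow> F s \<le> F t" and lim: "(\<lambda>n. F (t + 1 / Suc n)) \<longlonglongrightarrow> F t"
  shows "continuous (at_right t) F"
  unfolding continuous_within
proof (rule order_tendstoI)
  fix a assume a: "a < F t"
  have "a < F s" if "t < s" for s using mono[of t s] that a by linarith
  then show "\<forall>\<^sub>F s in at_right t. a < F s"
    by (rule eventually_mono[OF eventually_at_right_less])
next
  fix a assume "F t < a"
  then have "\<forall>\<^sub>F n in sequentially. F (t + 1 / Suc n) < a" by (rule order_tendstoD[OF lim])
  then obtain n where n: "F (t + 1 / Suc n) < a" by (auto simp: eventually_sequentially)
  have "F s < a" if "s < t + 1 / Suc n" for s
    using mono[of s "t + 1 / Suc n"] that n by linarith
  then show "\<forall>\<^sub>F s in at_right t. F s < a"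
    unfolding eventually_at_right_field by (intro exI[of _ "t + 1 / Suc n"]) auto
qed

lemma spectral_family_exists:
  fixes T :: "'h::complex_hilbert \<Rightarrow> 'h"
  assumes T: "pos_sym T" and T1: "\<And>x. rin (T x) x \<le> (norm x)\<^sup>2"
  shows "\<exists>E. (\<forall>t. oproj (E t) \<and> bicomm T (E t)) \<and>
    (\<forall>s t x. s \<le> t \<longrightarrow> E s (E t x) = E s x \<and> E t (E s x) = E s x) \<and>
    (\<forall>t x. E t x = x \<longrightarrow> rin (T x) x \<le> t * (norm x)\<^sup>2) \<and>
    (\<forall>t x. E t x = 0 \<longrightarrow> t * (norm x)\<^sup>2 \<le> rin (T x) x) \<and>
    (\<forall>t<0. \<forall>x. E t x = 0) \<and> (\<forall>t\<ge>1. \<forall>x. E t x = x) \<and>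
    (\<forall>x t. continuous (at_right t) (\<lambda>s. (norm (E s x))\<^sup>2))"
proof -
  note Ts = pos_symD(1)[OF T]
  have "\<forall>t. \<exists>E. oproj E \<and> bicomm T E \<and> (\<forall>x. E x = x \<longrightarrow> rin (T x) x \<le> t * (norm x)\<^sup>2) \<and>
    (\<forall>x. E x = 0 \<longrightarrow> x \<noteq> 0 \<longrightarrow> t * (norm x)\<^sup>2 < rin (T x) x)"
    using spectral_projection_exists[OF Ts] by blast
  from choice[OF this] obtain E where E: "\<And>t. oproj (E t)" "\<And>t. bicomm T (E t)"
    "\<And>t x. E t x = x \<Longrightarrow> rin (T x) x \<le> t * (norm x)\<^sup>2"
    "\<And>t x. E t x = 0 \<Longrightarrow> x \<noteq> 0 \<Longrightarrow> t * (norm x)\<^sup>2 < rin (T x) x" by auto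
  have diff: "E t (x - y) = E t x - E t y" for t x y
    by (rule linear_diff[OF oproj_linear[OF E(1)]])
  have com: "E s (E t x) = E t (E s x)" for s t x
    by (rule bicommD[OF E(2) oprojD(2)[OF E(1)] oprojD(2)[OF E(1)]])
      (simp_all add: oprojD(3)[OF E(1)] bicomm_self[OF Ts E(2)])
  \<comment> \<open>The two form estimates contradict each other on a nonzero y. Monotonicity
    follows by applying this to the part of \<open>E s x\<close> killed by \<open>E t\<close>, so
    positive parts for different t never have to be compared.\<close>
  have sep: "y = 0" if "E s y = y" "E t y = 0" "s \<le> t" for s t y
  proof (rule ccontr)
    assume "y \<noteq> 0"
    then show False
      using E(4)[OF that(2) \<open>y \<noteq> 0\<close>] E(3)[OF that(1)] mult_right_mono[OF that(3) zero_le_power2, of "norm y"]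
      by linarith
  qed
  have mono: "E t (E s x) = E s x" if "s \<le> t" for s t x
  proof -
    have "E s x - E t (E s x) = 0"
      by (rule sep[OF _ _ that]) (simp_all add: diff com[of s t] oprojD(4)[OF E(1)])
    then have "E s x = E t (E s x)" by (simp only: right_minus_eq)
    then show ?thesis by (rule sym)
  qed
  have mono': "E s (E t x) = E s x" if "s \<le> t" for s t x using mono[OF that] by (simp add: com[of s t])
  \<comment> \<open>The value t = 0 is excluded: the kernel of \<open>T\<close> sits in the range of
    \<open>E 0\<close>.\<close>
  have "E t x = 0" if "t < 0" for t x
  proof -
    have "rin (T (E t x)) (E t x) \<le> t * (norm (E t x))\<^sup>2" by (rule E(3)) (simp add: oprojD(4)[OF E(1)])
    with pos_symD(4)[OF T, of "E t x"] have "0 \<le> t * (norm (E t x))\<^sup>2" by simp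
    with that show ?thesis by (simp add: zero_le_mult_iff)
  qed
  moreover have "E t x = x" if "1 \<le> t" for t x
  proof (rule ccontr)
    assume "E t x \<noteq> x"
    then have "t * (norm (x - E t x))\<^sup>2 < rin (T (x - E t x)) (x - E t x)"
      by (intro E(4)) (simp_all add: diff oprojD(4)[OF E(1)])
    with T1[of "x - E t x"] mult_right_mono[OF that zero_le_power2, of "norm (x - E t x)"] show False by linarith
  qed
  moreover have "continuous (at_right t) (\<lambda>s. (norm (E s x))\<^sup>2)" for x t
  proof (rule mono_right_continuous_sequentially)
    show "(norm (E s x))\<^sup>2 \<le> (norm (E t x))\<^sup>2" if "s \<le> t" for s t
      using oproj_norm_le[OF E(1), of s "E t x"] mono'[OF that] by (simp add: power_mono)
    define r where "r n = t + 1 / real (Suc n)" for n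
    have r: "t \<le> r n" "m \<le> n \<Longrightarrow> r n \<le> r m" for m n
      by (auto simp: r_def frac_le)
    have rt: "r \<longlonglongrightarrow> t"
      unfolding r_def using tendsto_add[OF tendsto_const LIMSEQ_inverse_real_of_nat, of t]
      by (simp add: inverse_eq_divide)
    have "Cauchy (\<lambda>n. x - E (r n) x)"
      by (rule increasing_projections_Cauchy[OF oproj_complement[OF E(1)]]) (simp add: diff mono[OF r(2)])
    then obtain l where "(\<lambda>n. x - E (r n) x) \<longlonglongrightarrow> l" by (auto simp: Cauchy_convergent_iff convergent_def)
    from tendsto_diff[OF tendsto_const[of x] this] have l: "(\<lambda>n. E (r n) x) \<longlonglongrightarrow> x - l" by simp
    \<comment> \<open>\<open>v\<close> is the jump of the family at t from the right. It is killed
      by \<open>E t\<close> but fixed by every \<open>E (r m)\<close>, so its form is at most t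
      ||v||^2 in the limit, against the strict lower bound.\<close>
    define v where "v = x - l - E t x"
    have lim: "(\<lambda>n. E s (E (r n) x)) \<longlonglongrightarrow> E s (x - l)" for s
      by (rule bounded_linear.tendsto[OF oprojD(2)[OF E(1)] l])
    have "E t (x - l) = E t x"
      using lim[of t] by (simp add: mono'[OF r(1)] LIMSEQ_const_iff)
    then have Ev: "E t v = 0" by (simp add: v_def diff oprojD(4)[OF E(1)])
    have "E (r m) v = v" for m
    proof -
      have "\<forall>\<^sub>F n in sequentially. E (r m) (E (r n) x) = E (r n) x"
        using eventually_ge_at_top[of m] by eventually_elim (simp add: mono[OF r(2)])
      then have "(\<lambda>n. E (r n) x) \<longlonglongrightarrow> E (r m) (x - l)" by (rule Lim_transform_eventually[OF lim])
      then have "E (r m) (x - l) = x - l" using l LIMSEQ_unique by blast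
      then show ?thesis by (simp add: v_def diff mono[OF r(1)])
    qed
    then have "rin (T v) v \<le> r m * (norm v)\<^sup>2" for m by (rule E(3))
    then have "rin (T v) v \<le> t * (norm v)\<^sup>2"
      by (intro LIMSEQ_le_const[OF tendsto_mult[OF rt tendsto_const]]) auto
    with E(4)[OF Ev] have "v = 0" by force
    then have "(\<lambda>n. E (r n) x) \<longlonglongrightarrow> E t x" using l by (simp add: v_def)
    then show "(\<lambda>n. (norm (E (t + 1 / real (Suc n)) x))\<^sup>2) \<longlonglongrightarrow> (norm (E t x))\<^sup>2"
      unfolding r_def by (intro tendsto_intros)
  qed
  moreover have "t * (norm x)\<^sup>2 \<le> rin (T x) x" if "E t x = 0" for t x
    using E(4)[OF that] by (cases "x = 0") auto
  ultimately show ?thesis using E mono mono' by (intro exI[of _ E]) auto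
qed

section \<open>Projection-valued measures\<close>

lemma pvmD:
  assumes "proj_valued_measure K E" "S \<in> sets borel"
  shows "bounded_op K (E S)" "x \<in> K \<Longrightarrow> E S (E S x) = E S x"
    "x \<in> K \<Longrightarrow> y \<in> K \<Longrightarrow> rin (E S x) y = rin x (E S y)" "x \<in> K \<Longrightarrow> E S x \<in> K"
    "x \<in> K \<Longrightarrow> E UNIV x = x"
    "S' \<in> sets borel \<Longrightarrow> x \<in> K \<Longrightarrow> E S (E S' x) = E (S \<inter> S') x"
proof -
  show bo: "bounded_op K (E S)"
    using assms by (auto simp: proj_valued_measure_def orthogonal_projection_def)
  show "x \<in> K \<Longrightarrow> E S x \<in> K" by (rule bounded_opD(1)[OF bo])
qed (use assms in \<open>auto simp: proj_valued_measure_def orthogonal_projection_def rin_def\<close>)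

lemma pvm_rin_eq:
  assumes "proj_valued_measure K E" "S \<in> sets borel" "x \<in> K"
  shows "rin (E S x) x = (norm (E S x))\<^sup>2"
  using pvmD(2,3,4)[OF assms(1,2)] assms(3) by (metis rin_self)

lemma pvm_sums:
  assumes "proj_valued_measure K E" "range F \<subseteq> sets borel" "disjoint_family F" "x \<in> K"
  shows "(\<lambda>n::nat. E (F n) x) sums E (\<Union>n. F n) x"
  using assms unfolding proj_valued_measure_def by blast

text \<open>Countable additivity for the constant empty family: the terms of a convergent series
  tend to 0, and here they are all equal.\<close>

lemma pvm_empty:
  assumes "proj_valued_measure K E" "x \<in> K"
  shows "E {} x = 0"
proof -
  have "(\<lambda>n::nat. E {} x) sums E (\<Union>n::nat. {}) x"
    by (rule pvm_sums[OF assms(1) _ _ assms(2)]) (auto simp: disjoint_family_on_def)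
  then have "(\<lambda>n::nat. E {} x) \<longlonglongrightarrow> 0" by (intro summable_LIMSEQ_zero sums_summable)
  then show ?thesis by (simp add: LIMSEQ_const_iff)
qed

lemma pvm_finite_sum:
  fixes N :: nat
  assumes "proj_valued_measure K E" "\<And>n. F n \<in> sets borel" "disjoint_family_on F {..N}" "x \<in> K"
  shows "E (\<Union>n\<le>N. F n) x = (\<Sum>n\<le>N. E (F n) x)"
proof -
  define G where "G n = (if n \<le> N then F n else {})" for n
  have "(\<lambda>n. E (G n) x) sums E (\<Union>n. G n) x"
    by (rule pvm_sums[OF assms(1) _ _ assms(4)])
      (use assms(2,3) in \<open>auto simp: disjoint_family_on_def G_def\<close>)
  moreover have "(\<Union>n. G n) = (\<Union>n\<le>N. F n)" by (auto simp: G_def split: if_splits)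
  moreover have "(\<lambda>n. E (G n) x) sums (\<Sum>n\<le>N. E (G n) x)"
    by (rule sums_finite) (auto simp: G_def pvm_empty[OF assms(1,4)])
  ultimately show ?thesis using sums_unique2 by (fastforce simp: G_def)
qed

lemma pvm_complement:
  assumes "proj_valued_measure K E" "S \<in> sets borel" "x \<in> K"
  shows "E (- S) x = x - E S x"
proof -
  let ?F = "\<lambda>n::nat. if n = 0 then S else - S"
  have "E (\<Union>n\<le>1. ?F n) x = (\<Sum>n\<le>1. E (?F n) x)"
    using assms by (intro pvm_finite_sum[OF assms(1) _ _ assms(3)]) (auto simp: disjoint_family_on_def)
  moreover have "(\<Union>n\<le>(1::nat). ?F n) = UNIV" by (auto intro: exI[of _ 0] exI[of _ 1])
  ultimately have "E UNIV x = E S x + E (- S) x" by (simp only:) simp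
  then show ?thesis using pvmD(5)[OF assms(1,2,3)] by (metis add_diff_cancel_left')
qed

lemma sets_pvm_measure [simp, measurable_cong]: "sets (pvm_measure E x) = sets borel"
  unfolding pvm_measure_def by (metis sets.sigma_sets_eq sets_measure_of sets.space_closed space_borel)

lemma space_pvm_measure [simp]: "space (pvm_measure E x) = UNIV"
  unfolding pvm_measure_def by (simp add: space_measure_of_conv)

lemma emeasure_pvm_measure:
  assumes "proj_valued_measure K E" "x \<in> K" "S \<in> sets borel"
  shows "emeasure (pvm_measure E x) S = ennreal ((norm (E S x))\<^sup>2)"
proof -
  have "emeasure (pvm_measure E x) S = ennreal (Re (cinner (E S x) x))"
  proof (rule emeasure_measure_of[OF pvm_measure_def])
    show "positive (sets (pvm_measure E x)) (\<lambda>S. ennreal (Re (cinner (E S x) x)))"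
      using pvm_empty[OF assms(1,2)] rin_zero(1)[of x] by (simp add: positive_def rin_def)
    show "countably_additive (sets (pvm_measure E x)) (\<lambda>S. ennreal (Re (cinner (E S x) x)))"
    proof (rule countably_additiveI)
      fix F :: "nat \<Rightarrow> real set"
      assume F: "range F \<subseteq> sets (pvm_measure E x)" "disjoint_family F"
      have "(\<lambda>n. rin (E (F n) x) x) sums rin (E (\<Union>n. F n) x) x"
        by (rule sums_rin_left)
          (rule pvm_sums[OF assms(1) _ F(2) assms(2)], use F in simp)
      then show "(\<Sum>n. ennreal (Re (cinner (E (F n) x) x))) = ennreal (Re (cinner (E (\<Union>n. F n) x) x))"
        unfolding rin_def[symmetric]
        by (intro suminf_ennreal_eq) (use F(1) pvm_rin_eq[OF assms(1) _ assms(2)] in auto)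
    qed
  qed (use assms in auto)
  then show ?thesis using pvm_rin_eq[OF assms(1,3,2)] by (simp add: rin_def)
qed

lemma measure_pvm_measure:
  assumes "proj_valued_measure K E" "x \<in> K" "S \<in> sets borel"
  shows "measure (pvm_measure E x) S = (norm (E S x))\<^sup>2"
  unfolding measure_def emeasure_pvm_measure[OF assms] by simp

lemma finite_measure_pvm_measure:
  assumes "proj_valued_measure K E" "x \<in> K"
  shows "finite_measure (pvm_measure E x)"
  by (rule finite_measureI) (simp add: emeasure_pvm_measure[OF assms])

text \<open>The measure of the complement of S is ||x - E S x||^2. This translates between fixed
  vectors of a projection and supports of scalar measures.\<close>

lemma pvm_AE_iff:
  assumes E: "proj_valued_measure K E" and x: "x \<in> K" and S: "S \<in> sets borel"
  shows "(AE r in pvm_measure E x. r \<in> S) \<longleftrightarrow> E S x = x"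
proof -
  have "(AE r in pvm_measure E x. r \<in> S) \<longleftrightarrow> emeasure (pvm_measure E x) (- S) = 0"
    by (subst AE_iff_measurable[where N = "- S"]) (use S in auto)
  also have "\<dots> \<longleftrightarrow> E (- S) x = 0"
    by (subst emeasure_pvm_measure[OF E x]) (use S in auto)
  also have "\<dots> \<longleftrightarrow> E S x = x" using pvm_complement[OF E S x] by auto
  finally show ?thesis .
qed

text \<open>The cells \<open>i = 0, \<dots>, N\<close> cover \<open>(-1/N, 1]\<close>; the cell \<open>0\<close> is there to catch the point \<open>0\<close>.\<close>

definition grid_cell :: "nat \<Rightarrow> nat \<Rightarrow> real set" where
  "grid_cell N i = {(real i - 1) / real N <.. real i / real N}"

lemma grid_cell_borel [simp, measurable]: "grid_cell N i \<in> sets borel"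
  by (simp add: grid_cell_def)

lemma in_grid_cell_iff: "0 < N \<Longrightarrow> r \<in> grid_cell N i \<longleftrightarrow> int i = \<lceil>real N * r\<rceil>"
proof -
  assume N: "0 < N"
  have "r \<in> grid_cell N i \<longleftrightarrow> real i - 1 < real N * r \<and> real N * r \<le> real i"
    using N by (auto simp: grid_cell_def field_simps)
  also have "\<dots> \<longleftrightarrow> \<lceil>real N * r\<rceil> = int i" by (simp add: ceiling_eq_iff)
  finally show ?thesis by auto
qed

lemma grid_cell_disjoint: "0 < N \<Longrightarrow> disjoint_family_on (grid_cell N) I"
  by (auto simp: disjoint_family_on_def in_grid_cell_iff)

lemma grid_cell_cover: "0 < N \<Longrightarrow> {0..1} \<subseteq> (\<Union>i\<le>N. grid_cell N i)"
proof
  fix r :: real assume N: "0 < N" and r: "r \<in> {0..1}"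
  have "0 \<le> real N * r" using r by simp
  then have "0 \<le> \<lceil>real N * r\<rceil>" by simp
  moreover have "real N * r \<le> real N" using r N by (simp add: mult_left_le)
  then have "\<lceil>real N * r\<rceil> \<le> int N" by (simp add: ceiling_le_iff)
  ultimately show "r \<in> (\<Union>i\<le>N. grid_cell N i)"
    by (intro UN_I[of "nat \<lceil>real N * r\<rceil>"]) (auto simp: in_grid_cell_iff[OF N] nat_le_iff)
qed

text \<open>A Riemann sum argument with right endpoints. The term \<open>D / N\<close> measures how
  far the pieces of V are from the Riemann sum, \<open>C / N\<close> how far the sum is from the
  integral; V does not depend on N, so both errors disappear in the limit.\<close>

lemma integral_eq_grid_limit:
  fixes M :: "real measure" and f :: "real \<Rightarrow> real"
  assumes fin: "finite_measure M" and sets[measurable_cong]: "sets M = sets borel"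
    and supp: "AE r in M. r \<in> {0..1}"
    and lip: "\<And>r s. r \<in> {0..1} \<Longrightarrow> s \<in> {0..1} \<Longrightarrow> \<bar>f r - f s\<bar> \<le> C * \<bar>r - s\<bar>"
    and int: "integrable M (\<lambda>r. indicator {0..1} r *\<^sub>R f r)"
    and V: "\<And>N. 0 < N \<Longrightarrow> \<exists>\<nu>. V = (\<Sum>i\<le>N. \<nu> i) \<and>
      (\<forall>i\<le>N. \<bar>\<nu> i - f (real i / real N) * measure M (grid_cell N i)\<bar> \<le> D / real N * measure M (grid_cell N i))"
    and D: "0 \<le> D"
  shows "V = (LINT r:{0..1}|M. f r)"
proof -
  interpret finite_measure M by (rule fin)
  have C: "0 \<le> C" using lip[of 0 1] by auto
  let ?m = "measure M (space M)"
  have bound: "\<bar>V - (LINT r:{0..1}|M. f r)\<bar> \<le> (C + D) * ?m / real N" if N: "0 < N" for N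
  proof -
    obtain \<nu> where \<nu>: "V = (\<Sum>i\<le>N. \<nu> i)"
      "\<And>i. i \<le> N \<Longrightarrow> \<bar>\<nu> i - f (real i / real N) * measure M (grid_cell N i)\<bar> \<le> D / real N * measure M (grid_cell N i)"
      using V[OF N] by auto
    define g where "g r = (\<Sum>i\<le>N. f (real i / real N) * indicator (grid_cell N i) r)" for r
    have ig: "integrable M g" unfolding g_def
      by (intro Bochner_Integration.integrable_sum integrable_mult_right integrable_real_indicator)
        (auto simp: emeasure_eq_measure sets)
    have sg: "(\<integral>r. g r \<partial>M) = (\<Sum>i\<le>N. f (real i / real N) * measure M (grid_cell N i))"
      unfolding g_def
      by (subst Bochner_Integration.integral_sum)
        (auto intro!: integrable_mult_right integrable_real_indicator
          simp: emeasure_eq_measure sets sets_eq_imp_space_eq[OF sets])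
    have "\<bar>V - (\<integral>r. g r \<partial>M)\<bar> \<le> (\<Sum>i\<le>N. \<bar>\<nu> i - f (real i / real N) * measure M (grid_cell N i)\<bar>)"
      unfolding sg \<nu>(1) sum_subtractf[symmetric] by (rule sum_abs)
    also have "\<dots> \<le> (\<Sum>i\<le>N. D / real N * measure M (grid_cell N i))" by (intro sum_mono \<nu>(2)) simp
    also have "\<dots> = D / real N * measure M (\<Union>i\<le>N. grid_cell N i)"
      by (subst finite_measure_finite_Union)
        (auto simp: grid_cell_disjoint[OF N] sets sum_distrib_left)
    also have "\<dots> \<le> D / real N * ?m"
      using D by (intro mult_left_mono bounded_measure) auto
    finally have 1: "\<bar>V - (\<integral>r. g r \<partial>M)\<bar> \<le> D / real N * ?m" .
    have close: "\<bar>g r - indicator {0..1} r *\<^sub>R f r\<bar> \<le> C / real N" if r: "r \<in> {0..1}" for r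
    proof -
      obtain j where j: "j \<le> N" "r \<in> grid_cell N j" using grid_cell_cover[OF N] r by auto
      have "g r = (\<Sum>i\<le>N. if i = j then f (real j / real N) else 0)"
        unfolding g_def
        by (rule sum.cong) (use j(2) in \<open>auto simp: in_grid_cell_iff[OF N] indicator_def\<close>)
      also have "\<dots> = f (real j / real N)" using j(1) by simp
      finally have "g r = f (real j / real N)" .
      moreover have "\<bar>f (real j / real N) - f r\<bar> \<le> C * \<bar>real j / real N - r\<bar>"
        by (rule lip) (use j(1) N r in auto)
      moreover have "C * \<bar>real j / real N - r\<bar> \<le> C * (1 / real N)"
        using j(2) C by (intro mult_left_mono) (auto simp: grid_cell_def diff_divide_distrib)
      ultimately show ?thesis using r by simp
    qed
    have "\<bar>(\<integral>r. g r \<partial>M) - (LINT r:{0..1}|M. f r)\<bar> = \<bar>\<integral>r. g r - indicator {0..1} r *\<^sub>R f r \<partial>M\<bar>"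
      unfolding set_lebesgue_integral_def by (subst Bochner_Integration.integral_diff[OF ig int]) simp
    also have "\<dots> \<le> (\<integral>r. \<bar>g r - indicator {0..1} r *\<^sub>R f r\<bar> \<partial>M)"
      using integral_norm_bound[of M "\<lambda>r. g r - indicator {0..1} r *\<^sub>R f r"] by simp
    also have "\<dots> \<le> (\<integral>r. C / real N \<partial>M)"
      using supp close by (intro integral_mono_AE Bochner_Integration.integrable_abs
          Bochner_Integration.integrable_diff ig int) auto
    finally have "\<bar>(\<integral>r. g r \<partial>M) - (LINT r:{0..1}|M. f r)\<bar> \<le> C / real N * ?m"
      by (simp add: mult.commute)
    with 1 show ?thesis by (simp add: add_divide_distrib distrib_right abs_le_iff)
  qed
  have "(\<lambda>N. (C + D) * ?m / real N) \<longlonglongrightarrow> 0" by (rule lim_const_over_n)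
  then have "\<bar>V - (LINT r:{0..1}|M. f r)\<bar> \<le> 0"
    using bound by (intro LIMSEQ_le_const) (auto intro!: exI[of _ 1])
  then show ?thesis by simp
qed

lemma integrable_indicator_continuous:
  fixes M :: "real measure" and f :: "real \<Rightarrow> real"
  assumes "finite_measure M" "sets M = sets borel" "continuous_on {0..1} f"
  shows "integrable M (\<lambda>r. indicator {0..1} r *\<^sub>R f r)"
proof -
  interpret finite_measure M by (rule assms)
  have "compact (f ` {0..1})" by (intro compact_continuous_image assms) auto
  then obtain B where B: "\<And>r. r \<in> {0..1} \<Longrightarrow> norm (f r) \<le> B"
    using compact_imp_bounded[of "f ` {0..1}"] unfolding bounded_iff by blast
  have "(\<lambda>r. indicator {0..1} r *\<^sub>R f r) \<in> borel_measurable M"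
    unfolding measurable_cong_sets[OF assms(2) refl]
    by (rule borel_measurable_continuous_on_indicator[OF _ assms(3)]) simp
  moreover have "AE r in M. norm (indicator {0..1} r *\<^sub>R f r) \<le> max B 0"
    using B by (intro AE_I2) (force simp: indicator_def)
  ultimately show ?thesis by (rule integrable_const_bound[rotated])
qed

text \<open>Splitting x into the pieces \<open>E (grid_cell N i) x\<close> splits <L x, x> into cell
  contributions. It is applied with \<open>L = R\<close> to construct a spectral measure, and with L
  a power of \<open>R\<close> to exploit a given one.\<close>

lemma pvm_quadratic_form_eq_integral:
  assumes K: "csubspace K" and E: "proj_valued_measure K E" and x: "x \<in> K"
    and supp: "E {0..1} x = x" and f: "continuous_on {0..1} f"
    and lip: "\<And>r s. r \<in> {0..1} \<Longrightarrow> s \<in> {0..1} \<Longrightarrow> \<bar>f r - f s\<bar> \<le> C * \<bar>r - s\<bar>"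
    and L: "bounded_op K L" and D: "0 \<le> D"
    and cell: "\<And>N i. 0 < N \<Longrightarrow> i \<le> N \<Longrightarrow>
      \<bar>rin (L (E (grid_cell N i) x)) x - f (real i / real N) * (norm (E (grid_cell N i) x))\<^sup>2\<bar>
        \<le> D / real N * (norm (E (grid_cell N i) x))\<^sup>2"
  shows "rin (L x) x = (LINT r:{0..1}|pvm_measure E x. f r)"
proof (rule integral_eq_grid_limit[OF finite_measure_pvm_measure[OF E x] sets_pvm_measure _ lip _ _ D])
  show AE01: "AE r in pvm_measure E x. r \<in> {0..1}"
    unfolding pvm_AE_iff[OF E x atLeastAtMost_borel] by (rule supp)
  show "integrable (pvm_measure E x) (\<lambda>r. indicator {0..1} r *\<^sub>R f r)"
    by (rule integrable_indicator_continuous[OF finite_measure_pvm_measure[OF E x] sets_pvm_measure f])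
  fix N :: nat assume N: "0 < N"
  have "AE r in pvm_measure E x. r \<in> (\<Union>i\<le>N. grid_cell N i)"
    by (rule eventually_mono[OF AE01]) (use grid_cell_cover[OF N] in blast)
  then have "E (\<Union>i\<le>N. grid_cell N i) x = x" by (subst (asm) pvm_AE_iff[OF E x]) auto
  then have xs: "x = (\<Sum>i\<le>N. E (grid_cell N i) x)"
    using pvm_finite_sum[OF E grid_cell_borel grid_cell_disjoint[OF N] x] by simp
  have "L (\<Sum>i\<in>I. E (grid_cell N i) x) = (\<Sum>i\<in>I. L (E (grid_cell N i) x)) \<and>
    (\<Sum>i\<in>I. E (grid_cell N i) x) \<in> K" if "finite I" for I
    using that
  proof (induction I)
    case empty
    then show ?case by (simp add: bounded_op_zero[OF K L] csubspaceD(1)[OF K])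
  next
    case (insert i I)
    have "E (grid_cell N i) x \<in> K" by (rule pvmD(4)[OF E grid_cell_borel x])
    with insert show ?case
      by (simp add: bounded_opD(2)[OF L] csubspaceD(2)[OF K])
  qed
  from this[of "{..N}"] have "L x = (\<Sum>i\<le>N. L (E (grid_cell N i) x))"
    unfolding xs[symmetric] by simp
  then have "rin (L x) x = (\<Sum>i\<le>N. rin (L (E (grid_cell N i) x)) x)" by (simp add: rin_sum_left)
  then show "\<exists>\<nu>. rin (L x) x = (\<Sum>i\<le>N. \<nu> i) \<and> (\<forall>i\<le>N. \<bar>\<nu> i - f (real i / real N) *
      measure (pvm_measure E x) (grid_cell N i)\<bar> \<le> D / real N * measure (pvm_measure E x) (grid_cell N i))"
    using cell[OF N] unfolding measure_pvm_measure[OF E x grid_cell_borel] by blast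
qed auto

section \<open>The spectral theorem\<close>

lemma sym_op_eqI:
  assumes P: "sym_op P" and Q: "sym_op Q" and eq: "\<And>x. rin (P x) x = rin (Q x) x"
  shows "P = Q"
proof
  fix u
  interpret P: bounded_linear P by (rule sym_opD[OF P])
  interpret Q: bounded_linear Q by (rule sym_opD[OF Q])
  have "norm (P u - Q u) \<le> 0 * norm u"
    by (rule real_quadratic_form_norm_bound[where K = UNIV])
      (simp_all add: P.add Q.add P.scaleR Q.scaleR algebra_simps rin_simps eq sym_opD(2)[OF P] sym_opD(2)[OF Q])
  then show "P u = Q u" by simp
qed

text \<open>At the vector Q x the hypothesis reads ||P Q x||^2 + ||Q x||^2 \<le> ||Q x||^2.\<close>

lemma oproj_disjoint:
  assumes "oproj P" "oproj Q" "\<And>x. rin (P x) x + rin (Q x) x \<le> (norm x)\<^sup>2"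
  shows "P (Q x) = 0"
  using assms(3)[of "Q x"] oproj_rin[OF assms(1), of "Q x"] oproj_rin[OF assms(2), of "Q x"]
  by (simp add: oprojD(4)[OF assms(2)])

text \<open>The partial sums are increasing projections, hence Cauchy at each vector. Idempotence of
  the limit follows from \<open>Q m (P x) = Q m x\<close>.\<close>

lemma orthogonal_projections_sums:
  assumes Q: "\<And>i. oproj (Q i)" and orth: "\<And>i j x. i \<noteq> j \<Longrightarrow> Q i (Q j x) = 0"
  shows "\<exists>P. oproj P \<and> (\<forall>x. (\<lambda>i::nat. Q i x) sums P x)"
proof -
  define S where "S n x = (\<Sum>i<n. Q i x)" for n x
  have QS: "Q m (S n x) = (if m < n then Q m x else 0)" for m n x
  proof -
    have "Q m (S n x) = (\<Sum>i<n. Q m (Q i x))"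
      unfolding S_def by (rule linear_sum[OF oproj_linear[OF Q]])
    also have "\<dots> = (\<Sum>i<n. if i = m then Q m x else 0)"
      by (rule sum.cong) (auto simp: orth oprojD(4)[OF Q])
    finally show ?thesis by simp
  qed
  have SS: "S m (S n x) = S m x" if "m \<le> n" for m n x
    unfolding S_def[of m] by (rule sum.cong) (use that in \<open>auto simp: QS\<close>)
  have "oproj (S n)" for n
    unfolding oproj_def sym_op_def
  proof (intro conjI allI)
    show "bounded_linear (S n)" unfolding S_def by (intro bounded_linear_sum oprojD(2)[OF Q])
    show "rin (S n x) y = rin x (S n y)" for x y
      by (simp add: S_def rin_sum_left rin_sum_right oprojD(3)[OF Q])
  qed (simp add: SS)
  then have "Cauchy (\<lambda>n. S n x)" for x
    by (rule increasing_projections_Cauchy) (rule SS)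
  then have "\<exists>l. (\<lambda>i. Q i x) sums l" for x
    by (simp add: sums_def S_def Cauchy_convergent_iff convergent_def)
  then obtain P where P: "\<And>x. (\<lambda>i. Q i x) sums P x" by metis
  have sym: "rin (P x) y = rin x (P y)" for x y
  proof (rule sums_unique2)
    show "(\<lambda>i. rin (Q i x) y) sums rin (P x) y"
      by (rule sums_rin_left[OF P])
    show "(\<lambda>i. rin (Q i x) y) sums rin x (P y)" unfolding oprojD(3)[OF Q]
      by (rule sums_rin_right[OF P])
  qed
  have QP: "Q m (P x) = Q m x" for m x
  proof (rule sums_unique2)
    show "(\<lambda>i. Q m (Q i x)) sums Q m (P x)" by (rule bounded_linear.sums[OF oprojD(2)[OF Q] P])
    have "(\<lambda>i. Q m (Q i x)) = (\<lambda>i. if i = m then Q m x else 0)"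
      by (auto simp: fun_eq_iff orth oprojD(4)[OF Q])
    then show "(\<lambda>i. Q m (Q i x)) sums Q m x" using sums_single[of m "\<lambda>_. Q m x"] by simp
  qed
  have "bounded_linear P"
  proof (rule bounded_linear_intro[where K = 1])
    fix x y r
    have "(\<lambda>i. Q i (x + y)) sums (P x + P y)"
      unfolding linear_add[OF oproj_linear[OF Q]] by (rule sums_add[OF P P])
    then show "P (x + y) = P x + P y" by (rule sums_unique2[OF P])
    have "(\<lambda>i. Q i (r *\<^sub>R x)) sums (r *\<^sub>R P x)"
      unfolding linear_cmul[OF oproj_linear[OF Q]] by (rule sums_scaleR_right[OF P])
    then show "P (r *\<^sub>R x) = r *\<^sub>R P x" by (rule sums_unique2[OF P])
    have "(\<lambda>n. norm (S n x)) \<longlonglongrightarrow> norm (P x)"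
      using P[of x] by (intro tendsto_norm) (simp add: sums_def S_def)
    then have "norm (P x) \<le> norm x"
      by (rule LIMSEQ_le_const2) (use \<open>\<And>n. oproj (S n)\<close> oproj_norm_le in blast)
    then show "norm (P x) \<le> norm x * 1" by simp
  qed
  moreover have "P (P x) = P x" for x
    using P[of "P x"] P[of x] unfolding QP by (rule sums_unique2)
  ultimately have "oproj P" using sym by (simp add: oproj_def sym_op_def)
  with P show ?thesis by blast
qed

lemma bicomm_closed:
  shows "bicomm T (\<lambda>x. 0)" "bicomm T P \<Longrightarrow> bicomm T (\<lambda>x. x - P x)"
    "bicomm T P \<Longrightarrow> bicomm T Q \<Longrightarrow> bicomm T (\<lambda>x. P x - Q x)"
    "(\<And>i::nat. bicomm T (F i)) \<Longrightarrow> (\<And>x. (\<lambda>i. F i x) sums S x) \<Longrightarrow> bicomm T S"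
proof -
  show "bicomm T (\<lambda>x. 0)" unfolding bicomm_def by (auto simp: linear_simps)
  show "bicomm T P \<Longrightarrow> bicomm T (\<lambda>x. x - P x)"
    unfolding bicomm_def by (simp add: linear_simps)
  show "bicomm T P \<Longrightarrow> bicomm T Q \<Longrightarrow> bicomm T (\<lambda>x. P x - Q x)"
    unfolding bicomm_def by (simp add: linear_simps)
  assume F: "\<And>i::nat. bicomm T (F i)" and S: "\<And>x. (\<lambda>i. F i x) sums S x"
  show "bicomm T S" unfolding bicomm_def
  proof (intro allI impI)
    fix W W' x
    assume W: "bounded_linear W" "bounded_linear W'" "\<forall>x y. rin (W x) y = rin x (W' y)"
      "\<forall>x. W (T x) = T (W x)"
    have "(\<lambda>i. W (F i x)) sums W (S x)" by (rule bounded_linear.sums[OF W(1) S])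
    moreover have "W (F i x) = F i (W x)" for i
      by (rule bicommD[OF F W(1,2)]) (use W in auto)
    ultimately show "W (S x) = S (W x)" using S[of "W x"] sums_unique2 by simp
  qed
qed

lemma oproj_disjoint_sets:
  assumes fin: "\<And>x. finite_measure (\<mu> x)" and sets: "\<And>x. sets (\<mu> x) = sets borel"
    and space: "\<And>x. measure (\<mu> x) UNIV = (norm x)\<^sup>2"
    and P: "oproj P" "\<And>x. rin (P x) x = measure (\<mu> x) A" and Q: "oproj Q" "\<And>x. rin (Q x) x = measure (\<mu> x) B"
    and AB: "A \<in> sets borel" "B \<in> sets borel" "A \<inter> B = {}"
  shows "P (Q x) = 0"
proof (rule oproj_disjoint[OF P(1) Q(1)])
  fix x
  have "measure (\<mu> x) A + measure (\<mu> x) B = measure (\<mu> x) (A \<union> B)"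
    by (rule finite_measure.finite_measure_Union[OF fin, symmetric]) (use AB in \<open>auto simp: sets\<close>)
  also have "\<dots> \<le> (norm x)\<^sup>2"
    using finite_measure.bounded_measure[OF fin, of x "A \<union> B"] sets_eq_imp_space_eq[OF sets, of x]
    by (simp add: space)
  finally show "rin (P x) x + rin (Q x) x \<le> (norm x)\<^sup>2" by (simp add: P(2) Q(2))
qed

text \<open>The sets whose measures are the quadratic form of a projection are a Dynkin system, because
  projections whose forms add up to at most the norm are orthogonal. No complex measures are needed.\<close>

lemma projections_from_measures:
  fixes T :: "'h::complex_hilbert \<Rightarrow> 'h" and \<mu> :: "'h \<Rightarrow> real measure"
  assumes fin: "\<And>x. finite_measure (\<mu> x)" and sets: "\<And>x. sets (\<mu> x) = sets borel"
    and space: "\<And>x. measure (\<mu> x) UNIV = (norm x)\<^sup>2"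
    and basic: "\<And>a b. a \<le> b \<Longrightarrow> \<exists>Q. oproj Q \<and> bicomm T Q \<and> (\<forall>x. rin (Q x) x = measure (\<mu> x) {a<..b})"
    and S: "S \<in> sets borel"
  shows "\<exists>Q. oproj Q \<and> bicomm T Q \<and> (\<forall>x. rin (Q x) x = measure (\<mu> x) S)"
proof -
  let ?G = "range (\<lambda>(a, b). {a<..b::real})"
  have bs: "sets borel = sigma_sets UNIV ?G"
    unfolding borel_sigma_sets_Ioc by (rule sets_measure_of) simp
  have sp: "space (\<mu> x) = UNIV" for x using sets_eq_imp_space_eq[OF sets] by simp
  have zero: "oproj (\<lambda>x::'h. 0)" by (simp add: oproj_def sym_op_def)
  have "Int_stable ?G" by (auto simp: Int_stable_def image_def) blast
  moreover have "?G \<subseteq> Pow UNIV" by simp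
  moreover have "S \<in> sigma_sets UNIV ?G" using S bs by simp
  ultimately show ?thesis
  proof (induction rule: sigma_sets_induct_disjoint)
    case (basic A)
    then obtain a b where A: "A = {a<..b}" by auto
    show ?case
    proof (cases "a \<le> b")
      case True
      then show ?thesis unfolding A by (rule assms(4))
    next
      case False
      then have "A = {}" using A by auto
      then show ?thesis by (intro exI[of _ "\<lambda>x. 0"]) (simp add: zero bicomm_closed(1))
    qed
  next
    case empty
    then show ?case by (intro exI[of _ "\<lambda>x. 0"]) (simp add: zero bicomm_closed(1))
  next
    case (compl A)
    then obtain Q where Q: "oproj Q" "bicomm T Q" "\<And>x. rin (Q x) x = measure (\<mu> x) A" by auto
    have "measure (\<mu> x) (UNIV - A) = (norm x)\<^sup>2 - measure (\<mu> x) A" for x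
      using finite_measure.finite_measure_compl[OF fin, of A x] compl(1) bs by (simp add: sets sp space)
    then show ?case
      by (intro exI[of _ "\<lambda>x. x - Q x"])
        (simp add: oproj_complement[OF Q(1)] bicomm_closed(2)[OF Q(2)] rin_simps rin_self Q(3))
  next
    case (union A)
    then obtain Q where Q: "\<And>i. oproj (Q i)" "\<And>i. bicomm T (Q i)"
      "\<And>i x. rin (Q i x) x = measure (\<mu> x) (A i)" by metis
    have Ab: "A i \<in> sets borel" for i using union(2) bs by auto
    have "Q i (Q j x) = 0" if "i \<noteq> j" for i j x
      by (rule oproj_disjoint_sets[OF fin sets space Q(1) Q(3) Q(1) Q(3) Ab Ab])
        (use that union(1) in \<open>auto simp: disjoint_family_on_def\<close>)
    then obtain P where P: "oproj P" "\<And>x. (\<lambda>i. Q i x) sums P x"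
      using orthogonal_projections_sums[of Q] Q(1) by blast
    have "rin (P x) x = measure (\<mu> x) (\<Union>i. A i)" for x
    proof (rule sums_unique2)
      show "(\<lambda>i. rin (Q i x) x) sums rin (P x) x"
        by (rule sums_rin_left[OF P(2)])
      show "(\<lambda>i. rin (Q i x) x) sums measure (\<mu> x) (\<Union>i. A i)"
        unfolding Q(3) by (rule finite_measure.finite_measure_UNION[OF fin])
          (use Ab union(1) in \<open>auto simp: sets\<close>)
    qed
    with P bicomm_closed(4)[of T Q P] Q(2) show ?case by (intro exI[of _ P]) auto
  qed
qed

text \<open>A symmetric operator is determined by its form, so additivity of \<open>E\<close> is
  read off from additivity of the measures. For multiplicativity, S and S' are split into their
  common part and the two differences; all products of disjoint parts vanish.\<close>

lemma pvm_from_measures: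
  fixes T :: "'h::complex_hilbert \<Rightarrow> 'h" and \<mu> :: "'h \<Rightarrow> real measure"
  assumes fin: "\<And>x. finite_measure (\<mu> x)" and sets: "\<And>x. sets (\<mu> x) = sets borel"
    and space: "\<And>x. measure (\<mu> x) UNIV = (norm x)\<^sup>2"
    and basic: "\<forall>a b. a \<le> b \<longrightarrow> (\<exists>Q. oproj Q \<and> bicomm T Q \<and> (\<forall>x. rin (Q x) x = measure (\<mu> x) {a<..b}))"
  shows "\<exists>E. (\<forall>S\<in>sets borel. oproj (E S) \<and> bicomm T (E S) \<and> (\<forall>x. rin (E S x) x = measure (\<mu> x) S)) \<and>
    (\<forall>x. E UNIV x = x) \<and>
    (\<forall>S\<in>sets borel. \<forall>S'\<in>sets borel. \<forall>x. E (S \<inter> S') x = E S (E S' x)) \<and>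
    (\<forall>F :: nat \<Rightarrow> real set. range F \<subseteq> sets borel \<longrightarrow> disjoint_family F \<longrightarrow>
        (\<forall>x. (\<lambda>n. E (F n) x) sums E (\<Union>n. F n) x))"
proof -
  have "\<forall>S\<in>sets borel. \<exists>Q. oproj Q \<and> bicomm T Q \<and> (\<forall>x. rin (Q x) x = measure (\<mu> x) S)"
    using projections_from_measures[OF fin sets space basic[rule_format]] by blast
  from bchoice[OF this] obtain E where E: "\<And>S. S \<in> sets borel \<Longrightarrow> oproj (E S)"
    "\<And>S. S \<in> sets borel \<Longrightarrow> bicomm T (E S)"
    "\<And>S x. S \<in> sets borel \<Longrightarrow> rin (E S x) x = measure (\<mu> x) S" by blast
  have one: "E UNIV x = x" for x
  proof -
    have "E UNIV = (\<lambda>x. x)"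
      by (rule sym_op_eqI[OF oprojD(1)[OF E(1)]]) (simp_all add: sym_op_def E(3) space rin_self)
    then show ?thesis by simp
  qed
  have disj: "E A (E B x) = 0" if "A \<in> sets borel" "B \<in> sets borel" "A \<inter> B = {}" for A B x
    by (rule oproj_disjoint_sets[OF fin sets space E(1) E(3) E(1) E(3)]) (rule that)+
  have add: "E (A \<union> B) x = E A x + E B x" if "A \<in> sets borel" "B \<in> sets borel" "A \<inter> B = {}" for A B x
  proof -
    have "E (A \<union> B) = (\<lambda>x. E A x + E B x)"
    proof (rule sym_op_eqI)
      show "sym_op (E (A \<union> B))" by (rule oprojD(1)[OF E(1)]) (use that in auto)
      show "sym_op (\<lambda>x. E A x + E B x)"
        by (simp add: sym_op_def bounded_linear_add oprojD(2)[OF E(1)] that rin_simps oprojD(3)[OF E(1)])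
      have "measure (\<mu> x) (A \<union> B) = measure (\<mu> x) A + measure (\<mu> x) B" for x
        by (rule finite_measure.finite_measure_Union[OF fin]) (use that in \<open>auto simp: sets\<close>)
      then show "rin (E (A \<union> B) x) x = rin (E A x + E B x) x" for x
        using that by (simp add: E(3) rin_simps)
    qed
    then show ?thesis by simp
  qed
  have mult: "E (S \<inter> S') x = E S (E S' x)" if "S \<in> sets borel" "S' \<in> sets borel" for S S' x
  proof -
    let ?A = "S \<inter> S'" and ?B = "S - S'" and ?C = "S' - S"
    have b: "?A \<in> sets borel" "?B \<in> sets borel" "?C \<in> sets borel" using that by auto
    have "E S y = E ?A y + E ?B y" for y
      using add[OF b(1,2)] by (simp add: Int_Diff_Un) (metis Int_Diff_disjoint Int_Diff_Un)
    moreover have "E S' x = E ?A x + E ?C x"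
      using add[OF b(1,3)] by (metis Int_Diff_Un Int_Diff_disjoint Int_commute)
    moreover have "E V (u + v) = E V u + E V v" if "V \<in> sets borel" for V u v
      by (rule linear_add[OF oproj_linear[OF E(1)]]) (rule that)
    moreover have "E ?A (E ?C x) = 0" "E ?B (E ?A x) = 0" "E ?B (E ?C x) = 0"
      by (rule disj; use that in auto)+
    ultimately show ?thesis using b oprojD(4)[OF E(1)[OF b(1)]] by simp
  qed
  have sums: "(\<lambda>n. E (F n) x) sums E (\<Union>n. F n) x"
    if F: "range F \<subseteq> sets borel" "disjoint_family F" for F :: "nat \<Rightarrow> real set" and x
  proof -
    have Fb: "F n \<in> sets borel" for n using F(1) by auto
    have "E (F i) (E (F j) x) = 0" if "i \<noteq> j" for i j x
      using F(2) that by (intro disj Fb) (auto simp: disjoint_family_on_def)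
    then obtain P where P: "oproj P" "\<And>x. (\<lambda>i. E (F i) x) sums P x"
      using orthogonal_projections_sums[of "\<lambda>i. E (F i)"] E(1)[OF Fb] by blast
    have "P = E (\<Union>n. F n)"
    proof (rule sym_op_eqI)
      show "rin (P x) x = rin (E (\<Union>n. F n) x) x" for x
      proof (rule sums_unique2)
        show "(\<lambda>i. rin (E (F i) x) x) sums rin (P x) x"
          by (rule sums_rin_left[OF P(2)])
        have "(\<lambda>i. measure (\<mu> x) (F i)) sums measure (\<mu> x) (\<Union>i. F i)"
          by (rule finite_measure.finite_measure_UNION[OF fin]) (use F in \<open>auto simp: sets\<close>)
        then show "(\<lambda>i. rin (E (F i) x) x) sums rin (E (\<Union>n. F n) x) x"
          using Fb by (simp add: E(3))
      qed
    qed (use P(1) E(1)[of "\<Union>n. F n"] Fb in \<open>auto simp: oproj_def\<close>)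
    with P(2) show ?thesis by simp
  qed
  show ?thesis
    by (intro exI[of _ E] conjI ballI allI impI) (rule E(1) E(2) E(3) one mult sums; assumption)+
qed

text \<open>The scalar measure of x is the Stieltjes measure of t \<mapsto> ||P_t x||^2. The last
  clause stands in for an integral formula: enclosing the form of \<open>T\<close> on the range of
  each interval projection is exactly what the grid argument consumes.\<close>

lemma spectral_resolution_exists:
  fixes T :: "'h::complex_hilbert \<Rightarrow> 'h"
  assumes T: "pos_sym T" and T1: "\<And>x. rin (T x) x \<le> (norm x)\<^sup>2"
  shows "\<exists>E. (\<forall>S\<in>sets borel. oproj (E S) \<and> bicomm T (E S)) \<and>
    (\<forall>x. E UNIV x = x) \<and>
    (\<forall>S\<in>sets borel. \<forall>S'\<in>sets borel. \<forall>x. E (S \<inter> S') x = E S (E S' x)) \<and>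
    (\<forall>F :: nat \<Rightarrow> real set. range F \<subseteq> sets borel \<longrightarrow> disjoint_family F \<longrightarrow>
        (\<forall>x. (\<lambda>n. E (F n) x) sums E (\<Union>n. F n) x)) \<and>
    (\<forall>a<0. \<forall>x. E {a<..1} x = x) \<and>
    (\<forall>a b u. a \<le> b \<longrightarrow> E {a<..b} u = u \<longrightarrow>
      a * (norm u)\<^sup>2 \<le> rin (T u) u \<and> rin (T u) u \<le> b * (norm u)\<^sup>2)"
proof -
  obtain P where P: "\<forall>t. oproj (P t) \<and> bicomm T (P t)"
    "\<forall>s t x. s \<le> t \<longrightarrow> P s (P t x) = P s x \<and> P t (P s x) = P s x"
    "\<forall>t x. P t x = x \<longrightarrow> rin (T x) x \<le> t * (norm x)\<^sup>2"
    "\<forall>t x. P t x = 0 \<longrightarrow> t * (norm x)\<^sup>2 \<le> rin (T x) x"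
    "\<forall>t<0. \<forall>x. P t x = 0" "\<forall>t\<ge>1. \<forall>x. P t x = x"
    "\<forall>x t. continuous (at_right t) (\<lambda>s. (norm (P s x))\<^sup>2)"
    using spectral_family_exists[OF T T1] by (elim exE conjE)
  have Pp: "oproj (P t)" and Pc: "bicomm T (P t)" for t using P(1) by auto
  define \<mu> where "\<mu> x = interval_measure (\<lambda>s. (norm (P s x))\<^sup>2)" for x
  have mono: "(norm (P s x))\<^sup>2 \<le> (norm (P t x))\<^sup>2" if "s \<le> t" for s t x
    using oproj_norm_le[OF Pp, of s "P t x"] P(2) that by (simp add: power_mono)
  have sets: "sets (\<mu> x) = sets borel" for x by (simp add: \<mu>_def)
  have Ioc: "emeasure (\<mu> x) {a<..b} = ennreal ((norm (P b x))\<^sup>2 - (norm (P a x))\<^sup>2)" if "a \<le> b" for a b x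
    unfolding \<mu>_def using that mono P(7) by (intro emeasure_interval_measure_Ioc) auto
  \<comment> \<open>Each interval of the exhaustion starts below 0 and ends at or above 1, so it
    already carries the full mass.\<close>
  have tot: "emeasure (\<mu> x) UNIV = ennreal ((norm x)\<^sup>2)" for x
  proof -
    have "(\<lambda>n. emeasure (\<mu> x) {- real (Suc n)<..real (Suc n)}) \<longlonglongrightarrow> emeasure (\<mu> x) (\<Union>n. {- real (Suc n)<..real (Suc n)})"
      by (rule Lim_emeasure_incseq) (auto simp: sets incseq_def)
    moreover have "(\<Union>n. {- real (Suc n)<..real (Suc n)}) = UNIV"
    proof (intro equalityI subsetI)
      fix r :: real
      obtain n :: nat where "\<bar>r\<bar> < real n" using reals_Archimedean2 by blast
      then show "r \<in> (\<Union>n. {- real (Suc n)<..real (Suc n)})" by (intro UN_I[of n]) auto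
    qed auto
    moreover have "emeasure (\<mu> x) {- real (Suc n)<..real (Suc n)} = ennreal ((norm x)\<^sup>2)" for n
      by (subst Ioc) (use P(5,6) in auto)
    ultimately show ?thesis by (simp add: LIMSEQ_const_iff)
  qed
  have fin: "finite_measure (\<mu> x)" for x
    by (rule finite_measureI) (simp add: tot[unfolded \<mu>_def] \<mu>_def)
  have space: "measure (\<mu> x) UNIV = (norm x)\<^sup>2" for x by (simp add: measure_def tot)
  have diffp: "oproj (\<lambda>x. P b x - P a x) \<and> bicomm T (\<lambda>x. P b x - P a x) \<and>
    (\<forall>x. rin (P b x - P a x) x = measure (\<mu> x) {a<..b})" if "a \<le> b" for a b
  proof (intro conjI allI)
    have lin: "P t (x - y) = P t x - P t y" for t x y
      by (rule linear_diff[OF oproj_linear[OF Pp]])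
    show "oproj (\<lambda>x. P b x - P a x)"
      unfolding oproj_def sym_op_def using P(2) that
      by (simp add: bounded_linear_sub oprojD(2)[OF Pp] rin_simps oprojD(3)[OF Pp] lin)
    show "bicomm T (\<lambda>x. P b x - P a x)" by (rule bicomm_closed(3)[OF Pc Pc])
    show "rin (P b x - P a x) x = measure (\<mu> x) {a<..b}" for x
      using mono[OF that, of x] by (simp add: measure_def Ioc[OF that] rin_simps oproj_rin[OF Pp])
  qed
  then have basic: "\<forall>a b. a \<le> b \<longrightarrow> (\<exists>Q. oproj Q \<and> bicomm T Q \<and> (\<forall>x. rin (Q x) x = measure (\<mu> x) {a<..b}))"
    by (intro allI impI exI[of _ "\<lambda>x. P b x - P a x" for a b])
  obtain E where E: "\<forall>S\<in>sets borel. oproj (E S) \<and> bicomm T (E S) \<and> (\<forall>x. rin (E S x) x = measure (\<mu> x) S)"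
    "\<forall>x. E UNIV x = x"
    "\<forall>S\<in>sets borel. \<forall>S'\<in>sets borel. \<forall>x. E (S \<inter> S') x = E S (E S' x)"
    "\<forall>F :: nat \<Rightarrow> real set. range F \<subseteq> sets borel \<longrightarrow> disjoint_family F \<longrightarrow>
        (\<forall>x. (\<lambda>n. E (F n) x) sums E (\<Union>n. F n) x)"
    using pvm_from_measures[OF fin sets space basic] by (elim exE conjE)
  have EIoc: "E {a<..b} x = P b x - P a x" if "a \<le> b" for a b x
  proof -
    have "E {a<..b} = (\<lambda>x. P b x - P a x)"
      by (rule sym_op_eqI) (use E(1) diffp[OF that] in \<open>auto simp: oproj_def\<close>)
    then show ?thesis by simp
  qed
  have "a * (norm u)\<^sup>2 \<le> rin (T u) u \<and> rin (T u) u \<le> b * (norm u)\<^sup>2"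
    if ab: "a \<le> b" and u: "E {a<..b} u = u" for a b u
  proof -
    have eq: "P b u - P a u = u" using u EIoc[OF ab] by simp
    have "P b (P b u - P a u) = P b u - P a u"
      using P(2) ab by (simp add: linear_diff[OF oproj_linear[OF Pp]] oprojD(4)[OF Pp])
    then have "P b u = u" by (simp only: eq)
    with eq have "P a u = 0" by simp
    with \<open>P b u = u\<close> P(3,4) show ?thesis by blast
  qed
  moreover have "E {a<..1} x = x" if "a < 0" for a x
    using EIoc[of a 1] that P(5,6) by simp
  ultimately show ?thesis using E by (intro exI[of _ E] conjI) auto
qed

section \<open>The spectral measure of a positive contraction on a closed subspace\<close>

lemma contractionD: "contraction K R \<Longrightarrow> x \<in> K \<Longrightarrow> norm (R x) \<le> norm x"
  by (simp add: contraction_def)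

text \<open>\<open>P\<close> is only known to be real-linear. Moving c across the inner product as
  \<open>cnj c\<close> and using that K is a complex subspace recovers complex linearity.\<close>

lemma oproj_csubspace_scaleC:
  assumes K: "csubspace K" and P: "oproj P" and PK: "\<And>x. P x \<in> K" and Pid: "\<And>x. x \<in> K \<Longrightarrow> P x = x"
  shows "P (c *\<^sub>C x) = c *\<^sub>C P x"
proof (rule rin_eqI)
  fix y
  have "rin (P (c *\<^sub>C x)) y = rin x (cnj c *\<^sub>C P y)" by (simp add: oprojD(3)[OF P] rin_scaleC_left)
  also have "\<dots> = rin x (P (cnj c *\<^sub>C P y))" by (simp add: Pid csubspaceD(3)[OF K] PK)
  also have "\<dots> = rin (P (c *\<^sub>C P x)) y" by (simp add: oprojD(3)[OF P, symmetric] rin_scaleC_left[symmetric])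
  also have "P (c *\<^sub>C P x) = c *\<^sub>C P x" by (simp add: Pid csubspaceD(3)[OF K] PK)
  finally show "rin (P (c *\<^sub>C x)) y = rin (c *\<^sub>C P x) y" .
qed

text \<open>\<open>R\<close> is meaningful only on K, so the resolution is built for
  \<open>T = R P\<close>, the extension of \<open>R\<close> by zero. Its projections lie in the
  bicommutant of \<open>T\<close>: commuting with \<open>P\<close> they preserve K, and commuting
  with complex scalars they are complex-linear.\<close>

lemma spectral_measure_exists:
  fixes K :: "'h::complex_hilbert set"
  assumes K: "csubspace K" and P: "oproj P" and PK: "\<And>x. P x \<in> K" and Pid: "\<And>x. x \<in> K \<Longrightarrow> P x = x"
    and R: "positive_op K R" and Rc: "contraction K R"
  shows "\<exists>E. is_spectral_measure K R E"
proof -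
  note Rb = positive_opD(1)[OF K R]
  interpret P: bounded_linear P by (rule oprojD[OF P])
  define T where "T x = R (P x)" for x
  have TK: "T x = R x" if "x \<in> K" for x by (simp add: T_def Pid that)
  have Tbl: "bounded_linear T"
  proof (rule bounded_linear_intro[where K = 1])
    show "T (x + y) = T x + T y" for x y by (simp add: T_def P.add bounded_opD(2)[OF Rb] PK)
    show "T (r *\<^sub>R x) = r *\<^sub>R T x" for r x by (simp add: T_def P.scaleR bounded_opD(4)[OF Rb] PK)
    show "norm (T x) \<le> norm x * 1" for x
      using contractionD[OF Rc PK, of x] oproj_norm_le[OF P, of x] by (simp add: T_def)
  qed
  have TP: "P (T x) = T x" "T (P x) = T x" for x
    by (simp_all add: T_def Pid PK bounded_opD(1)[OF Rb])
  have "rin (T x) y = rin x (T y)" for x y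
  proof -
    have "rin (T x) y = rin (R (P x)) (P y)" using oprojD(3)[OF P, of "T x" y] TP(1) by (simp add: T_def)
    also have "\<dots> = rin (P x) (T y)" by (simp add: T_def positive_opD(3)[OF K R] PK)
    also have "\<dots> = rin x (T y)" by (simp add: oprojD(3)[OF P] TP)
    finally show ?thesis .
  qed
  moreover have rT: "rin (T x) x = rin (R (P x)) (P x)" for x
    using oprojD(3)[OF P, of "T x" x] TP(1) by (simp add: T_def)
  ultimately have T: "pos_sym T"
    using Tbl positive_opD(4)[OF K R PK] by (simp add: pos_sym_def sym_op_def)
  have T1: "rin (T x) x \<le> (norm x)\<^sup>2" for x
  proof -
    have "rin (T x) x \<le> norm (T x) * norm x" using rin_cauchy_schwarz abs_le_D1 by blast
    also have "\<dots> \<le> norm x * norm x"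
      using contractionD[OF Rc PK, of x] oproj_norm_le[OF P, of x] by (intro mult_right_mono) (auto simp: T_def)
    finally show ?thesis by (simp add: power2_eq_square)
  qed
  obtain E where E: "\<forall>S\<in>sets borel. oproj (E S) \<and> bicomm T (E S)" "\<forall>x. E UNIV x = x"
    "\<forall>S\<in>sets borel. \<forall>S'\<in>sets borel. \<forall>x. E (S \<inter> S') x = E S (E S' x)"
    "\<forall>F :: nat \<Rightarrow> real set. range F \<subseteq> sets borel \<longrightarrow> disjoint_family F \<longrightarrow>
        (\<forall>x. (\<lambda>n. E (F n) x) sums E (\<Union>n. F n) x)"
    "\<forall>a<0. \<forall>x. E {a<..1} x = x"
    "\<forall>a b u. a \<le> b \<longrightarrow> E {a<..b} u = u \<longrightarrow>
      a * (norm u)\<^sup>2 \<le> rin (T u) u \<and> rin (T u) u \<le> b * (norm u)\<^sup>2"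
    using spectral_resolution_exists[OF T T1] by (elim exE conjE)
  have Ep: "oproj (E S)" and Eb: "bicomm T (E S)" if "S \<in> sets borel" for S using E(1) that by auto
  have EK: "E S x \<in> K" if "S \<in> sets borel" "x \<in> K" for S x
  proof -
    have "P (E S x) = E S (P x)"
      by (rule bicommD[OF Eb[OF that(1)] P.bounded_linear_axioms P.bounded_linear_axioms])
        (simp_all add: oprojD(3)[OF P] TP)
    then show ?thesis using PK[of "E S x"] by (simp add: Pid that)
  qed
  have EC: "E S (c *\<^sub>C x) = c *\<^sub>C E S x" if "S \<in> sets borel" for S c x
    by (rule bicommD[OF Eb[OF that] bounded_linear_scaleC bounded_linear_scaleC, symmetric])
      (simp_all add: rin_scaleC_left T_def oproj_csubspace_scaleC[OF K P PK Pid] bounded_opD(3)[OF Rb] PK)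
  have pvm: "proj_valued_measure K E" unfolding proj_valued_measure_def
  proof (intro conjI)
    show "\<forall>S\<in>sets borel. orthogonal_projection K (E S)"
      unfolding orthogonal_projection_def
    proof (intro ballI conjI)
      fix S :: "real set" assume S: "S \<in> sets borel"
      note p = oprojD[OF Ep[OF S]]
      interpret ES: bounded_linear "E S" by (rule p)
      show "bounded_op K (E S)"
        unfolding bounded_op_def using EK[OF S] EC[OF S] ES.add oproj_norm_le[OF Ep[OF S]]
        by (auto intro!: exI[of _ 1])
      show "E S (E S x) = E S x" for x by (rule p)
      show "cinner (E S x) y = cinner x (E S y)" for x y
        unfolding cinner_eq_rin EC[OF S, symmetric] by (simp add: p(3))
    qed
  qed (use E(2-4) in blast)+
  \<comment> \<open>The resolution supplies only intervals (a, 1] with a < 0. Intersecting countably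
    many of them, in the almost everywhere sense, leaves [0, 1].\<close>
  have supp: "E {0..1} x = x" if x: "x \<in> K" for x
  proof -
    have "AE r in pvm_measure E x. r \<in> {- 1 / Suc n<..1}" for n
      using pvm_AE_iff[OF pvm x, of "{- 1 / Suc n<..1}"] E(5)[rule_format, of "- 1 / Suc n" x] by simp
    then have "AE r in pvm_measure E x. \<forall>n. r \<in> {- 1 / Suc n<..1}" by (simp only: AE_all_countable) simp
    then have "AE r in pvm_measure E x. r \<in> {0..1}"
    proof (rule eventually_mono)
      fix r :: real assume r: "\<forall>n. r \<in> {- 1 / Suc n<..1}"
      have "0 \<le> r"
      proof (rule ccontr)
        assume "\<not> 0 \<le> r"
        then obtain n where "inverse (real (Suc n)) < - r" using reals_Archimedean[of "- r"] by auto
        with r[rule_format, of n] show False by (simp add: inverse_eq_divide)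
      qed
      with r show "r \<in> {0..1}" by simp
    qed
    then show ?thesis by (simp only: pvm_AE_iff[OF pvm x atLeastAtMost_borel])
  qed
  have int: "rin (R x) x = (LINT r:{0..1}|pvm_measure E x. r)" if x: "x \<in> K" for x
  proof (rule pvm_quadratic_form_eq_integral[OF K pvm x supp[OF x] continuous_on_id, where C = 1 and D = 1])
    show "bounded_op K R" by (rule Rb)
    fix N i :: nat assume N: "0 < N" "i \<le> N"
    let ?u = "E (grid_cell N i) x"
    have u: "?u \<in> K" by (rule EK) (simp_all add: x)
    have "E (grid_cell N i) ?u = ?u" by (rule oprojD(4)[OF Ep]) simp
    then have b: "(real i - 1) / real N * (norm ?u)\<^sup>2 \<le> rin (T ?u) ?u"
        "rin (T ?u) ?u \<le> real i / real N * (norm ?u)\<^sup>2"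
      using E(6)[rule_format, of "(real i - 1) / real N" "real i / real N" ?u] N
      by (simp_all add: grid_cell_def divide_right_mono)
    have "T (E (grid_cell N i) ?u) = E (grid_cell N i) (T ?u)"
      by (rule bicomm_self[OF pos_symD(1)[OF T] Eb]) simp
    then have "rin (R ?u) x = rin (T ?u) ?u"
      using oprojD(3)[OF Ep, of "grid_cell N i" "T ?u" x] \<open>E (grid_cell N i) ?u = ?u\<close>
      by (simp add: TK[OF u])
    with b show "\<bar>rin (R ?u) x - real i / real N * (norm ?u)\<^sup>2\<bar> \<le> 1 / real N * (norm ?u)\<^sup>2"
      by (simp add: diff_divide_distrib left_diff_distrib)
  qed auto
  have "is_spectral_measure K R E" unfolding is_spectral_measure_def is_pvm_integral_def
  proof (intro conjI ballI pvm Rb exI[of _ 1])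
    fix x assume x: "x \<in> K"
    have "{0..1} \<inter> {-1..1} = {0..1::real}" by auto
    then show "E {-1..1} x = x"
      using E(3)[rule_format, of "{-1..1}" "{0..1}" x] supp[OF x] by (simp add: Int_commute)
    have AE01: "AE r in pvm_measure E x. r \<in> {0..1}"
      using supp[OF x] by (simp only: pvm_AE_iff[OF pvm x atLeastAtMost_borel])
    then have AEe: "AE r in pvm_measure E x. indicator {0..1} r *\<^sub>R r = indicator UNIV r *\<^sub>R r"
      by (rule eventually_mono) simp
    have "integrable (pvm_measure E x) (\<lambda>r. indicator {0..1} r *\<^sub>R r)"
      by (rule integrable_indicator_continuous[OF finite_measure_pvm_measure[OF pvm x] sets_pvm_measure continuous_on_id])
    then show "set_integrable (pvm_measure E x) UNIV (\<lambda>r. r)"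
      unfolding set_integrable_def by (intro iffD1[OF integrable_cong_AE[OF _ _ AEe]]) auto
    have "(LINT r:{0..1}|pvm_measure E x. r) = (LINT r:UNIV|pvm_measure E x. r)"
      unfolding set_lebesgue_integral_def by (rule integral_cong_AE) (use AEe in auto)
    moreover have "cinner (R x) x = complex_of_real (rin (R x) x)"
      by (rule cinner_self_eq_rin)
        (use bounded_opD(3)[OF Rb x] positive_opD(3)[OF K R x csubspaceD(3)[OF K x]] in auto)
    ultimately show "cinner (R x) x = complex_of_real (LINT r:UNIV|pvm_measure E x. r)"
      using int[OF x] by simp
  qed
  then show ?thesis by (intro exI[of _ E])
qed

section \<open>Functional calculus for an arbitrary spectral measure\<close>

definition op_poly :: "(nat \<Rightarrow> real) \<Rightarrow> nat \<Rightarrow> ('h::complex_hilbert \<Rightarrow> 'h) \<Rightarrow> 'h \<Rightarrow> 'h" where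
  "op_poly a n R x = (\<Sum>i\<le>n. a i *\<^sub>R (R ^^ i) x)"

lemma bounded_op_funpow:
  assumes R: "bounded_op K R" and Rc: "contraction K R"
  shows "bounded_op K (R ^^ k)" "x \<in> K \<Longrightarrow> norm ((R ^^ k) x) \<le> norm x"
proof -
  have *: "x \<in> K \<Longrightarrow> (R ^^ k) x \<in> K \<and> norm ((R ^^ k) x) \<le> norm x" for x k
  proof (induction k)
    case (Suc k)
    then show ?case
      using bounded_opD(1)[OF R, of "(R ^^ k) x"] contractionD[OF Rc, of "(R ^^ k) x"] by simp
  qed simp
  then show "x \<in> K \<Longrightarrow> norm ((R ^^ k) x) \<le> norm x" by blast
  have add: "x \<in> K \<Longrightarrow> y \<in> K \<Longrightarrow> (R ^^ k) (x + y) = (R ^^ k) x + (R ^^ k) y" for x y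
    by (induction k) (simp_all add: bounded_opD(2)[OF R] *)
  have scale: "x \<in> K \<Longrightarrow> (R ^^ k) (c *\<^sub>C x) = c *\<^sub>C (R ^^ k) x" for c x
    by (induction k) (simp_all add: bounded_opD(3)[OF R] *)
  show "bounded_op K (R ^^ k)"
    unfolding bounded_op_def using * by (intro conjI ballI allI add scale exI[of _ 1]) simp_all
qed

lemma bounded_op_lin_comb:
  assumes K: "csubspace K" and X: "bounded_op K X" and Y: "bounded_op K Y"
  shows "bounded_op K (\<lambda>x. X x + r *\<^sub>R Y x)"
proof -
  obtain M where M: "\<And>x. x \<in> K \<Longrightarrow> norm (X x) \<le> M * norm x" using X unfolding bounded_op_def by blast
  obtain N where N: "\<And>x. x \<in> K \<Longrightarrow> norm (Y x) \<le> N * norm x" using Y unfolding bounded_op_def by blast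
  have "norm (X x + r *\<^sub>R Y x) \<le> (M + \<bar>r\<bar> * N) * norm x" if "x \<in> K" for x
  proof -
    have "norm (X x + r *\<^sub>R Y x) \<le> norm (X x) + \<bar>r\<bar> * norm (Y x)"
      by (rule order_trans[OF norm_triangle_ineq]) simp
    also have "\<dots> \<le> M * norm x + \<bar>r\<bar> * (N * norm x)"
      by (intro add_mono mult_left_mono M N that) simp
    finally show ?thesis by (simp add: algebra_simps)
  qed
  then show ?thesis unfolding bounded_op_def
    by (intro conjI ballI allI exI[of _ "M + \<bar>r\<bar> * N"])
      (auto simp: bounded_opD[OF X] bounded_opD[OF Y] csubspaceD[OF K] scaleR_right_distrib
        scaleC_add_right scaleC_scaleR_commute)
qed

lemma op_poly_bounded_op:
  assumes K: "csubspace K" and R: "bounded_op K R" and Rc: "contraction K R"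
  shows "bounded_op K (op_poly a n R)"
proof (induction n)
  case 0
  have "bounded_op K (\<lambda>x. 0)" using csubspaceD(1)[OF K]
    by (auto simp: bounded_op_def scaleC_scaleR_commute[of _ 0, simplified] intro!: exI[of _ 0])
  from bounded_op_lin_comb[OF K this bounded_op_funpow(1)[OF R Rc, of 0], of "a 0"]
  show ?case unfolding op_poly_def[abs_def] by simp
next
  case (Suc n)
  from bounded_op_lin_comb[OF K this bounded_op_funpow(1)[OF R Rc, of "Suc n"], of "a (Suc n)"]
  show ?case unfolding op_poly_def[abs_def] by simp
qed

lemma funpow_sym:
  assumes K: "csubspace K" and R: "positive_op K R" and x: "x \<in> K" and y: "y \<in> K"
  shows "rin ((R ^^ k) x) y = rin x ((R ^^ k) y)"
  using x y
proof (induction k arbitrary: x y)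
  case (Suc k)
  have "(R ^^ k) z \<in> K" if "z \<in> K" for z
    using that bounded_opD(1)[OF positive_opD(1)[OF K R]] by (induction k) auto
  then have "rin ((R ^^ Suc k) x) y = rin ((R ^^ k) x) (R y)" using Suc.prems positive_opD(3)[OF K R] by simp
  also have "\<dots> = rin x ((R ^^ k) (R y))"
    using Suc bounded_opD(1)[OF positive_opD(1)[OF K R]] by simp
  finally show ?case by (simp add: funpow_swap1)
qed simp

lemma op_poly_sym:
  assumes "csubspace K" "positive_op K R" "x \<in> K" "y \<in> K"
  shows "rin (op_poly a n R x) y = rin x (op_poly a n R y)"
  by (simp add: op_poly_def rin_sum_left rin_sum_right rin_simps funpow_sym[OF assms])

text \<open>By \<open>E A (E S x) = E (A \<inter> S) x\<close>. It turns the integral formula at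
  \<open>E S x\<close> into an integral over S against the measure of x.\<close>

lemma pvm_measure_restrict:
  assumes E: "proj_valued_measure K E" and x: "x \<in> K" and S: "S \<in> sets borel"
  shows "pvm_measure E (E S x) = density (pvm_measure E x) (\<lambda>r. ennreal (indicator S r))"
proof (rule measure_eqI)
  fix A assume "A \<in> sets (pvm_measure E (E S x))"
  then have A: "A \<in> sets borel" by simp
  show "emeasure (pvm_measure E (E S x)) A =
      emeasure (density (pvm_measure E x) (\<lambda>r. ennreal (indicator S r))) A"
    unfolding ennreal_indicator
    by (subst emeasure_restricted)
      (use A S in \<open>simp_all add: emeasure_pvm_measure[OF E] x pvmD[OF E] Int_commute\<close>)
qed simp

lemma power_lipschitz:
  fixes r s :: real
  assumes "r \<in> {0..1}" "s \<in> {0..1}"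
  shows "\<bar>r ^ k - s ^ k\<bar> \<le> real k * \<bar>r - s\<bar>"
proof (induction k)
  case (Suc k)
  have "r ^ Suc k - s ^ Suc k = r * (r ^ k - s ^ k) + (r - s) * s ^ k" by (simp add: algebra_simps)
  then have "\<bar>r ^ Suc k - s ^ Suc k\<bar> \<le> \<bar>r\<bar> * \<bar>r ^ k - s ^ k\<bar> + \<bar>r - s\<bar> * \<bar>s ^ k\<bar>"
    by (metis abs_mult abs_triangle_ineq)
  also have "\<dots> \<le> 1 * \<bar>r ^ k - s ^ k\<bar> + \<bar>r - s\<bar> * 1"
    using assms by (intro add_mono mult_right_mono mult_left_mono) (auto simp: power_le_one)
  finally show ?case using Suc by (simp add: algebra_simps)
qed simp

lemma polynomial_approximation:
  fixes f :: "real \<Rightarrow> real"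
  assumes f: "continuous_on {0..1} f" and e: "0 < e"
  shows "\<exists>a n. \<forall>r\<in>{0..1}. \<bar>f r - (\<Sum>i\<le>n. a i * r ^ i)\<bar> \<le> e"
proof -
  obtain p where p: "real_polynomial_function p" "\<And>r. r \<in> {0..1} \<Longrightarrow> \<bar>f r - p r\<bar> < e"
    using Stone_Weierstrass_real_polynomial_function[OF _ f e] by auto
  obtain a n where "p = (\<lambda>r. \<Sum>i\<le>n. a i * r ^ i)"
    using p(1) unfolding real_polynomial_function_iff_sum by blast
  with p(2) show ?thesis by (intro exI[of _ a] exI[of _ n]) force
qed

section \<open>Consequences of the defining integral of a spectral measure\<close>

context
  fixes K :: "'h::complex_hilbert set" and R E
  assumes K: "csubspace K" and R: "positive_op K R" and Rc: "contraction K R"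
    and E: "is_spectral_measure K R E"
begin

lemma E_pvm: "proj_valued_measure K E"
  using E by (simp add: is_spectral_measure_def)

lemma R_bounded_op: "bounded_op K R"
  by (rule positive_opD(1)[OF K R])

lemma R_integral:
  assumes "x \<in> K"
  shows "integrable (pvm_measure E x) (\<lambda>r. r)" "rin (R x) x = (\<integral>r. r \<partial>pvm_measure E x)"
proof -
  have "set_integrable (pvm_measure E x) UNIV (\<lambda>r. r) \<and>
      cinner (R x) x = complex_of_real (LINT r:UNIV|pvm_measure E x. r)"
    using E assms by (simp add: is_spectral_measure_def is_pvm_integral_def)
  then show "integrable (pvm_measure E x) (\<lambda>r. r)" "rin (R x) x = (\<integral>r. r \<partial>pvm_measure E x)"
    by (auto simp: set_integrable_def set_lebesgue_integral_def rin_def)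
qed

text \<open>The integral for <R x, x> splits over S and its complement. Expanding the form at x = E
  S x + E (- S) x gives the same two terms plus a cross term, which must therefore vanish.\<close>

lemma spectral_measure_orthogonal:
  assumes S: "S \<in> sets borel" and x: "x \<in> K"
  shows "rin (R (E S x)) (x - E S x) = 0"
proof -
  let ?M = "pvm_measure E x"
  have int: "rin (R (E B x)) (E B x) = (\<integral>r. indicator B r *\<^sub>R r \<partial>?M)" if B: "B \<in> sets borel" for B
  proof -
    have "rin (R (E B x)) (E B x) = (\<integral>r. r \<partial>pvm_measure E (E B x))"
      by (rule R_integral(2)) (rule pvmD(4)[OF E_pvm B x])
    also have "\<dots> = (\<integral>r. indicator B r *\<^sub>R r \<partial>?M)"
      unfolding pvm_measure_restrict[OF E_pvm x B]
      by (rule integral_density) (use B in auto)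
    finally show ?thesis .
  qed
  have ii: "integrable ?M (\<lambda>r. indicator B r *\<^sub>R r)" if "B \<in> sets borel" for B
    using integrable_mult_indicator[of B ?M "\<lambda>r. r"] R_integral(1)[OF x] that by simp
  have mS: "- S \<in> sets borel" using S by auto
  have w: "E (- S) x = x - E S x" by (rule pvm_complement[OF E_pvm S x])
  have uK: "E S x \<in> K" "E (- S) x \<in> K" by (rule pvmD(4)[OF E_pvm _ x], use S in auto)+
  have "rin (R x) x = (\<integral>r. indicator S r *\<^sub>R r + indicator (- S) r *\<^sub>R r \<partial>?M)"
    unfolding R_integral(2)[OF x] by (rule Bochner_Integration.integral_cong) (auto simp: indicator_def)
  also have "\<dots> = rin (R (E S x)) (E S x) + rin (R (E (- S) x)) (E (- S) x)"
    unfolding int[OF S] int[OF mS] by (rule Bochner_Integration.integral_add[OF ii[OF S] ii[OF mS]])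
  finally have 1: "rin (R x) x = rin (R (E S x)) (E S x) + rin (R (E (- S) x)) (E (- S) x)" .
  have "x = E S x + E (- S) x" by (simp add: w)
  then have "rin (R x) x = rin (R (E S x + E (- S) x)) (E S x + E (- S) x)" by simp
  also have "\<dots> = rin (R (E S x)) (E S x) + rin (R (E (- S) x)) (E (- S) x) + 2 * rin (R (E S x)) (E (- S) x)"
    using positive_opD(3)[OF K R uK] rin_commute[of "E S x" "R (E (- S) x)"]
    by (simp add: bounded_opD(2)[OF R_bounded_op uK] rin_simps)
  finally show ?thesis using 1 w by simp
qed

lemma spectral_measure_invariant:
  assumes S: "S \<in> sets borel" and u: "u \<in> K" "E S u = u"
  shows "E S (R u) = R u"
proof -
  have RuK: "R u \<in> K" by (rule bounded_opD(1)[OF R_bounded_op u(1)])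
  define y where "y = R u - E S (R u)"
  have EK: "E S (R u) \<in> K" by (rule pvmD(4)[OF E_pvm S RuK])
  have yK: "y \<in> K" unfolding y_def by (rule csubspaceD(5)[OF K RuK EK])
  have Ey: "E S y = 0"
    unfolding y_def bounded_op_diff[OF K pvmD(1)[OF E_pvm S] RuK EK] pvmD(2)[OF E_pvm S RuK] by simp
  \<comment> \<open>Orthogonality is applied to u + y, whose part in the range of \<open>E S\<close>
    is u and whose remainder is y; this gives <R u, y> = 0.\<close>
  have "E S (u + y) = u" by (simp add: bounded_opD(2)[OF pvmD(1)[OF E_pvm S] u(1) yK] u(2) Ey)
  then have "rin (R u) y = 0"
    using spectral_measure_orthogonal[OF S csubspaceD(2)[OF K u(1) yK]] by simp
  moreover have "rin (E S (R u)) y = 0"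
    by (simp add: pvmD(3)[OF E_pvm S RuK yK] Ey)
  ultimately have "(norm y)\<^sup>2 = 0" by (simp add: rin_self[symmetric] y_def rin_simps)
  then show ?thesis by (simp add: y_def)
qed

lemma spectral_measure_interval:
  assumes u: "u \<in> K" "E {a<..b} u = u"
  shows "a * (norm u)\<^sup>2 \<le> rin (R u) u" "rin (R u) u \<le> b * (norm u)\<^sup>2"
proof -
  interpret finite_measure "pvm_measure E u" by (rule finite_measure_pvm_measure[OF E_pvm u(1)])
  have AE: "AE r in pvm_measure E u. r \<in> {a<..b}"
    using u by (subst pvm_AE_iff[OF E_pvm u(1)]) auto
  have c: "(\<integral>r. c \<partial>pvm_measure E u) = c * (norm u)\<^sup>2" for c
    using measure_pvm_measure[OF E_pvm u(1), of UNIV] pvmD(5)[OF E_pvm, of UNIV u] u(1) by simp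
  have "(\<integral>r. a \<partial>pvm_measure E u) \<le> (\<integral>r. r \<partial>pvm_measure E u)"
    by (rule integral_mono_AE) (use AE R_integral(1)[OF u(1)] in auto)
  then show "a * (norm u)\<^sup>2 \<le> rin (R u) u" by (simp only: c R_integral(2)[OF u(1)])
  have "(\<integral>r. r \<partial>pvm_measure E u) \<le> (\<integral>r. b \<partial>pvm_measure E u)"
    by (rule integral_mono_AE) (use AE R_integral(1)[OF u(1)] in auto)
  then show "rin (R u) u \<le> b * (norm u)\<^sup>2" by (simp only: c R_integral(2)[OF u(1)])
qed

text \<open>The definition guarantees only some bounded support. Outside [0, 1] a function that is
  positive on the set in question, -r on the left and r - 1 on the right, has nonpositive integral
  by positivity or contractivity of \<open>R\<close>, so the measure vanishes there.\<close>

lemma spectral_measure_support: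
  assumes x: "x \<in> K"
  shows "E {0..1} x = x"
proof -
  have key: "E S x = 0" if S: "S \<in> sets borel" and g: "\<And>r. r \<in> S \<Longrightarrow> 0 < g r"
    and gi: "integrable (pvm_measure E (E S x)) g" "(\<integral>r. g r \<partial>pvm_measure E (E S x)) \<le> 0" for S and g :: "real \<Rightarrow> real"
  proof -
    let ?M = "pvm_measure E (E S x)"
    have u: "E S x \<in> K" by (rule pvmD(4)[OF E_pvm S x])
    have AES: "AE r in ?M. r \<in> S"
      using pvmD(2)[OF E_pvm S x] by (subst pvm_AE_iff[OF E_pvm u S])
    then have nn: "AE r in ?M. 0 \<le> g r" by (rule eventually_mono) (simp add: g less_imp_le)
    then have "(\<integral>r. g r \<partial>?M) = 0" using gi(2) integral_nonneg_AE[OF nn] by linarith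
    then have "AE r in ?M. g r = 0" using integral_nonneg_eq_0_iff_AE[OF gi(1) nn] by simp
    with AES have "AE r in ?M. r \<in> {}" by eventually_elim (use g in force)
    then show ?thesis by (subst (asm) pvm_AE_iff[OF E_pvm u]) (simp_all add: pvm_empty[OF E_pvm u])
  qed
  have 1: "E {..<0} x = 0"
  proof (rule key[OF _, of _ "\<lambda>r. - r"])
    have u: "E {..<0} x \<in> K" by (rule pvmD(4)[OF E_pvm _ x]) simp
    show "integrable (pvm_measure E (E {..<0} x)) (\<lambda>r. - r)" using R_integral(1)[OF u] by simp
    show "(\<integral>r. - r \<partial>pvm_measure E (E {..<0} x)) \<le> 0"
      using R_integral(2)[OF u] positive_opD(4)[OF K R u] by simp
  qed auto
  have 2: "E {1<..} x = 0"
  proof (rule key[OF _, of _ "\<lambda>r. r - 1"])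
    have u: "E {1<..} x \<in> K" by (rule pvmD(4)[OF E_pvm _ x]) simp
    interpret finite_measure "pvm_measure E (E {1<..} x)" by (rule finite_measure_pvm_measure[OF E_pvm u])
    show "integrable (pvm_measure E (E {1<..} x)) (\<lambda>r. r - 1)" using R_integral(1)[OF u] by simp
    have "rin (R (E {1<..} x)) (E {1<..} x) \<le> norm (R (E {1<..} x)) * norm (E {1<..} x)"
      using rin_cauchy_schwarz abs_le_D1 by blast
    also have "\<dots> \<le> norm (E {1<..} x) * norm (E {1<..} x)"
      by (intro mult_right_mono contractionD[OF Rc u]) simp
    finally have "rin (R (E {1<..} x)) (E {1<..} x) \<le> (norm (E {1<..} x))\<^sup>2" by (simp add: power2_eq_square)
    then show "(\<integral>r. r - 1 \<partial>pvm_measure E (E {1<..} x)) \<le> 0"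
      using R_integral[OF u] measure_pvm_measure[OF E_pvm u, of UNIV] pvmD(5)[OF E_pvm, of UNIV "E {1<..} x"] u
      by simp
  qed auto
  have "- {..<0} = {0::real..}" "- {1<..} = {..1::real}" by auto
  then have "E {0..} x = x" "E {..1} x = x"
    using pvm_complement[OF E_pvm _ x, of "{..<0}"] pvm_complement[OF E_pvm _ x, of "{1<..}"] 1 2 by auto
  moreover have "{0..} \<inter> {..1} = {0..1::real}" by auto
  ultimately show ?thesis using pvmD(6)[OF E_pvm _ _ x, of "{0..}" "{..1}"] by simp
qed

text \<open>On the range of the cell projection the form of R - b lies between -(b - a) and 0, so
  its norm there is at most b - a. The powers follow from R^(k+1) - b^(k+1) = R (R^k - b^k) + b^k (R
  - b), with \<open>R\<close> a contraction and b in [0, 1]. The left end a may be negative, as it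
  is for the grid cell 0.\<close>

lemma spectral_measure_cell_funpow:
  assumes u: "u \<in> K" "E {a<..b} u = u" and b: "0 \<le> b" "b \<le> 1" and ab: "a \<le> b"
  shows "(R ^^ k) u \<in> K \<and> E {a<..b} ((R ^^ k) u) = (R ^^ k) u"
    "norm ((R ^^ k) u - b ^ k *\<^sub>R u) \<le> real k * (b - a) * norm u"
proof -
  have S: "{a<..b} \<in> sets borel" by simp
  let ?V = "{x \<in> K. E {a<..b} x = x}"
  note Eb = pvmD(1)[OF E_pvm S]
  have one: "norm (R v - b *\<^sub>R v) \<le> (b - a) * norm v" if "v \<in> ?V" for v
  proof (rule real_quadratic_form_norm_bound[where K = ?V and X = "\<lambda>v. R v - b *\<^sub>R v"])
    show "x + y \<in> ?V \<and> R (x + y) - b *\<^sub>R (x + y) = R x - b *\<^sub>R x + (R y - b *\<^sub>R y)"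
      if "x \<in> ?V" "y \<in> ?V" for x y
      using that by (simp add: csubspaceD[OF K] bounded_opD[OF R_bounded_op] bounded_opD[OF Eb] scaleR_right_distrib)
    show "r *\<^sub>R x \<in> ?V \<and> R (r *\<^sub>R x) - b *\<^sub>R r *\<^sub>R x = r *\<^sub>R (R x - b *\<^sub>R x)" if "x \<in> ?V" for r x
      using that by (simp add: csubspaceD[OF K] bounded_opD[OF R_bounded_op] bounded_opD[OF Eb] scaleR_diff_right mult.commute)
    show "R x - b *\<^sub>R x \<in> ?V" if "x \<in> ?V" for x
      using that by (simp add: csubspaceD[OF K] bounded_opD[OF R_bounded_op] bounded_opD[OF Eb]
          bounded_op_diff[OF K Eb] spectral_measure_invariant[OF S])
    show "rin (R x - b *\<^sub>R x) y = rin x (R y - b *\<^sub>R y)" if "x \<in> ?V" "y \<in> ?V" for x y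
      using that positive_opD(3)[OF K R] by (simp add: rin_simps)
    show "\<bar>rin (R x - b *\<^sub>R x) x\<bar> \<le> (b - a) * (norm x)\<^sup>2" if "x \<in> ?V" for x
      using that spectral_measure_interval[of x a b] by (simp add: rin_simps rin_self algebra_simps)
  qed (rule that)
  have inV: "(R ^^ k) u \<in> ?V" for k
    by (induction k) (use u in \<open>auto simp: bounded_opD[OF R_bounded_op] spectral_measure_invariant[OF S]\<close>)
  then show "(R ^^ k) u \<in> K \<and> E {a<..b} ((R ^^ k) u) = (R ^^ k) u" by blast
  show "norm ((R ^^ k) u - b ^ k *\<^sub>R u) \<le> real k * (b - a) * norm u"
  proof (induction k)
    case (Suc k)
    have bk: "b ^ k *\<^sub>R u \<in> K" using u(1) csubspaceD(4)[OF K] by blast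
    have k: "(R ^^ k) u \<in> K" using inV by blast
    have "(R ^^ Suc k) u - b ^ Suc k *\<^sub>R u = R ((R ^^ k) u - b ^ k *\<^sub>R u) + b ^ k *\<^sub>R (R u - b *\<^sub>R u)"
      by (simp add: bounded_op_diff[OF K R_bounded_op k bk] bounded_opD(4)[OF R_bounded_op u(1)]
          scaleR_diff_right mult.commute)
    then have "norm ((R ^^ Suc k) u - b ^ Suc k *\<^sub>R u)
      \<le> norm (R ((R ^^ k) u - b ^ k *\<^sub>R u)) + norm (b ^ k *\<^sub>R (R u - b *\<^sub>R u))"
      by (simp only: norm_triangle_ineq)
    also have "\<dots> \<le> norm ((R ^^ k) u - b ^ k *\<^sub>R u) + 1 * norm (R u - b *\<^sub>R u)"
      unfolding norm_scaleR
      by (intro add_mono mult_right_mono contractionD[OF Rc] csubspaceD(5)[OF K k bk])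
        (use b in \<open>auto simp: power_le_one\<close>)
    also have "\<dots> \<le> real k * (b - a) * norm u + 1 * ((b - a) * norm u)"
      using Suc one[of u] u by simp
    finally show ?case by (simp add: algebra_simps)
  qed simp
qed

text \<open>Both constants are k: the Lipschitz constant of the k-th power on [0, 1], and the factor
  in the cell estimate for a cell of width 1/N.\<close>

lemma funpow_integral:
  assumes x: "x \<in> K"
  shows "rin ((R ^^ k) x) x = (LINT r:{0..1}|pvm_measure E x. r ^ k)"
proof (rule pvm_quadratic_form_eq_integral[OF K E_pvm x spectral_measure_support[OF x], where C = "real k" and D = "real k"])
  show "bounded_op K (R ^^ k)" by (rule bounded_op_funpow(1)[OF R_bounded_op Rc])
  show "\<bar>r ^ k - s ^ k\<bar> \<le> real k * \<bar>r - s\<bar>" if "r \<in> {0..1}" "s \<in> {0..1}" for r s :: real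
    by (rule power_lipschitz[OF that])
  fix N i :: nat assume N: "0 < N" "i \<le> N"
  let ?u = "E (grid_cell N i) x" and ?b = "real i / real N"
  have u: "?u \<in> K" "E (grid_cell N i) ?u = ?u"
    using pvmD(2,4)[OF E_pvm grid_cell_borel x] by auto
  have ba: "?b - (real i - 1) / real N = 1 / real N" by (simp add: diff_divide_distrib)
  have cond: "0 \<le> ?b" "?b \<le> 1" "(real i - 1) / real N \<le> ?b" using N by (auto simp: divide_right_mono)
  note c = spectral_measure_cell_funpow[OF u[unfolded grid_cell_def] cond, folded grid_cell_def, unfolded ba]
  have "rin ((R ^^ k) ?u) x = rin ((R ^^ k) ?u) ?u"
    using pvmD(3)[OF E_pvm grid_cell_borel _ x] c(1) by metis
  then have "rin ((R ^^ k) ?u) x - ?b ^ k * (norm ?u)\<^sup>2 = rin ((R ^^ k) ?u - ?b ^ k *\<^sub>R ?u) ?u"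
    by (simp add: rin_simps rin_self)
  then have "\<bar>rin ((R ^^ k) ?u) x - ?b ^ k * (norm ?u)\<^sup>2\<bar> \<le> norm ((R ^^ k) ?u - ?b ^ k *\<^sub>R ?u) * norm ?u"
    by (simp only: rin_cauchy_schwarz)
  also have "\<dots> \<le> (real k * (1 / real N) * norm ?u) * norm ?u"
    by (rule mult_right_mono[OF c(2)]) simp
  finally show "\<bar>rin ((R ^^ k) ?u) x - ?b ^ k * (norm ?u)\<^sup>2\<bar> \<le> real k / real N * (norm ?u)\<^sup>2"
    by (simp add: power2_eq_square)
qed (auto intro!: continuous_intros)

lemma set_integrable_continuous:
  fixes f :: "real \<Rightarrow> real"
  assumes "x \<in> K" "continuous_on {0..1} f"
  shows "set_integrable (pvm_measure E x) {0..1} f"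
  unfolding set_integrable_def
  by (rule integrable_indicator_continuous[OF finite_measure_pvm_measure[OF E_pvm assms(1)] sets_pvm_measure assms(2)])

lemma op_poly_integral:
  assumes x: "x \<in> K"
  shows "rin (op_poly a n R x) x = (LINT r:{0..1}|pvm_measure E x. (\<Sum>i\<le>n. a i * r ^ i))"
proof -
  have i: "integrable (pvm_measure E x) (\<lambda>r. indicator {0..1} r *\<^sub>R r ^ i)" for i
    using set_integrable_continuous[OF x, of "\<lambda>r. r ^ i"] by (simp add: set_integrable_def continuous_intros)
  have "(LINT r:{0..1}|pvm_measure E x. (\<Sum>i\<le>n. a i * r ^ i))
      = (\<integral>r. (\<Sum>i\<le>n. a i * (indicator {0..1} r *\<^sub>R r ^ i)) \<partial>pvm_measure E x)"
    unfolding set_lebesgue_integral_def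
    by (rule Bochner_Integration.integral_cong) (simp_all add: sum_distrib_left mult.left_commute)
  also have "\<dots> = (\<Sum>i\<le>n. a i * (LINT r:{0..1}|pvm_measure E x. r ^ i))"
    unfolding set_lebesgue_integral_def
    by (subst Bochner_Integration.integral_sum) (use i in \<open>auto intro!: integrable_mult_right\<close>)
  finally show ?thesis
    by (simp add: op_poly_def rin_sum_left rin_simps funpow_integral[OF x])
qed

lemma set_integral_diff_bound:
  fixes f g :: "real \<Rightarrow> real"
  assumes x: "x \<in> K" and f: "continuous_on {0..1} f" and g: "continuous_on {0..1} g"
    and fg: "\<And>r. r \<in> {0..1} \<Longrightarrow> \<bar>f r - g r\<bar> \<le> e"
  shows "\<bar>(LINT r:{0..1}|pvm_measure E x. f r) - (LINT r:{0..1}|pvm_measure E x. g r)\<bar> \<le> e * (norm x)\<^sup>2"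
proof -
  let ?M = "pvm_measure E x"
  interpret finite_measure ?M by (rule finite_measure_pvm_measure[OF E_pvm x])
  note fi = set_integrable_continuous[OF x f] and gi = set_integrable_continuous[OF x g]
  have e: "0 \<le> e" using fg[of 0] by auto
  have "\<bar>(LINT r:{0..1}|?M. f r) - (LINT r:{0..1}|?M. g r)\<bar> = \<bar>LINT r:{0..1}|?M. f r - g r\<bar>"
    by (subst set_integral_diff(2)[OF fi gi]) simp
  also have "\<dots> \<le> (\<integral>r. \<bar>indicator {0..1} r *\<^sub>R (f r - g r)\<bar> \<partial>?M)"
    unfolding set_lebesgue_integral_def
    using integral_norm_bound[of ?M "\<lambda>r. indicator {0..1} r *\<^sub>R (f r - g r)"] by simp
  also have "\<dots> \<le> (\<integral>r. e \<partial>?M)"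
    using set_integral_diff(1)[OF fi gi] fg e
    by (intro integral_mono Bochner_Integration.integrable_abs) (auto simp: set_integrable_def indicator_def)
  also have "\<dots> = e * (norm x)\<^sup>2"
    using measure_pvm_measure[OF E_pvm x, of UNIV] pvmD(5)[OF E_pvm, of UNIV x] x by simp
  finally show ?thesis .
qed

lemma pvm_integral_rin:
  assumes X: "is_pvm_integral K E {0..1} f X" and x: "x \<in> K"
  shows "rin (X x) x = (LINT r:{0..1}|pvm_measure E x. f r)"
    "y \<in> K \<Longrightarrow> rin (X x) y = rin x (X y)" "bounded_op K X"
proof -
  show b: "bounded_op K X" using X by (simp add: is_pvm_integral_def)
  have c: "cinner (X x) x = complex_of_real (LINT r:{0..1}|pvm_measure E x. f r)" if "x \<in> K" for x
    using X that by (simp add: is_pvm_integral_def)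
  from c[OF x] show "rin (X x) x = (LINT r:{0..1}|pvm_measure E x. f r)" by (simp add: rin_def)
  have "cinner (X x) x \<in> \<real>" if "x \<in> K" for x unfolding c[OF that] by simp
  from bounded_op_cinner_sym[OF K b this x] show "y \<in> K \<Longrightarrow> rin (X x) y = rin x (X y)"
    by (simp add: rin_def)
qed

lemma norm_diff_le_of_quadratic_form:
  assumes X: "bounded_op K X" and Y: "bounded_op K Y"
    and Xs: "\<And>x y. x \<in> K \<Longrightarrow> y \<in> K \<Longrightarrow> rin (X x) y = rin x (X y)"
    and Ys: "\<And>x y. x \<in> K \<Longrightarrow> y \<in> K \<Longrightarrow> rin (Y x) y = rin x (Y y)"
    and q: "\<And>x. x \<in> K \<Longrightarrow> \<bar>rin (X x) x - rin (Y x) x\<bar> \<le> e * (norm x)\<^sup>2" and v: "v \<in> K"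
  shows "norm (X v - Y v) \<le> e * norm v"
proof (rule real_quadratic_form_norm_bound[where K = K and X = "\<lambda>x. X x - Y x"])
  show "X x - Y x \<in> K" if "x \<in> K" for x
    using that csubspaceD(5)[OF K] bounded_opD(1)[OF X] bounded_opD(1)[OF Y] by blast
qed (use v q in \<open>auto simp: csubspaceD[OF K] bounded_opD[OF X] bounded_opD[OF Y] rin_simps Xs Ys
    scaleR_diff_right\<close>)

text \<open>The forms of both operators are integrals against the same measure, of total mass
  ||x||^2, and symmetric operators with close forms are close in norm. The error depends on the
  polynomial alone and not on \<open>R\<close>.\<close>

lemma pvm_integral_op_poly_close:
  assumes X: "is_pvm_integral K E {0..1} f X" and f: "continuous_on {0..1} f"
    and close: "\<And>r. r \<in> {0..1} \<Longrightarrow> \<bar>f r - (\<Sum>i\<le>n. a i * r ^ i)\<bar> \<le> e" and v: "v \<in> K"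
  shows "norm (X v - op_poly a n R v) \<le> e * norm v"
proof (rule norm_diff_le_of_quadratic_form[OF pvm_integral_rin(3)[OF X v] op_poly_bounded_op[OF K R_bounded_op Rc] _ _ _ v])
  show "\<bar>rin (X x) x - rin (op_poly a n R x) x\<bar> \<le> e * (norm x)\<^sup>2" if "x \<in> K" for x
    unfolding pvm_integral_rin(1)[OF X that] op_poly_integral[OF that]
    by (rule set_integral_diff_bound[OF that f _ close]) (intro continuous_intros)
qed (simp_all add: pvm_integral_rin(2)[OF X] op_poly_sym[OF K R])

text \<open>Polynomials in \<open>R\<close> that approximate f uniformly have forms close to the
  integral, hence are Cauchy in operator norm. Closedness of K keeps the limit inside K.\<close>

lemma pvm_integral_exists:
  assumes f: "continuous_on {0..1} f" and cl: "closed K"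
  shows "\<exists>X. is_pvm_integral K E {0..1} f X"
proof -
  have "\<forall>m. \<exists>a n. \<forall>r\<in>{0..1}. \<bar>f r - (\<Sum>i\<le>n. a i * r ^ i)\<bar> \<le> 1 / real (Suc m)"
    by (intro allI polynomial_approximation[OF f]) simp
  then obtain a n where an: "\<And>m r. r \<in> {0..1} \<Longrightarrow> \<bar>f r - (\<Sum>i\<le>n m. a m i * r ^ i)\<bar> \<le> 1 / real (Suc m)"
    by metis
  define X where "X m = op_poly (a m) (n m) R" for m
  have Xb: "bounded_op K (X m)" for m
    unfolding X_def by (rule op_poly_bounded_op[OF K R_bounded_op Rc])
  have Xs: "rin (X m x) y = rin x (X m y)" if "x \<in> K" "y \<in> K" for m x y
    unfolding X_def by (rule op_poly_sym[OF K R that])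
  have Xint: "\<bar>rin (X m x) x - (LINT r:{0..1}|pvm_measure E x. f r)\<bar> \<le> 1 / real (Suc m) * (norm x)\<^sup>2"
    if "x \<in> K" for m x
    unfolding X_def op_poly_integral[OF that] abs_minus_commute[of "LINT r:{0..1}|pvm_measure E x. (\<Sum>i\<le>n m. a m i * r ^ i)"]
    by (rule set_integral_diff_bound[OF that f _ an]) (auto intro!: continuous_intros)
  have Xd: "norm (X m x - X l x) \<le> (1 / real (Suc m) + 1 / real (Suc l)) * norm x" if "x \<in> K" for m l x
  proof (rule norm_diff_le_of_quadratic_form[OF Xb Xb Xs Xs _ that])
    fix y assume y: "y \<in> K"
    show "\<bar>rin (X m y) y - rin (X l y) y\<bar> \<le> (1 / real (Suc m) + 1 / real (Suc l)) * (norm y)\<^sup>2"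
      using Xint[OF y, of m] Xint[OF y, of l] unfolding distrib_right by linarith
  qed
  have lim0: "(\<lambda>m. 1 / real (Suc m) * c) \<longlonglongrightarrow> 0" for c
    using tendsto_mult_right[OF LIMSEQ_inverse_real_of_nat, of c] by (simp add: inverse_eq_divide)
  have "\<exists>l. (\<lambda>m. X m x) \<longlonglongrightarrow> l" if x: "x \<in> K" for x
  proof -
    have "Cauchy (\<lambda>m. X m x)"
    proof (rule metric_CauchyI)
      fix e :: real assume "0 < e"
      then have "\<forall>\<^sub>F m in sequentially. 1 / real (Suc m) * norm x < e / 2"
        by (intro order_tendstoD(2)[OF lim0]) simp
      then obtain M where M: "\<And>m. M \<le> m \<Longrightarrow> 1 / real (Suc m) * norm x < e / 2"
        by (auto simp: eventually_sequentially)
      show "\<exists>M. \<forall>m\<ge>M. \<forall>l\<ge>M. dist (X m x) (X l x) < e"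
      proof (intro exI allI impI)
        fix m l assume "M \<le> m" "M \<le> l"
        with M[of m] M[of l] Xd[OF x, of m l] show "dist (X m x) (X l x) < e"
          unfolding dist_norm distrib_right by linarith
      qed
    qed
    then show ?thesis by (simp add: Cauchy_convergent_iff convergent_def)
  qed
  then obtain Y where Y: "\<And>x. x \<in> K \<Longrightarrow> (\<lambda>m. X m x) \<longlonglongrightarrow> Y x" by metis
  have YK: "Y x \<in> K" if "x \<in> K" for x
    by (rule closed_sequentially[OF cl _ Y[OF that]]) (simp add: bounded_opD(1)[OF Xb that])
  have Yadd: "Y (x + y) = Y x + Y y" if "x \<in> K" "y \<in> K" for x y
  proof (rule LIMSEQ_unique[OF Y])
    show "(\<lambda>m. X m (x + y)) \<longlonglongrightarrow> Y x + Y y"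
      unfolding bounded_opD(2)[OF Xb that] by (intro tendsto_add Y that)
  qed (rule csubspaceD(2)[OF K that])
  have YC: "Y (c *\<^sub>C x) = c *\<^sub>C Y x" if "x \<in> K" for c x
  proof (rule LIMSEQ_unique[OF Y])
    show "(\<lambda>m. X m (c *\<^sub>C x)) \<longlonglongrightarrow> c *\<^sub>C Y x"
      unfolding bounded_opD(3)[OF Xb that] by (rule bounded_linear.tendsto[OF bounded_linear_scaleC Y[OF that]])
  qed (rule csubspaceD(3)[OF K that])
  have Ys: "rin (Y x) y = rin x (Y y)" if "x \<in> K" "y \<in> K" for x y
  proof (rule LIMSEQ_unique)
    show "(\<lambda>m. rin (X m x) y) \<longlonglongrightarrow> rin (Y x) y" by (intro tendsto_rin tendsto_const Y that)
    show "(\<lambda>m. rin (X m x) y) \<longlonglongrightarrow> rin x (Y y)"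
      unfolding Xs[OF that] by (intro tendsto_rin tendsto_const Y that)
  qed
  obtain M where M: "\<And>x. x \<in> K \<Longrightarrow> norm (X 0 x) \<le> M * norm x" using Xb[of 0] unfolding bounded_op_def by blast
  \<comment> \<open>Each \<open>X m x\<close> is within 2 ||x|| of \<open>X 0 x\<close> by
    \<open>Xd\<close>, and M bounds \<open>X 0\<close>.\<close>
  have Yn: "norm (Y x) \<le> (2 + M) * norm x" if x: "x \<in> K" for x
  proof (rule LIMSEQ_le_const2[OF tendsto_norm[OF Y[OF x]]], intro exI allI impI)
    fix m
    have "norm (X m x) \<le> norm (X m x - X 0 x) + norm (X 0 x)"
      using norm_triangle_ineq[of "X m x - X 0 x" "X 0 x"] by simp
    also have "\<dots> \<le> (1 / real (Suc m) + 1 / real (Suc 0)) * norm x + M * norm x"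
      by (intro add_mono Xd M x)
    also have "\<dots> \<le> 2 * norm x + M * norm x" by (intro add_right_mono mult_right_mono) auto
    finally show "norm (X m x) \<le> (2 + M) * norm x" by (simp add: algebra_simps)
  qed
  have "is_pvm_integral K E {0..1} f Y"
    unfolding is_pvm_integral_def bounded_op_def
  proof (intro conjI ballI allI exI[of _ "2 + M"])
    fix x assume x: "x \<in> K"
    show "set_integrable (pvm_measure E x) {0..1} f" by (rule set_integrable_continuous[OF x f])
    have "(\<lambda>m. rin (X m x) x - (LINT r:{0..1}|pvm_measure E x. f r)) \<longlonglongrightarrow> 0"
      by (rule Lim_null_comparison[OF _ lim0[of "(norm x)\<^sup>2"]]) (use Xint[OF x] in auto)
    from tendsto_add[OF this tendsto_const[of "LINT r:{0..1}|pvm_measure E x. f r"]]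
    have "(\<lambda>m. rin (X m x) x) \<longlonglongrightarrow> (LINT r:{0..1}|pvm_measure E x. f r)" by simp
    moreover have "(\<lambda>m. rin (X m x) x) \<longlonglongrightarrow> rin (Y x) x" by (intro tendsto_rin tendsto_const Y x)
    ultimately have "rin (Y x) x = (LINT r:{0..1}|pvm_measure E x. f r)" using LIMSEQ_unique by blast
    moreover have "cinner (Y x) x = complex_of_real (rin (Y x) x)"
      by (rule cinner_self_eq_rin) (use YC[OF x] Ys[OF x csubspaceD(3)[OF K x]] in auto)
    ultimately show "cinner (Y x) x = complex_of_real (LINT r:{0..1}|pvm_measure E x. f r)" by simp
  qed (use YK Yadd YC Yn in auto)
  then show ?thesis by (intro exI[of _ Y])
qed

end

section \<open>The Pusz--Woronowicz pair\<close>

lemma positive_op_UNIV_D: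
  assumes "positive_op UNIV T"
  shows "pos_sym T" "bounded_linear T" "rin (T x) y = rin x (T y)" "0 \<le> rin (T x) x"
    "T (c *\<^sub>C x) = c *\<^sub>C T x" "T (x + y) = T x + T y" "T (x - y) = T x - T y"
proof -
  show *: "pos_sym T" "T (c *\<^sub>C x) = c *\<^sub>C T x" using assms by (auto simp: positive_op_UNIV_iff)
  note pos_symD[OF *(1)]
  then show "bounded_linear T" "rin (T x) y = rin x (T y)" "0 \<le> rin (T x) x"
    "T (x + y) = T x + T y" "T (x - y) = T x - T y"
    by (auto simp: linear_simps)
qed

text \<open>Through the square root of A the form becomes an inner product of images.\<close>

lemma positive_op_cauchy_schwarz:
  assumes A: "positive_op UNIV A"
  shows "\<bar>rin (A x) y\<bar> \<le> sqrt (rin (A x) x) * sqrt (rin (A y) y)"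
proof -
  note s = op_sqrt[OF A]
  have eq: "rin (A u) v = rin (op_sqrt A u) (op_sqrt A v)" for u v
    using positive_op_UNIV_D(3)[OF s(1), of "op_sqrt A u" v] s(2)[of u] by simp
  have n: "sqrt (rin (A u) u) = norm (op_sqrt A u)" for u by (simp add: eq rin_self)
  show ?thesis unfolding n unfolding eq by (rule rin_cauchy_schwarz)
qed

text \<open>Two Riesz representations: \<open>L x\<close>, which will be \<open>R (T x)\<close>,
  represents T y \<mapsto> <A x, y>, and then \<open>R w\<close> represents T y \<mapsto> <w, L y>.
  This defines \<open>R\<close> on all vectors at once, without extending it by continuity from the
  range of \<open>T\<close>.\<close>

lemma pw_half_exists:
  fixes A T :: "'h::complex_hilbert \<Rightarrow> 'h"
  assumes A: "positive_op UNIV A" and T: "positive_op UNIV T" and le: "\<And>x. rin (A x) x \<le> (norm (T x))\<^sup>2"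
  defines "K \<equiv> closure (range T)"
  shows "\<exists>R. positive_op K R \<and> contraction K R \<and> (\<forall>x y. rin (R (T x)) (T y) = rin (A x) y) \<and>
    (\<forall>w y. rin (R w) (T y) = rin w (R (T y)))"
proof -
  note Tbl = positive_op_UNIV_D(2)[OF T] and Abl = positive_op_UNIV_D(2)[OF A]
  interpret T: bounded_linear T by (rule Tbl)
  interpret A: bounded_linear A by (rule Abl)
  have sq: "sqrt (rin (A x) x) \<le> norm (T x)" for x using le[of x] by (simp add: real_le_lsqrt)
  have AT: "\<bar>rin (A x) y\<bar> \<le> norm (T x) * norm (T y)" for x y
    by (rule order_trans[OF positive_op_cauchy_schwarz[OF A]])
      (intro mult_mono sq, use positive_op_UNIV_D(4)[OF A] in auto)
  have "\<exists>v\<in>closure (range T). (\<forall>y. rin v (T y) = rin (A x) y) \<and> norm v \<le> norm (T x)" for x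
    by (rule riesz_range[OF Tbl _ _ AT]) (auto simp: rin_simps intro!: linearI)
  then obtain L where L: "\<And>x. L x \<in> closure (range T)" "\<And>x y. rin (L x) (T y) = rin (A x) y"
    "\<And>x. norm (L x) \<le> norm (T x)" by metis
  have Ladd: "L (x + y) = L x + L y" for x y
    by (rule closure_range_eqI[OF L(1) closure_range_add[OF Tbl L(1) L(1)]]) (simp add: L(2) rin_simps A.add)
  have Lscale: "L (r *\<^sub>R x) = r *\<^sub>R L x" for r x
    by (rule closure_range_eqI[OF L(1) closure_range_scaleR[OF Tbl L(1)]]) (simp add: L(2) rin_simps A.scaleR)
  have clC: "c *\<^sub>C x \<in> closure (range T)" if "x \<in> closure (range T)" for c x
    by (rule closure_range_invariant[OF bounded_linear_scaleC _ that])
      (simp flip: positive_op_UNIV_D(5)[OF T])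
  have LC: "L (c *\<^sub>C x) = c *\<^sub>C L x" for c x
    by (rule closure_range_eqI[OF L(1) clC[OF L(1)]])
      (simp add: L(2) rin_scaleC_left positive_op_UNIV_D(5)[OF A] positive_op_UNIV_D(5)[OF T, symmetric])
  have "\<exists>v\<in>closure (range T). (\<forall>y. rin v (T y) = rin w (L y)) \<and> norm v \<le> norm w" for w
  proof (rule riesz_range[OF Tbl])
    show "linear (\<lambda>y. rin w (L y))" by (intro linearI) (simp_all add: Ladd Lscale rin_simps)
    show "\<bar>rin w (L y)\<bar> \<le> norm w * norm (T y)" for y
      by (rule order_trans[OF rin_cauchy_schwarz]) (intro mult_left_mono L(3) norm_ge_zero)
  qed simp
  then obtain R where R: "\<And>w. R w \<in> closure (range T)" "\<And>w y. rin (R w) (T y) = rin w (L y)"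
    "\<And>w. norm (R w) \<le> norm w" by metis
  have Radd: "R (x + y) = R x + R y" for x y
    by (rule closure_range_eqI[OF R(1) closure_range_add[OF Tbl R(1) R(1)]]) (simp add: R(2) rin_simps)
  have RC: "R (c *\<^sub>C x) = c *\<^sub>C R x" for c x
    by (rule closure_range_eqI[OF R(1) clC[OF R(1)]])
      (simp add: R(2) rin_scaleC_left LC positive_op_UNIV_D(5)[OF T, symmetric])
  have Rbl: "bounded_linear R"
    by (rule bounded_linear_intro[where K = 1]) (simp_all add: Radd RC R(3) scaleR_eq_scaleC)
  have RT: "R (T x) = L x" for x
  proof (rule closure_range_eqI[OF R(1) L(1)])
    fix y
    have "rin (R (T x)) (T y) = rin (A y) x" by (simp add: R(2) rin_commute[of "T x"] L(2))
    also have "\<dots> = rin (L x) (T y)"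
      using positive_op_UNIV_D(3)[OF A, of y x] rin_commute[of y "A x"] by (simp add: L(2))
    finally show "rin (R (T x)) (T y) = rin (L x) (T y)" .
  qed
  have symK: "rin (R w) v = rin w (R v)" if v: "v \<in> K" for w v
  proof -
    obtain s where s: "\<forall>n. s n \<in> range T" "s \<longlonglongrightarrow> v"
      by (rule closure_limE[OF v[unfolded K_def]])
    have "rin (R w) (s n) = rin w (R (s n))" for n
    proof -
      obtain y where "s n = T y" using spec[OF s(1), of n] by (elim rangeE)
      then show ?thesis by (simp add: R(2) RT)
    qed
    moreover have "(\<lambda>n. rin (R w) (s n)) \<longlonglongrightarrow> rin (R w) v" by (intro tendsto_rin tendsto_const s)
    moreover have "(\<lambda>n. rin w (R (s n))) \<longlonglongrightarrow> rin w (R v)"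
      by (intro tendsto_rin tendsto_const bounded_linear.tendsto[OF Rbl s(2)])
    ultimately show ?thesis by (simp add: LIMSEQ_unique)
  qed
  have posK: "0 \<le> rin (R v) v" if v: "v \<in> K" for v
  proof -
    obtain s where s: "\<forall>n. s n \<in> range T" "s \<longlonglongrightarrow> v"
      by (rule closure_limE[OF v[unfolded K_def]])
    have "0 \<le> rin (R (s n)) (s n)" for n
    proof -
      obtain y where "s n = T y" using spec[OF s(1), of n] by (elim rangeE)
      then show ?thesis by (simp add: RT L(2) positive_op_UNIV_D(4)[OF A])
    qed
    moreover have "(\<lambda>n. rin (R (s n)) (s n)) \<longlonglongrightarrow> rin (R v) v"
      by (intro tendsto_rin s bounded_linear.tendsto[OF Rbl s(2)])
    ultimately show ?thesis by (intro LIMSEQ_le_const) auto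
  qed
  have bop: "bounded_op K R"
    unfolding bounded_op_def K_def using R(1,3) Radd RC by (auto intro!: exI[of _ 1])
  have "cinner (R v) v = complex_of_real (rin (R v) v)" if "v \<in> K" for v
    by (rule cinner_self_eq_rin) (use RC symK clC that in \<open>auto simp: K_def\<close>)
  with posK bop have "positive_op K R" by (simp add: positive_op_def)
  moreover have "contraction K R" using bop R(3) by (simp add: contraction_def)
  ultimately show ?thesis using R(2) RT L(2) by (intro exI[of _ R]) simp
qed

section \<open>The pair and the calculus for fixed A and B\<close>

context
  fixes A B :: "'h::complex_hilbert \<Rightarrow> 'h"
  assumes A: "positive_op UNIV A" and B: "positive_op UNIV B"
begin

lemma pw_sum_positive: "positive_op UNIV (\<lambda>x. A x + B x)"
  using A B by (auto simp: positive_op_UNIV_iff pos_sym_def sym_op_def bounded_linear_add rin_simps scaleC_add_right)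

lemma pw_T_positive: "positive_op UNIV (pw_T A B)"
  unfolding pw_T_def by (rule op_sqrt(1)[OF pw_sum_positive])

lemma pw_T_sq: "pw_T A B (pw_T A B x) = A x + B x"
  unfolding pw_T_def by (rule op_sqrt(2)[OF pw_sum_positive])

lemma pw_T_rin: "rin (pw_T A B x) (pw_T A B y) = rin (A x) y + rin (B x) y"
  using positive_op_UNIV_D(3)[OF pw_T_positive, of "pw_T A B x" y] by (simp add: pw_T_sq rin_simps)

lemma pw_T_norm_sq: "(norm (pw_T A B x))\<^sup>2 = rin (A x) x + rin (B x) x"
  by (simp add: rin_self[symmetric] pw_T_rin)

text \<open>The space is defined by the range of A + B = T^2, while the arguments need density of
  the range of \<open>T\<close>. The component y of T x orthogonal to the range of T^2 satisfies T^2
  y = 0, hence T y = 0 and <y, T x> = 0, which leaves y = 0.\<close>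

lemma pw_space_eq: "pw_space A B = closure (range (pw_T A B))"
proof
  have Cbl: "bounded_linear (\<lambda>x. A x + B x)" by (rule positive_op_UNIV_D(2)[OF pw_sum_positive])
  show "pw_space A B \<subseteq> closure (range (pw_T A B))"
    unfolding pw_space_def
    by (rule closure_mono) (auto simp: pw_T_sq[symmetric])
  obtain P where P: "oproj P" "\<forall>x. P x \<in> closure (range (\<lambda>x. A x + B x))"
      "\<forall>x y. rin (P x) (A y + B y) = rin x (A y + B y)"
    using range_projection[OF Cbl] by (elim exE conjE)
  have "pw_T A B x \<in> pw_space A B" for x
  proof -
    let ?T = "pw_T A B" and ?y = "pw_T A B x - P (pw_T A B x)"
    have "rin (?T (?T ?y)) z = 0" for z
    proof -
      have "rin (?T (?T ?y)) z = rin ?y (?T (?T z))" by (simp add: positive_op_UNIV_D(3)[OF pw_T_positive])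
      also have "\<dots> = 0" unfolding pw_T_sq rin_diff_left using P(3) by simp
      finally show ?thesis .
    qed
    from this[of ?y] have "rin (?T ?y) (?T ?y) = 0" by (simp add: positive_op_UNIV_D(3)[OF pw_T_positive])
    then have "?T ?y = 0" by (simp add: rin_self)
    then have "rin ?y (?T x) = 0" using positive_op_UNIV_D(3)[OF pw_T_positive, of ?y x] by simp
    moreover have "P ?y = 0"
      by (simp add: linear_diff[OF oproj_linear[OF P(1)]] oprojD(4)[OF P(1)])
    then have "rin ?y (P (?T x)) = 0" using oprojD(3)[OF P(1), of ?y "?T x"] by simp
    ultimately have "rin ?y ?y = 0" by (simp add: rin_diff_right)
    then have "?T x = P (?T x)" by (simp add: rin_self)
    then show ?thesis using P(2) unfolding pw_space_def by metis
  qed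
  then show "closure (range (pw_T A B)) \<subseteq> pw_space A B"
    by (intro closure_minimal) (auto simp: pw_space_def)
qed

lemma pw_T_in_space: "pw_T A B x \<in> pw_space A B"
  unfolding pw_space_eq by (rule subsetD[OF closure_subset]) simp

lemma pw_space_closed: "closed (pw_space A B)"
  by (simp add: pw_space_def)

lemma pw_space_csubspace: "csubspace (pw_space A B)"
proof -
  note bl = positive_op_UNIV_D(2)[OF pw_T_positive]
  have "0 \<in> range (pw_T A B)"
    using linear_0[OF bounded_linear.linear[OF bl]] by (metis rangeI)
  then have "0 \<in> closure (range (pw_T A B))" by (rule subsetD[OF closure_subset])
  moreover have "c *\<^sub>C x \<in> closure (range (pw_T A B))" if "x \<in> closure (range (pw_T A B))" for c x
    by (rule closure_range_invariant[OF bounded_linear_scaleC _ that])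
      (simp flip: positive_op_UNIV_D(5)[OF pw_T_positive])
  ultimately show ?thesis
    using closure_range_add[OF bl] by (simp add: csubspace_def pw_space_eq)
qed

text \<open>\<open>R\<close> and \<open>S\<close> are built separately from A and B. Their sum is
  the identity on vectors T y by comparing forms; symmetry against such vectors then extends this to
  the whole space.\<close>

lemma pw_pair_exists: "\<exists>p. is_pw_pair A B p"
proof -
  let ?T = "pw_T A B"
  obtain R where R: "positive_op (pw_space A B) R" "contraction (pw_space A B) R"
    "\<forall>x y. rin (R (?T x)) (?T y) = rin (A x) y" "\<forall>w y. rin (R w) (?T y) = rin w (R (?T y))"
    using pw_half_exists[OF A pw_T_positive] positive_op_UNIV_D(4)[OF B]
    unfolding pw_T_norm_sq pw_space_eq by auto
  obtain S where S: "positive_op (pw_space A B) S" "contraction (pw_space A B) S"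
    "\<forall>x y. rin (S (?T x)) (?T y) = rin (B x) y" "\<forall>w y. rin (S w) (?T y) = rin w (S (?T y))"
    using pw_half_exists[OF B pw_T_positive] positive_op_UNIV_D(4)[OF A]
    unfolding pw_T_norm_sq pw_space_eq by auto
  have RK: "R w \<in> pw_space A B" and SK: "S w \<in> pw_space A B" if "w \<in> pw_space A B" for w
    using that R(1) S(1) by (auto simp: positive_op_def bounded_op_def)
  have addK: "u + v \<in> pw_space A B" if "u \<in> pw_space A B" "v \<in> pw_space A B" for u v
    using csubspaceD(2)[OF pw_space_csubspace that] .
  have RS: "R (?T y) + S (?T y) = ?T y" for y
    by (rule closure_range_eqI[of _ ?T])
      (auto simp: pw_space_eq[symmetric] pw_T_in_space RK SK addK rin_simps R(3) S(3) pw_T_rin)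
  have sum: "R w + S w = w" if "w \<in> pw_space A B" for w
  proof (rule closure_range_eqI[of _ ?T])
    show "R w + S w \<in> closure (range ?T)" "w \<in> closure (range ?T)"
      using that RK SK addK by (auto simp: pw_space_eq[symmetric])
    show "rin (R w + S w) (?T y) = rin w (?T y)" for y
      using RS[of y] R(4) S(4) by (simp add: rin_add_left) (simp add: rin_add_right[symmetric])
  qed
  have AR: "A x = cadjoint ?T (R (?T x))" and BS: "B x = cadjoint ?T (S (?T x))" for x
    unfolding cadjoint_positive_op[OF pw_T_positive]
    by (rule rin_eqI; simp add: positive_op_UNIV_D(3)[OF pw_T_positive] R(3) S(3))+
  have "is_pw_pair A B (R, S)"
    unfolding is_pw_pair_def using R(1,2) S(1,2) sum AR BS by simp
  then show ?thesis by (intro exI[of _ "(R, S)"])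
qed

lemma is_pw_pair_fst:
  assumes "is_pw_pair A B p"
  shows "positive_op (pw_space A B) (fst p)" "contraction (pw_space A B) (fst p)"
    "A x = cadjoint (pw_T A B) (fst p (pw_T A B x))"
  using assms unfolding is_pw_pair_def split_beta by blast+

text \<open>The third identity is A = T R T with one factor \<open>T\<close> moved across; in this
  shape \<open>R\<close> enters the parallel sum and the weak limit.\<close>

lemma pw_R:
  shows "positive_op (pw_space A B) (pw_R A B)" "contraction (pw_space A B) (pw_R A B)"
    "rin (pw_R A B (pw_T A B x)) (pw_T A B y) = rin (A x) y"
proof -
  note pair = is_pw_pair_fst[OF someI_ex[OF pw_pair_exists], folded pw_R_def]
  show "positive_op (pw_space A B) (pw_R A B)" "contraction (pw_space A B) (pw_R A B)"
    by (rule pair)+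
  show "rin (pw_R A B (pw_T A B x)) (pw_T A B y) = rin (A x) y"
    unfolding pair(3)[of x] cadjoint_positive_op[OF pw_T_positive]
    by (simp add: positive_op_UNIV_D(3)[OF pw_T_positive])
qed

lemma pw_R_bounded_op: "bounded_op (pw_space A B) (pw_R A B)"
  by (rule positive_opD(1)[OF pw_space_csubspace pw_R(1)])

lemma pw_spectral_measure:
  "is_spectral_measure (pw_space A B) (pw_R A B) (spectral_measure (pw_space A B) (pw_R A B))"
proof -
  obtain P where P: "oproj P" "\<forall>x. P x \<in> pw_space A B" "\<forall>x\<in>pw_space A B. P x = x"
    using range_projection[OF positive_op_UNIV_D(2)[OF pw_sum_positive]] unfolding pw_space_def
    by (elim exE conjE)
  have "\<exists>E. is_spectral_measure (pw_space A B) (pw_R A B) E"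
    by (rule spectral_measure_exists[OF pw_space_csubspace P(1) _ _ pw_R(1,2)]) (use P in auto)
  then show ?thesis unfolding spectral_measure_def by (rule someI_ex)
qed

text \<open>The spectral measure is hidden from here on: what the convergence proof sees is an inner
  operator approximated by polynomials in \<open>R\<close>, with an error depending only on \<phi>
  and the polynomial.\<close>

lemma pw_calculus_eq:
  fixes \<phi> :: "real \<times> real \<Rightarrow> real"
  assumes "continuous_on {0..1} (\<lambda>r. \<phi> (r, 1 - r))"
  shows "\<exists>X. bounded_op (pw_space A B) X \<and>
    (\<forall>x. pw_calculus \<phi> A B x = pw_T A B (X (pw_T A B x))) \<and>
    (\<forall>a n e. (\<forall>r\<in>{0..1}. \<bar>\<phi> (r, 1 - r) - (\<Sum>i\<le>n. a i * r ^ i)\<bar> \<le> e) \<longrightarrow>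
      (\<forall>v\<in>pw_space A B. norm (X v - op_poly a n (pw_R A B) v) \<le> e * norm v))"
proof -
  let ?K = "pw_space A B" and ?R = "pw_R A B"
  define X where "X = pvm_integral ?K (spectral_measure ?K ?R) {0..1} (\<lambda>r. \<phi> (r, 1 - r))"
  note ctx = pw_space_csubspace pw_R(1,2) pw_spectral_measure
  have X: "is_pvm_integral ?K (spectral_measure ?K ?R) {0..1} (\<lambda>r. \<phi> (r, 1 - r)) X"
    unfolding X_def pvm_integral_def
    by (rule someI_ex[OF pvm_integral_exists[OF ctx assms pw_space_closed]])
  then have "bounded_op ?K X" by (simp add: is_pvm_integral_def)
  moreover have "pw_calculus \<phi> A B x = pw_T A B (X (pw_T A B x))" for x
    unfolding pw_calculus_def cadjoint_positive_op[OF pw_T_positive] X_def ..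
  moreover have "norm (X v - op_poly a n ?R v) \<le> e * norm v"
    if "\<forall>r\<in>{0..1}. \<bar>\<phi> (r, 1 - r) - (\<Sum>i\<le>n. a i * r ^ i)\<bar> \<le> e" "v \<in> ?K" for a n e v
    by (rule pvm_integral_op_poly_close[OF ctx X assms _ that(2)]) (use that(1) in blast)
  ultimately show ?thesis by (intro exI[of _ X]) auto
qed

lemma pw_calculus_bounded_op:
  fixes \<phi> :: "real \<times> real \<Rightarrow> real"
  assumes "continuous_on {0..1} (\<lambda>r. \<phi> (r, 1 - r))"
  shows "bounded_op UNIV (pw_calculus \<phi> A B)"
proof -
  let ?T = "pw_T A B"
  obtain X where X: "bounded_op (pw_space A B) X" "\<forall>x. pw_calculus \<phi> A B x = ?T (X (?T x))"
    using pw_calculus_eq[of \<phi>] assms by auto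
  note T = positive_opD(1)[OF csubspace_UNIV pw_T_positive]
  obtain M where M: "\<And>x. x \<in> pw_space A B \<Longrightarrow> norm (X x) \<le> M * norm x"
    using X(1) unfolding bounded_op_def by blast
  obtain N where N: "0 < N" "\<And>x. norm (?T x) \<le> N * norm x"
    using bounded_linear_rin_bound[OF positive_op_UNIV_D(2)[OF pw_T_positive]] by blast
  have "norm (?T (X (?T x))) \<le> N * \<bar>M\<bar> * N * norm x" for x
  proof -
    have "norm (?T (X (?T x))) \<le> N * norm (X (?T x))" by (rule N)
    also have "\<dots> \<le> N * (\<bar>M\<bar> * norm (?T x))"
      using M[OF pw_T_in_space, of x] mult_right_mono[OF abs_ge_self[of M] norm_ge_zero[of "?T x"]] N(1)
      by (intro mult_left_mono) auto
    also have "\<dots> \<le> N * (\<bar>M\<bar> * (N * norm x))" using N by (intro mult_left_mono) auto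
    finally show ?thesis by (simp add: mult.assoc)
  qed
  then show ?thesis
    unfolding bounded_op_def X(2)[rule_format]
    by (intro conjI ballI allI exI[of _ "N * \<bar>M\<bar> * N"])
      (auto simp: bounded_opD[OF T] bounded_opD[OF X(1)] pw_T_in_space)
qed

end

section \<open>Strong convergence\<close>

text \<open>Pointwise convergence alone would not let the argument move; the common bound M absorbs
  \<open>u n - v\<close>.\<close>

lemma sot_uniform_bound_tendsto:
  fixes T :: "nat \<Rightarrow> 'h::complex_hilbert \<Rightarrow> 'h"
  assumes T: "\<And>n. linear (T n)" and M: "\<And>n x. norm (T n x) \<le> M * norm x"
    and lim: "\<And>x. (\<lambda>n. T n x) \<longlonglongrightarrow> T' x" and u: "u \<longlonglongrightarrow> v"
  shows "(\<lambda>n. T n (u n)) \<longlonglongrightarrow> T' v"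
proof -
  have "(\<lambda>n. T n (u n - v)) \<longlonglongrightarrow> 0"
  proof (rule Lim_null_comparison)
    show "\<forall>\<^sub>F n in sequentially. norm (T n (u n - v)) \<le> M * norm (u n - v)" using M by simp
    have "(\<lambda>n. M * norm (u n - v)) \<longlonglongrightarrow> M * norm (v - v)" by (intro tendsto_intros u)
    then show "(\<lambda>n. M * norm (u n - v)) \<longlonglongrightarrow> 0" by simp
  qed
  from tendsto_add[OF this lim[of v]] show ?thesis by (simp add: linear_diff[OF T])
qed

lemma sqrt_iter_tendsto:
  fixes Z :: "nat \<Rightarrow> 'h::complex_hilbert \<Rightarrow> 'h"
  assumes Z: "\<And>n. linear (Z n)" "\<And>n x. norm (Z n x) \<le> norm x" and lim: "\<And>x. (\<lambda>n. Z n x) \<longlonglongrightarrow> Z' x"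
    and u: "u \<longlonglongrightarrow> v"
  shows "(\<lambda>n. sqrt_iter (Z n) k (u n)) \<longlonglongrightarrow> sqrt_iter Z' k v"
  using u
proof (induction k arbitrary: u v)
  case (Suc k)
  have "(\<lambda>n. Z n (u n)) \<longlonglongrightarrow> Z' v"
    by (rule sot_uniform_bound_tendsto[OF Z(1) _ lim Suc.prems, where M = 1]) (simp add: Z)
  then show ?case unfolding sqrt_iter.simps by (intro tendsto_intros Suc)
qed simp

lemma op_sqrt_tendsto:
  fixes C :: "nat \<Rightarrow> 'h::complex_hilbert \<Rightarrow> 'h"
  assumes C: "\<And>n. positive_op UNIV (C n)" and C': "positive_op UNIV C'" and M: "0 < M"
    and bd: "\<And>n x. rin (C n x) x \<le> M * (norm x)\<^sup>2" and bd': "\<And>x. rin (C' x) x \<le> M * (norm x)\<^sup>2"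
    and lim: "\<And>x. (\<lambda>n. C n x) \<longlonglongrightarrow> C' x"
  shows "(\<lambda>n. op_sqrt (C n) x) \<longlonglongrightarrow> op_sqrt C' x"
proof (rule LIMSEQ_I)
  fix e :: real assume e: "0 < e"
  have "(\<lambda>k. sqrt M * (1 - sqrt_rate k) * norm x) \<longlonglongrightarrow> sqrt M * (1 - 1) * norm x"
    by (intro tendsto_intros sqrt_rate_tendsto)
  then have "\<forall>\<^sub>F k in sequentially. sqrt M * (1 - sqrt_rate k) * norm x < e / 3"
    using e by (intro order_tendstoD(2)[where y = "sqrt M * (1 - 1) * norm x"]) auto
  \<comment> \<open>This k depends on M, x and e but not on n, so one polynomial serves all the
    operators.\<close>
  then obtain k where k: "sqrt M * (1 - sqrt_rate k) * norm x < e / 3"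
    by (auto simp: eventually_sequentially)
  let ?Z = "\<lambda>n x. x - (1 / M) *\<^sub>R C n x" and ?Z' = "\<lambda>x. x - (1 / M) *\<^sub>R C' x"
  note Z = pos_sym_contraction_complement[OF positive_op_UNIV_D(1)[OF C] M bd]
  have "(\<lambda>n. sqrt_iter (?Z n) k x) \<longlonglongrightarrow> sqrt_iter ?Z' k x"
  proof (rule sqrt_iter_tendsto)
    show "linear (?Z n)" for n using Z(1) by (simp add: sym_op_def bounded_linear.linear)
    show "norm (?Z n x) \<le> norm x" for n x by (rule Z(2))
    show "(\<lambda>n. ?Z n x) \<longlonglongrightarrow> ?Z' x" for x by (intro tendsto_intros lim)
  qed simp
  then have "(\<lambda>n. sqrt_approx M (C n) k x) \<longlonglongrightarrow> sqrt_approx M C' k x"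
    unfolding sqrt_approx_def by (intro tendsto_intros)
  then obtain N where N: "\<And>n. N \<le> n \<Longrightarrow> norm (sqrt_approx M (C n) k x - sqrt_approx M C' k x) < e / 3"
    using LIMSEQ_D[of _ _ "e / 3"] e by (metis divide_pos_pos zero_less_numeral)
  show "\<exists>N. \<forall>n\<ge>N. norm (op_sqrt (C n) x - op_sqrt C' x) < e"
  proof (intro exI allI impI)
    fix n assume n: "N \<le> n"
    let ?a = "op_sqrt (C n) x - sqrt_approx M (C n) k x"
      and ?b = "sqrt_approx M (C n) k x - sqrt_approx M C' k x" and ?c = "op_sqrt C' x - sqrt_approx M C' k x"
    have a: "norm ?a \<le> sqrt M * (1 - sqrt_rate k) * norm x" by (rule op_sqrt(3)[OF C M bd])
    have c: "norm ?c \<le> sqrt M * (1 - sqrt_rate k) * norm x" by (rule op_sqrt(3)[OF C' M bd'])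
    have "norm (op_sqrt (C n) x - op_sqrt C' x) = norm (?a + ?b - ?c)" by (simp add: algebra_simps)
    also have "\<dots> \<le> norm ?a + norm ?b + norm ?c"
      using norm_triangle_ineq4[of "?a + ?b" ?c] norm_triangle_ineq[of ?a ?b] by linarith
    also have "\<dots> < e" using a c k N[OF n] by linarith
    finally show "norm (op_sqrt (C n) x - op_sqrt C' x) < e" .
  qed
qed

text \<open>With \<open>u = T y\<close>, \<open>v = T x\<close> and \<open>S = 1 - R\<close> this is
  \<open>\<langle>R u, u\<rangle> + \<langle>S (v - u), v - u\<rangle> = \<parallel>u - S v\<parallel>\<^sup>2 + \<langle>R S v, v\<rangle>\<close>: the parallel sum of \<open>A\<close> and \<open>B\<close>
  is \<open>T\<^sup>* R (1 - R) T\<close>.\<close>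

lemma parallel_sum_identity:
  assumes A: "positive_op UNIV A" and B: "positive_op UNIV B"
  defines "T \<equiv> pw_T A B" and "R \<equiv> pw_R A B"
  shows "rin (A y) y + rin (B (x - y)) (x - y) =
    (norm (T y - (T x - R (T x))))\<^sup>2 + (rin (A x) x - (norm (R (T x)))\<^sup>2)"
proof -
  note K = pw_space_csubspace[OF A B] and R = pw_R(1)[OF A B, folded R_def]
  have TK: "T z \<in> pw_space A B" for z unfolding T_def by (rule pw_T_in_space[OF A B])
  have rA: "rin (R (T u)) (T v) = rin (A u) v" for u v unfolding T_def R_def by (rule pw_R(3)[OF A B])
  have rB: "rin (B u) v = rin (T u) (T v) - rin (A u) v" for u v
    unfolding T_def using pw_T_rin[OF A B] by simp
  have Td: "T (x - y) = T x - T y" unfolding T_def by (rule positive_op_UNIV_D(7)[OF pw_T_positive[OF A B]])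
  have As: "rin (A x) y = rin (A y) x" using positive_op_UNIV_D(3)[OF A, of x y] rin_commute[of x "A y"] by simp
  have c: "rin (T y) (R (T x)) = rin (A x) y" "rin (T x) (R (T x)) = rin (A x) x"
    using rA rin_commute by metis+
  have "rin (A y) y + rin (B (x - y)) (x - y) =
      (norm (T y))\<^sup>2 + (norm (T x))\<^sup>2 - 2 * rin (T y) (T x) - rin (A x) x + 2 * rin (A x) y"
    unfolding rB Td rin_self norm_diff_sq positive_op_UNIV_D(7)[OF A]
    by (simp add: rin_simps As rin_commute[of "T x" "T y"])
  moreover have "(norm (T y - (T x - R (T x))))\<^sup>2 =
      (norm (T y))\<^sup>2 - 2 * (rin (T y) (T x) - rin (A x) y) + ((norm (T x))\<^sup>2 - 2 * rin (A x) x + (norm (R (T x)))\<^sup>2)"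
    unfolding norm_diff_sq rin_diff_right c by simp
  ultimately show ?thesis by simp
qed

section \<open>Limits along decreasing sequences\<close>

lemma closure_approx:
  fixes v :: "'a::real_normed_vector"
  assumes "v \<in> closure S" "0 < e"
  obtains s where "s \<in> S" "norm (v - s) < e"
  using assms closure_approachable[of v S] by (auto simp: dist_norm norm_minus_commute)

text \<open>The test vectors \<open>T n y\<close> move with n, but they converge to
  \<open>T' y\<close>; the common bound on the \<open>w n\<close> makes the replacement
  harmless.\<close>

lemma weak_tendsto_of_dense:
  assumes w: "\<And>n. norm (w n) \<le> M" and T: "\<And>y. (\<lambda>n. T n y) \<longlonglongrightarrow> T' y"
    and lim: "\<And>y. (\<lambda>n. rin (w n) (T n y)) \<longlonglongrightarrow> rin w' (T' y)" and v: "v \<in> closure (range T')"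
  shows "(\<lambda>n. rin (w n) v) \<longlonglongrightarrow> rin w' v"
proof (rule LIMSEQ_I)
  fix e :: real assume e: "0 < e"
  have M0: "0 \<le> M" using w[of 0] norm_ge_zero order_trans by blast
  \<comment> \<open>N dominates both norms multiplied by d, so the two replacement errors together
    stay below d N = e/3; the summand 1 keeps N positive.\<close>
  define N where "N = M + norm w' + 1"
  define d where "d = e / (3 * N)"
  have p: "0 < N" unfolding N_def using M0 norm_ge_zero[of w'] by linarith
  have d: "0 < d" using e p by (simp add: d_def)
  obtain y where y: "norm (v - T' y) < d" using closure_approx[OF v d] by blast
  have "(\<lambda>n. norm (v - T n y)) \<longlonglongrightarrow> norm (v - T' y)" by (intro tendsto_intros T)
  from order_tendstoD(2)[OF this y] have ev1: "\<forall>\<^sub>F n in sequentially. norm (v - T n y) < d" .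
  have ev2: "\<forall>\<^sub>F n in sequentially. dist (rin (w n) (T n y)) (rin w' (T' y)) < e / 3"
    by (rule tendstoD[OF lim]) (use e in simp)
  have "\<forall>\<^sub>F n in sequentially. norm (rin (w n) v - rin w' v) < e"
    using ev1 ev2
  proof eventually_elim
    case (elim n)
    have "rin (w n) v - rin w' v = rin (w n) (v - T n y) + (rin (w n) (T n y) - rin w' (T' y)) - rin w' (v - T' y)"
      by (simp add: rin_diff_right)
    then have "\<bar>rin (w n) v - rin w' v\<bar> \<le> \<bar>rin (w n) (v - T n y)\<bar> + \<bar>rin (w n) (T n y) - rin w' (T' y)\<bar> + \<bar>rin w' (v - T' y)\<bar>"
      by linarith
    moreover have "\<bar>rin (w n) (v - T n y)\<bar> \<le> M * d"
      by (rule order_trans[OF rin_cauchy_schwarz]) (intro mult_mono w, use elim(1) M0 in auto)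
    moreover have "\<bar>rin w' (v - T' y)\<bar> \<le> norm w' * d"
      by (rule order_trans[OF rin_cauchy_schwarz]) (intro mult_left_mono, use y in auto)
    moreover have "M * d + norm w' * d \<le> e / 3"
    proof -
      have "M * d + norm w' * d \<le> N * d" using d by (simp add: N_def algebra_simps)
      also have "\<dots> = e / 3" using p by (simp add: d_def)
      finally show ?thesis .
    qed
    ultimately show ?case using elim(2) e by (simp add: dist_real_def)
  qed
  then show "\<exists>N. \<forall>n\<ge>N. norm (rin (w n) v - rin w' v) < e" by (simp add: eventually_sequentially)
qed

lemma op_le_rin: "op_le A B \<Longrightarrow> rin (A x) x \<le> rin (B x) x"
  using positive_op_UNIV_D(4)[of "\<lambda>x. B x - A x" x] by (simp add: op_le_def rin_diff_left)

lemma sot_decreasing_to_rin: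
  assumes "sot_decreasing_to X Y"
  shows "(\<lambda>n. X n x) \<longlonglongrightarrow> Y x" "rin (Y x) x \<le> rin (X n x) x" "rin (X n x) x \<le> rin (X 0 x) x"
proof -
  have dec: "rin (X (Suc n) x) x \<le> rin (X n x) x" for n
    using assms by (intro op_le_rin) (simp add: sot_decreasing_to_def)
  show lim: "(\<lambda>n. X n x) \<longlonglongrightarrow> Y x" using assms by (simp add: sot_decreasing_to_def sot_tendsto_def)
  have anti: "rin (X n x) x \<le> rin (X m x) x" if "m \<le> n" for m n
    using lift_Suc_antimono_le[of "\<lambda>n. rin (X n x) x", OF dec that] .
  then show "rin (X n x) x \<le> rin (X 0 x) x" by simp
  show "rin (Y x) x \<le> rin (X n x) x"
    by (rule LIMSEQ_le_const2[OF tendsto_rin[OF lim tendsto_const]]) (use anti in blast)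
qed

context
  fixes A B :: "'h::complex_hilbert \<Rightarrow> 'h" and An Bn :: "nat \<Rightarrow> 'h \<Rightarrow> 'h"
  assumes A: "positive_op UNIV A" and B: "positive_op UNIV B"
    and An: "\<And>n. positive_op UNIV (An n)" and Bn: "\<And>n. positive_op UNIV (Bn n)"
    and Alim: "sot_decreasing_to An A" and Blim: "sot_decreasing_to Bn B"
begin

text \<open>The operators of index 0 dominate all others and the limits.\<close>

lemma pw_T_uniform_bound:
  "\<exists>M>0. (\<forall>n x. rin (An n x + Bn n x) x \<le> M * (norm x)\<^sup>2) \<and> (\<forall>x. rin (A x + B x) x \<le> M * (norm x)\<^sup>2)"
proof -
  obtain M where M: "0 < M" "\<And>x. \<bar>rin (An 0 x + Bn 0 x) x\<bar> \<le> M * (norm x)\<^sup>2"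
    using bounded_linear_rin_bound[OF positive_op_UNIV_D(2)[OF pw_sum_positive[OF An Bn]], of 0 0] by blast
  have 0: "rin (An 0 x + Bn 0 x) x \<le> M * (norm x)\<^sup>2" for x using M(2)[of x] by linarith
  have "rin (An n x + Bn n x) x \<le> M * (norm x)\<^sup>2" for n x
    using 0[of x] sot_decreasing_to_rin(3)[OF Alim, of n x] sot_decreasing_to_rin(3)[OF Blim, of n x]
    by (simp add: rin_add_left)
  moreover have "rin (A x + B x) x \<le> M * (norm x)\<^sup>2" for x
    using 0[of x] sot_decreasing_to_rin(2)[OF Alim, of x 0] sot_decreasing_to_rin(2)[OF Blim, of x 0]
    by (simp add: rin_add_left)
  ultimately show ?thesis using M(1) by blast
qed

lemma pw_T_tendsto: "(\<lambda>n. pw_T (An n) (Bn n) x) \<longlonglongrightarrow> pw_T A B x"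
proof -
  obtain M where M: "0 < M" "\<And>n x. rin (An n x + Bn n x) x \<le> M * (norm x)\<^sup>2"
    "\<And>x. rin (A x + B x) x \<le> M * (norm x)\<^sup>2"
    using pw_T_uniform_bound by blast
  show ?thesis unfolding pw_T_def
    by (rule op_sqrt_tendsto[OF pw_sum_positive[OF An Bn] pw_sum_positive[OF A B] M])
      (intro tendsto_add sot_decreasing_to_rin(1)[OF Alim] sot_decreasing_to_rin(1)[OF Blim])
qed

lemma pw_T_norm_bound: "\<exists>M. \<forall>n x. norm (pw_T (An n) (Bn n) x) \<le> M * norm x"
proof -
  obtain M where M: "0 < M" "\<And>n x. rin (An n x + Bn n x) x \<le> M * (norm x)\<^sup>2"
    using pw_T_uniform_bound by blast
  have "norm (pw_T (An n) (Bn n) x) \<le> sqrt M * norm x" for n x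
  proof (rule power2_le_imp_le)
    have "(norm (pw_T (An n) (Bn n) x))\<^sup>2 \<le> M * (norm x)\<^sup>2"
      using M(2)[of n x] by (simp add: pw_T_norm_sq[OF An Bn] rin_add_left)
    then show "(norm (pw_T (An n) (Bn n) x))\<^sup>2 \<le> (sqrt M * norm x)\<^sup>2"
      using M(1) by (simp add: power_mult_distrib)
  qed (use M(1) in simp)
  then show ?thesis by blast
qed

text \<open>Infima over \<open>n\<close> and over \<open>y\<close> commute, so the parallel sums \<open>T\<^sub>n\<^sup>* R\<^sub>n (1 - R\<^sub>n) T\<^sub>n\<close>
  converge; this is where monotonicity is used.\<close>

lemma pw_RT_norm_tendsto:
  "(\<lambda>n. (norm (pw_R (An n) (Bn n) (pw_T (An n) (Bn n) x)))\<^sup>2) \<longlonglongrightarrow> (norm (pw_R A B (pw_T A B x)))\<^sup>2"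
proof -
  define q where "q n = rin (An n x) x - (norm (pw_R (An n) (Bn n) (pw_T (An n) (Bn n) x)))\<^sup>2" for n
  define q' where "q' = rin (A x) x - (norm (pw_R A B (pw_T A B x)))\<^sup>2"
  define s where "s n y = rin (An n y) y + rin (Bn n (x - y)) (x - y)" for n y
  define s' where "s' y = rin (A y) y + rin (B (x - y)) (x - y)" for y
  have ge: "q' \<le> s' y" for y
    unfolding q'_def s'_def parallel_sum_identity[OF A B, of y x] by simp
  have gen: "q n \<le> s n y" for n y
    unfolding q_def s_def parallel_sum_identity[OF An[of n] Bn[of n], of y x] by simp
  \<comment> \<open>The infimum need not be attained. Its optimal value of T y would be (1 - R) T x,
    which lies in the closed range of \<open>T\<close> and is approximated within
    \<open>sqrt e\<close>.\<close>
  have near: "\<exists>y. rin (C y) y + rin (D (x - y)) (x - y) < rin (C x) x - (norm (pw_R C D (pw_T C D x)))\<^sup>2 + e"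
    if C: "positive_op UNIV C" and D: "positive_op UNIV D" and e: "0 < e" for C D e
  proof -
    let ?v = "pw_T C D x - pw_R C D (pw_T C D x)"
    have "?v \<in> pw_space C D"
      by (intro csubspaceD(5)[OF pw_space_csubspace[OF C D]] pw_T_in_space[OF C D]
          bounded_opD(1)[OF pw_R_bounded_op[OF C D]])
    then obtain y where "norm (?v - pw_T C D y) < sqrt e"
      using closure_approx[of ?v "range (pw_T C D)" "sqrt e"] e by (auto simp: pw_space_eq[OF C D])
    then have "(norm (pw_T C D y - ?v))\<^sup>2 < (sqrt e)\<^sup>2"
      by (intro power_strict_mono) (simp_all add: norm_minus_commute)
    then show ?thesis using e
      by (intro exI[of _ y]) (simp add: parallel_sum_identity[OF C D, of y x])
  qed
  have mono: "s' y \<le> s n y" for n y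
    unfolding s_def s'_def
    by (intro add_mono sot_decreasing_to_rin(2)[OF Alim] sot_decreasing_to_rin(2)[OF Blim])
  have "q \<longlonglongrightarrow> q'"
  proof (rule order_tendstoI)
    fix a assume a: "a < q'"
    \<comment> \<open>Lower bound: a nearly optimal y for index n also competes in the limit
      problem, where its value is no larger because the limits lie below \<open>An n\<close> and
      \<open>Bn n\<close>.\<close>
    have "q' \<le> q n" for n
    proof (rule field_le_epsilon)
      fix e :: real assume "0 < e"
      then obtain y where "s n y < q n + e" using near[OF An[of n] Bn[of n], of e] by (auto simp: s_def q_def)
      with ge[of y] mono[of y n] show "q' \<le> q n + e" by linarith
    qed
    with a have "a < q n" for n by (rule order.strict_trans2)
    then show "\<forall>\<^sub>F n in sequentially. a < q n" by simp
  next
    fix a assume "q' < a"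
    \<comment> \<open>Upper bound: y is nearly optimal for the limit and held fixed, so plain
      convergence of the forms at y suffices.\<close>
    then obtain y where y: "s' y < a" using near[OF A B, of "a - q'"] by (auto simp: s'_def q'_def)
    have "(\<lambda>n. s n y) \<longlonglongrightarrow> s' y"
      unfolding s_def s'_def
      by (intro tendsto_add tendsto_rin tendsto_const sot_decreasing_to_rin(1)[OF Alim]
          sot_decreasing_to_rin(1)[OF Blim])
    from order_tendstoD(2)[OF this y] show "\<forall>\<^sub>F n in sequentially. q n < a"
      by eventually_elim (use gen order.strict_trans1 in blast)
  qed
  moreover have "(\<lambda>n. rin (An n x) x) \<longlonglongrightarrow> rin (A x) x"
    by (intro tendsto_rin tendsto_const sot_decreasing_to_rin(1)[OF Alim])
  ultimately have "(\<lambda>n. rin (An n x) x - q n) \<longlonglongrightarrow> rin (A x) x - q'" by (intro tendsto_diff)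
  then show ?thesis by (simp add: q_def q'_def)
qed

text \<open>In ||w_n - w'||^2 = ||w_n||^2 - 2 <w_n, w'> + ||w'||^2 weak convergence is needed only
  at the single vector w', which lies in the closed range of \<open>T'\<close>. Against
  \<open>T_n y\<close> it reads <A_n x, y> \<rightarrow> <A x, y>.\<close>

lemma pw_RT_tendsto:
  "(\<lambda>n. pw_R (An n) (Bn n) (pw_T (An n) (Bn n) x)) \<longlonglongrightarrow> pw_R A B (pw_T A B x)"
proof -
  let ?T = "\<lambda>n. pw_T (An n) (Bn n)" and ?T' = "pw_T A B"
  define w where "w n = pw_R (An n) (Bn n) (?T n x)" for n
  define w' where "w' = pw_R A B (?T' x)"
  obtain M where M: "\<And>n x. norm (?T n x) \<le> M * norm x" using pw_T_norm_bound by blast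
  have wM: "norm (w n) \<le> M * norm x" for n
    unfolding w_def using contractionD[OF pw_R(2)[OF An Bn] pw_T_in_space[OF An Bn]] M order_trans by blast
  have "w' \<in> pw_space A B" unfolding w'_def
    by (intro bounded_opD(1)[OF pw_R_bounded_op[OF A B]] pw_T_in_space[OF A B])
  then have w': "w' \<in> closure (range ?T')" by (simp add: pw_space_eq[OF A B])
  have "(\<lambda>n. rin (w n) w') \<longlonglongrightarrow> rin w' w'"
  proof (rule weak_tendsto_of_dense[OF wM pw_T_tendsto _ w'])
    show "(\<lambda>n. rin (w n) (?T n y)) \<longlonglongrightarrow> rin w' (?T' y)" for y
      unfolding w_def w'_def pw_R(3)[OF An Bn] pw_R(3)[OF A B]
      by (intro tendsto_rin tendsto_const sot_decreasing_to_rin(1)[OF Alim])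
  qed
  moreover have "(\<lambda>n. (norm (w n))\<^sup>2) \<longlonglongrightarrow> (norm w')\<^sup>2"
    unfolding w_def w'_def by (rule pw_RT_norm_tendsto)
  ultimately have "(\<lambda>n. (norm (w n))\<^sup>2 - 2 * rin (w n) w' + (norm w')\<^sup>2)
      \<longlonglongrightarrow> (norm w')\<^sup>2 - 2 * rin w' w' + (norm w')\<^sup>2"
    by (intro tendsto_add tendsto_diff tendsto_mult tendsto_const)
  moreover have "(norm w')\<^sup>2 - 2 * rin w' w' + (norm w')\<^sup>2 = 0" by (simp add: rin_self)
  ultimately have "(\<lambda>n. (norm (w n - w'))\<^sup>2) \<longlonglongrightarrow> 0" by (simp only: norm_diff_sq)
  from tendsto_real_sqrt[OF this] have "(\<lambda>n. norm (w n - w')) \<longlonglongrightarrow> 0" by simp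
  then have "(\<lambda>n. w n - w') \<longlonglongrightarrow> 0" by (rule tendsto_norm_zero_cancel)
  then show ?thesis unfolding w_def w'_def by (rule LIM_zero_cancel)
qed

text \<open>Approximate u' by some T y. For large n the vectors \<open>u n\<close> and
  \<open>T_n y\<close> are equally close, and both lie in the space of index n, where
  \<open>R_n\<close> is a contraction.\<close>

lemma pw_R_tendsto:
  assumes u: "\<And>n. u n \<in> pw_space (An n) (Bn n)" and u': "u' \<in> pw_space A B" and lim: "u \<longlonglongrightarrow> u'"
  shows "(\<lambda>n. pw_R (An n) (Bn n) (u n)) \<longlonglongrightarrow> pw_R A B u'"
proof (rule LIMSEQ_I)
  let ?T = "\<lambda>n. pw_T (An n) (Bn n)" and ?R = "\<lambda>n. pw_R (An n) (Bn n)"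
  let ?T' = "pw_T A B" and ?R' = "pw_R A B"
  fix e :: real assume e: "0 < e"
  then obtain y where y: "norm (u' - ?T' y) < e / 3"
    using closure_approx[of u' "range ?T'" "e / 3"] u' by (auto simp: pw_space_eq[OF A B])
  have "(\<lambda>n. norm (u n - ?T n y)) \<longlonglongrightarrow> norm (u' - ?T' y)" by (intro tendsto_intros lim pw_T_tendsto)
  from order_tendstoD(2)[OF this y] have ev1: "\<forall>\<^sub>F n in sequentially. norm (u n - ?T n y) < e / 3" .
  have ev2: "\<forall>\<^sub>F n in sequentially. dist (?R n (?T n y)) (?R' (?T' y)) < e / 3"
    by (rule tendstoD[OF pw_RT_tendsto]) (use e in simp)
  have d: "norm (pw_R C D v - pw_R C D w) \<le> norm (v - w)"
    if C: "positive_op UNIV C" and D: "positive_op UNIV D" and "v \<in> pw_space C D" "w \<in> pw_space C D" for C D v w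
    using contractionD[OF pw_R(2)[OF C D] csubspaceD(5)[OF pw_space_csubspace[OF C D] that(3,4)]]
    by (simp add: bounded_op_diff[OF pw_space_csubspace[OF C D]
          pw_R_bounded_op[OF C D] that(3,4)])
  have "\<forall>\<^sub>F n in sequentially. norm (?R n (u n) - ?R' u') < e"
    using ev1 ev2
  proof eventually_elim
    case (elim n)
    have "norm (?R n (u n) - ?R' u') \<le> norm (?R n (u n) - ?R n (?T n y)) +
        norm (?R n (?T n y) - ?R' (?T' y)) + norm (?R' u' - ?R' (?T' y))"
      using norm_triangle_ineq4[of "(?R n (u n) - ?R n (?T n y)) + (?R n (?T n y) - ?R' (?T' y))" "?R' u' - ?R' (?T' y)"]
        norm_triangle_ineq[of "?R n (u n) - ?R n (?T n y)" "?R n (?T n y) - ?R' (?T' y)"] by simp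
    with d[OF An Bn u pw_T_in_space[OF An Bn], of n y] d[OF A B u' pw_T_in_space[OF A B], of y] elim y
    show ?case unfolding dist_norm by linarith
  qed
  then show "\<exists>N. \<forall>n\<ge>N. norm (?R n (u n) - ?R' u') < e" by (simp add: eventually_sequentially)
qed

lemma pw_op_poly_tendsto:
  "(\<lambda>n. op_poly a m (pw_R (An n) (Bn n)) (pw_T (An n) (Bn n) x)) \<longlonglongrightarrow> op_poly a m (pw_R A B) (pw_T A B x)"
proof -
  have mem: "(pw_R C D ^^ k) (pw_T C D x) \<in> pw_space C D"
    if C: "positive_op UNIV C" and D: "positive_op UNIV D" for C D k
    by (rule bounded_opD(1)[OF bounded_op_funpow(1)[OF pw_R_bounded_op[OF C D] pw_R(2)[OF C D]] pw_T_in_space[OF C D]])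
  have "(\<lambda>n. (pw_R (An n) (Bn n) ^^ k) (pw_T (An n) (Bn n) x)) \<longlonglongrightarrow> (pw_R A B ^^ k) (pw_T A B x)" for k
  proof (induction k)
    case 0
    show ?case by (simp add: pw_T_tendsto)
  next
    case (Suc k)
    show ?case using pw_R_tendsto[OF mem[OF An Bn] mem[OF A B] Suc] by simp
  qed
  then show ?thesis unfolding op_poly_def by (intro tendsto_intros)
qed

lemma pw_calculus_tendsto:
  fixes \<phi> :: "real \<times> real \<Rightarrow> real"
  assumes f: "continuous_on {0..1} (\<lambda>r. \<phi> (r, 1 - r))"
  shows "(\<lambda>n. pw_calculus \<phi> (An n) (Bn n) x) \<longlonglongrightarrow> pw_calculus \<phi> A B x"
proof -
  let ?T = "\<lambda>n. pw_T (An n) (Bn n)" and ?R = "\<lambda>n. pw_R (An n) (Bn n)"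
  let ?T' = "pw_T A B" and ?R' = "pw_R A B"
  let ?close = "\<lambda>a m e. \<forall>r\<in>{0..1}. \<bar>\<phi> (r, 1 - r) - (\<Sum>i\<le>m. a i * r ^ i)\<bar> \<le> (e::real)"
  have "\<forall>n. \<exists>X. (\<forall>x. pw_calculus \<phi> (An n) (Bn n) x = ?T n (X (?T n x))) \<and>
    (\<forall>a m e. ?close a m e \<longrightarrow> (\<forall>v\<in>pw_space (An n) (Bn n). norm (X v - op_poly a m (?R n) v) \<le> e * norm v))"
    using pw_calculus_eq[OF An Bn f] by blast
  from choice[OF this] obtain X where X: "\<And>n x. pw_calculus \<phi> (An n) (Bn n) x = ?T n (X n (?T n x))"
    "\<And>n a m e v. ?close a m e \<Longrightarrow> v \<in> pw_space (An n) (Bn n) \<Longrightarrow> norm (X n v - op_poly a m (?R n) v) \<le> e * norm v"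
    by blast
  obtain X' where X': "\<And>x. pw_calculus \<phi> A B x = ?T' (X' (?T' x))"
    "\<And>a m e v. ?close a m e \<Longrightarrow> v \<in> pw_space A B \<Longrightarrow> norm (X' v - op_poly a m ?R' v) \<le> e * norm v"
    using pw_calculus_eq[OF A B f] by blast
  obtain M where M: "\<And>n x. norm (?T n x) \<le> M * norm x" using pw_T_norm_bound by blast
  \<comment> \<open>A bound for all the norms \<open>?T n x\<close> and \<open>?T' x\<close>; the
    summand 1 makes division by N legitimate.\<close>
  define N where "N = \<bar>M\<bar> * norm x + norm (?T' x) + 1"
  have N: "0 < N" "norm (?T n x) \<le> N" "norm (?T' x) \<le> N" for n
  proof -
    have "norm (?T n x) \<le> \<bar>M\<bar> * norm x"
      by (rule order_trans[OF M]) (simp add: mult_right_mono)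
    then show "norm (?T n x) \<le> N" unfolding N_def using norm_ge_zero[of "?T' x"] by linarith
    show "0 < N" "norm (?T' x) \<le> N" by (simp_all add: N_def add_nonneg_pos)
  qed
  have inner: "(\<lambda>n. X n (?T n x)) \<longlonglongrightarrow> X' (?T' x)"
  proof (rule LIMSEQ_I)
    fix e :: real assume e: "0 < e"
    define d where "d = e / (3 * N)"
    have d: "0 < d" "d * N = e / 3" using e N(1) by (simp_all add: d_def)
    \<comment> \<open>One polynomial is chosen for all n and for the limit, since the approximation
      error depends only on \<phi>.\<close>
    obtain a m where am: "?close a m d" using polynomial_approximation[OF f d(1)] by blast
    have "\<forall>\<^sub>F n in sequentially. dist (op_poly a m (?R n) (?T n x)) (op_poly a m ?R' (?T' x)) < e / 3"
      by (rule tendstoD[OF pw_op_poly_tendsto]) (use e in simp)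
    then have "\<forall>\<^sub>F n in sequentially. norm (X n (?T n x) - X' (?T' x)) < e"
    proof eventually_elim
      case (elim n)
      let ?p = "op_poly a m (?R n) (?T n x)" and ?p' = "op_poly a m ?R' (?T' x)"
      have "norm (X n (?T n x) - ?p) \<le> d * norm (?T n x)" by (rule X(2)[OF am pw_T_in_space[OF An Bn]])
      also have "\<dots> \<le> d * N" using d(1) N(2)[of n] by (intro mult_left_mono) auto
      finally have 1: "norm (X n (?T n x) - ?p) \<le> e / 3" by (simp add: d(2))
      have "norm (X' (?T' x) - ?p') \<le> d * norm (?T' x)" by (rule X'(2)[OF am pw_T_in_space[OF A B]])
      also have "\<dots> \<le> d * N" using d(1) N(3) by (intro mult_left_mono) auto
      finally have 2: "norm (X' (?T' x) - ?p') \<le> e / 3" by (simp add: d(2))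
      have "norm (X n (?T n x) - X' (?T' x)) \<le> norm (X n (?T n x) - ?p) + norm (?p - ?p') + norm (X' (?T' x) - ?p')"
        using norm_triangle_ineq4[of "(X n (?T n x) - ?p) + (?p - ?p')" "X' (?T' x) - ?p'"]
          norm_triangle_ineq[of "X n (?T n x) - ?p" "?p - ?p'"] by simp
      with 1 2 elim show ?case unfolding dist_norm by linarith
    qed
    then show "\<exists>N. \<forall>n\<ge>N. norm (X n (?T n x) - X' (?T' x)) < e" by (simp add: eventually_sequentially)
  qed
  show ?thesis unfolding X(1) X'(1)
    by (rule sot_uniform_bound_tendsto[OF _ M pw_T_tendsto inner])
      (rule bounded_linear.linear[OF positive_op_UNIV_D(2)[OF pw_T_positive[OF An Bn]]])
qed

end

theorem theorem6p1:
  fixes \<phi> :: "real \<times> real \<Rightarrow> real"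
    and A B :: "'h::complex_hilbert \<Rightarrow> 'h"
    and An Bn :: "nat \<Rightarrow> 'h \<Rightarrow> 'h"
  assumes "continuous_on ({0..} \<times> {0..}) \<phi>"
    and "homogeneous \<phi>"
    and "positive_op UNIV A"
    and "positive_op UNIV B"
    and "\<And>n. positive_op UNIV (An n)"
    and "\<And>n. positive_op UNIV (Bn n)"
    and "sot_decreasing_to An A"
    and "sot_decreasing_to Bn B"
  shows "(\<forall>n. bounded_op UNIV (pw_calculus \<phi> (An n) (Bn n))) \<and>
    bounded_op UNIV (pw_calculus \<phi> A B) \<and>
    sot_tendsto (\<lambda>n. pw_calculus \<phi> (An n) (Bn n)) (pw_calculus \<phi> A B)"
proof -
  have f: "continuous_on {0..1} (\<lambda>r. \<phi> (r, 1 - r))"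
    by (rule continuous_on_compose2[OF assms(1)]) (auto intro!: continuous_intros)
  show ?thesis
    using pw_calculus_bounded_op[OF assms(5,6) f] pw_calculus_bounded_op[OF assms(3,4) f]
      pw_calculus_tendsto[OF assms(3-8) f]
    by (simp add: sot_tendsto_def)
qed

end
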